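(* Let $n\ge 0$ and let $Q$ be a Dynkin quiver of type $\mathbb{A}_{n+2}$. The functor $F$, given on objects by $F(\gamma(i,j))=M(i+1,j)$, induces a bijection $$F\colon\{\text{triangulations of }P(Q)\}\to \mathrm{mar}(Q),\qquad \mathcal{T}\mapsto \bigoplus_{\gamma(i,j)\in\mathcal{T}} M(i+1,j),$$ where $\mathrm{mar}(Q)$ is the set of (isomorphism classes of) maximal almost rigid representations of $Q$.
   Context: $\Bbbk$ is an algebraically closed field. A Dynkin quiver $Q$ of type $\mathbb{A}_{n+2}$ has vertices $1,\dots,n+2$ and, for each $1\le i\le n+1$, exactly one arrow between $i$ and $i+1$, in either direction. Representations are finite-dimensional over $\Bbbk$. For $1\le i\le j\le n+2$, $M(i,j)$ is the indecomposable representation with $\Bbbk$ at the vertices $i,\dots,j$ and $0$ elsewhere, with identity maps between the nonzero spaces. Polygon $P(Q)$: put $\overline{[n+1]}=\{i\in[n+1] : i\to (i+1)\text{ in }Q\}$ and $\underline{[n+1]}=\{i\in[n+1]: i\leftarrow (i+1)\text{ in }Q\}$, where $[n+1]=\{1,\dots,n+1\}$. $P(Q)$ is a convex $(n+3)$-gon with vertices labeled $0,1,\dots,n+2$ placed from left to right in this order, with $0$ and $n+2$ on a common horizontal line $L$, the vertices in $\overline{[n+1]}$ above $L$ and those in $\underline{[n+1]}$ below $L$. For $0\le i<j\le n+2$, $\gamma(i,j)$ is the line segment between vertices $i$ and $j$. A triangulation of $P(Q)$ is a maximal set of pairwise noncrossing line segments $\gamma(i,j)$; it includes all boundary edges. A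 representation $T$ is basic if it has no repeated indecomposable direct summands (up to isomorphism). $T$ is almost rigid if it is basic and for each pair $A,B$ of indecomposable summands of $T$, either $\mathrm{Ext}^1(A,B)=0$, or $\mathrm{Ext}^1(A,B)\cong\Bbbk$ and it is generated by a short exact sequence $0\to B\to E\to A\to 0$ whose middle term $E$ is indecomposable. $T$ is maximal almost rigid if $T$ is almost rigid and, for every nonzero representation $M$, $T\oplus M$ is not almost rigid. *)

theory Defs
  imports
    "HOL-Analysis.Line_Segment"
    "HOL-Computational_Algebra.Polynomial"
    "Jordan_Normal_Form.Matrix"
begin

section \<open>Representations of a quiver\<close>

text \<open>
  A quiver without parallel arrows on the vertices \<open>1, \<dots>, N\<close> is given by its set
  \<open>Q\<close> of arrows, the pair \<open>(s, t)\<close> being an arrow from \<open>s\<close> to \<open>t\<close>.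
\<close>

definition dynkin_quiver_A :: "nat \<Rightarrow> (nat \<times> nat) set \<Rightarrow> bool" where
  "dynkin_quiver_A N Q \<longleftrightarrow>
     (\<forall>(s, t) \<in> Q. \<exists>i \<in> {1..<N}. (s, t) = (i, i + 1) \<or> (s, t) = (i + 1, i)) \<and>
     (\<forall>i \<in> {1..<N}. ((i, i + 1) \<in> Q) \<noteq> ((i + 1, i) \<in> Q))"

text \<open>
  Choosing bases, a finite-dimensional representation is given by the dimensions of the
  spaces at the vertices and by a matrix for every arrow (acting on column vectors).  Values at
  non-vertices and non-arrows are irrelevant: they are ignored by all notions below, in particular
  by \<open>isomorphic\<close>.
\<close>

record 'k rep =
  vdim :: "nat \<Rightarrow> nat"
  amap :: "nat \<times> nat \<Rightarrow> 'k mat"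

type_synonym 'k family = "nat \<Rightarrow> 'k mat"

definition is_rep :: "nat \<Rightarrow> (nat \<times> nat) set \<Rightarrow> 'k rep \<Rightarrow> bool" where
  "is_rep N Q R \<longleftrightarrow> (\<forall>(s, t) \<in> Q. amap R (s, t) \<in> carrier_mat (vdim R t) (vdim R s))"

definition is_zero_rep :: "nat \<Rightarrow> 'k rep \<Rightarrow> bool" where
  "is_zero_rep N R \<longleftrightarrow> (\<forall>v \<in> {1..N}. vdim R v = 0)"

definition is_hom ::
  "nat \<Rightarrow> (nat \<times> nat) set \<Rightarrow> 'k::field rep \<Rightarrow> 'k rep \<Rightarrow> 'k family \<Rightarrow> bool" where
  "is_hom N Q R S h \<longleftrightarrow>
     (\<forall>v \<in> {1..N}. h v \<in> carrier_mat (vdim S v) (vdim R v)) \<and>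
     (\<forall>(s, t) \<in> Q. h t * amap R (s, t) = amap S (s, t) * h s)"

definition is_iso ::
  "nat \<Rightarrow> (nat \<times> nat) set \<Rightarrow> 'k::field rep \<Rightarrow> 'k rep \<Rightarrow> 'k family \<Rightarrow> bool" where
  "is_iso N Q R S h \<longleftrightarrow> is_hom N Q R S h \<and> (\<forall>v \<in> {1..N}. invertible_mat (h v))"

definition isomorphic ::
  "nat \<Rightarrow> (nat \<times> nat) set \<Rightarrow> 'k::field rep \<Rightarrow> 'k rep \<Rightarrow> bool" where
  "isomorphic N Q R S \<longleftrightarrow> (\<exists>h. is_iso N Q R S h)"

definition iso_class :: "nat \<Rightarrow> (nat \<times> nat) set \<Rightarrow> 'k::field rep \<Rightarrow> 'k rep set" where
  "iso_class N Q R = {S. is_rep N Q S \<and> isomorphic N Q R S}"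

subsection \<open>Direct sums\<close>

definition block_diag :: "'k::zero mat \<Rightarrow> 'k mat \<Rightarrow> 'k mat" where
  "block_diag X Y =
     four_block_mat X (0\<^sub>m (dim_row X) (dim_col Y)) (0\<^sub>m (dim_row Y) (dim_col X)) Y"

definition append_columns :: "'k::zero mat \<Rightarrow> 'k mat \<Rightarrow> 'k mat" where
  "append_columns X Y = four_block_mat X Y (0\<^sub>m 0 (dim_col X)) (0\<^sub>m 0 (dim_col Y))"

definition direct_sum :: "'k::zero rep \<Rightarrow> 'k rep \<Rightarrow> 'k rep" where
  "direct_sum R S =
     \<lparr>vdim = (\<lambda>v. vdim R v + vdim S v), amap = (\<lambda>a. block_diag (amap R a) (amap S a))\<rparr>"

definition zero_rep :: "'k::zero rep" where
  "zero_rep = \<lparr>vdim = (\<lambda>_. 0), amap = (\<lambda>_. 0\<^sub>m 0 0)\<rparr>"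

definition direct_sum_list :: "'k::zero rep list \<Rightarrow> 'k rep" where
  "direct_sum_list Rs = foldr direct_sum Rs zero_rep"

definition indecomposable ::
  "nat \<Rightarrow> (nat \<times> nat) set \<Rightarrow> 'k::field rep \<Rightarrow> bool" where
  "indecomposable N Q R \<longleftrightarrow>
     is_rep N Q R \<and> \<not> is_zero_rep N R \<and>
     (\<forall>A B. is_rep N Q A \<longrightarrow> is_rep N Q B \<longrightarrow> isomorphic N Q R (direct_sum A B) \<longrightarrow>
        is_zero_rep N A \<or> is_zero_rep N B)"

definition is_summand ::
  "nat \<Rightarrow> (nat \<times> nat) set \<Rightarrow> 'k::field rep \<Rightarrow> 'k rep \<Rightarrow> bool" where
  "is_summand N Q A T \<longleftrightarrow>
     is_rep N Q A \<and> (\<exists>C. is_rep N Q C \<and> isomorphic N Q T (direct_sum A C))"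

section \<open>The vector space Ext1\<close>

text \<open>
  A triple \<open>(E, f, g)\<close> in \<open>extensions N Q A B\<close> is a short exact sequence
  \<open>0 \<rightarrow> B \<rightarrow> E \<rightarrow> A \<rightarrow> 0\<close> with maps \<open>f\<close> and \<open>g\<close>.
\<close>

type_synonym 'k ses = "'k rep \<times> 'k family \<times> 'k family"

definition extensions ::
  "nat \<Rightarrow> (nat \<times> nat) set \<Rightarrow> 'k::field rep \<Rightarrow> 'k rep \<Rightarrow> 'k ses set" where
  "extensions N Q A B =
     {(E, f, g). is_rep N Q E \<and> is_hom N Q B E f \<and> is_hom N Q E A g \<and>
        (\<forall>v \<in> {1..N}.
           inj_on ((*\<^sub>v) (f v)) (carrier_vec (vdim B v)) \<and>
           (*\<^sub>v) (f v) ` carrier_vec (vdim B v) =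
             {x \<in> carrier_vec (vdim E v). g v *\<^sub>v x = 0\<^sub>v (vdim A v)} \<and>
           (*\<^sub>v) (g v) ` carrier_vec (vdim E v) = carrier_vec (vdim A v))}"

definition ext_equiv ::
  "nat \<Rightarrow> (nat \<times> nat) set \<Rightarrow> 'k::field ses \<Rightarrow> 'k ses \<Rightarrow> bool" where
  "ext_equiv N Q = (\<lambda>(E, f, g) (E', f', g').
     \<exists>h. is_iso N Q E E' h \<and> (\<forall>v \<in> {1..N}. h v * f v = f' v \<and> g' v * h v = g v))"

definition ext_class ::
  "nat \<Rightarrow> (nat \<times> nat) set \<Rightarrow> 'k::field rep \<Rightarrow> 'k rep \<Rightarrow> 'k ses \<Rightarrow> 'k ses set" where
  "ext_class N Q A B x = {y \<in> extensions N Q A B. ext_equiv N Q x y}"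

definition Ext1 ::
  "nat \<Rightarrow> (nat \<times> nat) set \<Rightarrow> 'k::field rep \<Rightarrow> 'k rep \<Rightarrow> 'k ses set set" where
  "Ext1 N Q A B = ext_class N Q A B ` extensions N Q A B"

text \<open>
  \<open>ses_map N Q b a x y\<close>: there is a morphism of short exact sequences from \<open>x\<close> to \<open>y\<close> which
  is \<open>b\<close> on the left-hand terms and \<open>a\<close> on the right-hand terms.  If \<open>a\<close> is the identity,
  this says that \<open>y\<close> is the pushout of \<open>x\<close> along \<open>b\<close>; if \<open>b\<close> is the identity, that \<open>x\<close> is the
  pullback of \<open>y\<close> along \<open>a\<close>.
\<close>

definition ses_map ::
  "nat \<Rightarrow> (nat \<times> nat) set \<Rightarrow> 'k::field family \<Rightarrow> 'k family \<Rightarrow> 'k ses \<Rightarrow> 'k ses \<Rightarrow> bool" where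
  "ses_map N Q b a = (\<lambda>(E, f, g) (E', f', g').
     \<exists>h. is_hom N Q E E' h \<and> (\<forall>v \<in> {1..N}. h v * f v = f' v * b v \<and> g' v * h v = a v * g v))"

definition id_family :: "'k::field rep \<Rightarrow> 'k family" where
  "id_family R v = 1\<^sub>m (vdim R v)"

definition diagonal :: "'k::field rep \<Rightarrow> 'k family" where
  "diagonal R v = 1\<^sub>m (vdim R v) @\<^sub>r 1\<^sub>m (vdim R v)"

definition codiagonal :: "'k::field rep \<Rightarrow> 'k family" where
  "codiagonal R v = append_columns (1\<^sub>m (vdim R v)) (1\<^sub>m (vdim R v))"

definition split_ses :: "'k::field rep \<Rightarrow> 'k rep \<Rightarrow> 'k ses" where
  "split_ses A B =
     (direct_sum B A,
      (\<lambda>v. 1\<^sub>m (vdim B v) @\<^sub>r 0\<^sub>m (vdim A v) (vdim B v)),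
      (\<lambda>v. append_columns (0\<^sub>m (vdim A v) (vdim B v)) (1\<^sub>m (vdim A v))))"

definition ses_direct_sum :: "'k::field ses \<Rightarrow> 'k ses \<Rightarrow> 'k ses" where
  "ses_direct_sum = (\<lambda>(E, f, g) (E', f', g').
     (direct_sum E E', (\<lambda>v. block_diag (f v) (f' v)), (\<lambda>v. block_diag (g v) (g' v))))"

definition ext_zero ::
  "nat \<Rightarrow> (nat \<times> nat) set \<Rightarrow> 'k::field rep \<Rightarrow> 'k rep \<Rightarrow> 'k ses set" where
  "ext_zero N Q A B = ext_class N Q A B (split_ses A B)"

text \<open>
  Scalars act by pushout along the homothety of \<open>B\<close>.  Addition is the Baer sum: push the
  direct sum of the two sequences out along the codiagonal of \<open>B\<close> (giving \<open>w\<close>), then pull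
  \<open>w\<close> back along the diagonal of \<open>A\<close>.
\<close>

definition ext_scale ::
  "nat \<Rightarrow> (nat \<times> nat) set \<Rightarrow> 'k::field rep \<Rightarrow> 'k rep \<Rightarrow> 'k \<Rightarrow> 'k ses set \<Rightarrow> 'k ses set" where
  "ext_scale N Q A B c X =
     {y \<in> extensions N Q A B. \<exists>x \<in> X. ses_map N Q (\<lambda>v. c \<cdot>\<^sub>m id_family B v) (id_family A) x y}"

definition ext_add ::
  "nat \<Rightarrow> (nat \<times> nat) set \<Rightarrow> 'k::field rep \<Rightarrow> 'k rep \<Rightarrow>
   'k ses set \<Rightarrow> 'k ses set \<Rightarrow> 'k ses set" where
  "ext_add N Q A B X X' =
     {y \<in> extensions N Q A B. \<exists>x \<in> X. \<exists>x' \<in> X'. \<exists>w \<in> extensions N Q (direct_sum A A) B.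
        ses_map N Q (codiagonal B) (id_family (direct_sum A A)) (ses_direct_sum x x') w \<and>
        ses_map N Q (id_family B) (diagonal A) y w}"

definition Ext1_is_zero ::
  "nat \<Rightarrow> (nat \<times> nat) set \<Rightarrow> 'k::field rep \<Rightarrow> 'k rep \<Rightarrow> bool" where
  "Ext1_is_zero N Q A B \<longleftrightarrow> Ext1 N Q A B = {ext_zero N Q A B}"

definition Ext1_iso_field ::
  "nat \<Rightarrow> (nat \<times> nat) set \<Rightarrow> 'k::field rep \<Rightarrow> 'k rep \<Rightarrow> bool" where
  "Ext1_iso_field N Q A B \<longleftrightarrow>
     (\<exists>\<phi> :: 'k \<Rightarrow> 'k ses set. bij_betw \<phi> UNIV (Ext1 N Q A B) \<and>
        (\<forall>a b. \<phi> (a + b) = ext_add N Q A B (\<phi> a) (\<phi> b)) \<and>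
        (\<forall>c a. \<phi> (c * a) = ext_scale N Q A B c (\<phi> a)))"

definition generates_Ext1 ::
  "nat \<Rightarrow> (nat \<times> nat) set \<Rightarrow> 'k::field rep \<Rightarrow> 'k rep \<Rightarrow> 'k ses \<Rightarrow> bool" where
  "generates_Ext1 N Q A B x \<longleftrightarrow>
     Ext1 N Q A B = {ext_scale N Q A B c (ext_class N Q A B x) | c. True}"

section \<open>Maximal almost rigid representations\<close>

definition basic :: "nat \<Rightarrow> (nat \<times> nat) set \<Rightarrow> 'k::field rep \<Rightarrow> bool" where
  "basic N Q T \<longleftrightarrow>
     \<not> (\<exists>A. indecomposable N Q A \<and> is_summand N Q (direct_sum A A) T)"

definition almost_rigid :: "nat \<Rightarrow> (nat \<times> nat) set \<Rightarrow> 'k::field rep \<Rightarrow> bool" where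
  "almost_rigid N Q T \<longleftrightarrow>
     is_rep N Q T \<and> basic N Q T \<and>
     (\<forall>A B. indecomposable N Q A \<longrightarrow> is_summand N Q A T \<longrightarrow>
            indecomposable N Q B \<longrightarrow> is_summand N Q B T \<longrightarrow>
        Ext1_is_zero N Q A B \<or>
        (Ext1_iso_field N Q A B \<and>
         (\<exists>E f g. (E, f, g) \<in> extensions N Q A B \<and> generates_Ext1 N Q A B (E, f, g) \<and>
            indecomposable N Q E)))"

definition maximal_almost_rigid :: "nat \<Rightarrow> (nat \<times> nat) set \<Rightarrow> 'k::field rep \<Rightarrow> bool" where
  "maximal_almost_rigid N Q T \<longleftrightarrow>
     almost_rigid N Q T \<and>
     (\<forall>M. is_rep N Q M \<longrightarrow> \<not> is_zero_rep N M \<longrightarrow> \<not> almost_rigid N Q (direct_sum T M))"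

definition mar :: "nat \<Rightarrow> (nat \<times> nat) set \<Rightarrow> 'k::field rep set set" where
  "mar N Q = iso_class N Q ` {T. maximal_almost_rigid N Q T}"

section \<open>The polygon and its triangulations\<close>

text \<open>
  \<open>p\<close> places the vertices \<open>0, \<dots>, n + 2\<close> of the polygon of \<open>Q\<close> in the plane; the line
  \<open>L\<close> is the horizontal line through \<open>p 0\<close>.  The last condition says that every vertex is an
  extreme point, so that the \<open>p i\<close> are the vertices of a convex \<open>(n + 3)\<close>-gon.
\<close>

definition is_polygon ::
  "nat \<Rightarrow> (nat \<times> nat) set \<Rightarrow> (nat \<Rightarrow> real \<times> real) \<Rightarrow> bool" where
  "is_polygon n Q p \<longleftrightarrow>
     (\<forall>i j. i < j \<longrightarrow> j \<le> n + 2 \<longrightarrow> fst (p i) < fst (p j)) \<and>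
     snd (p (n + 2)) = snd (p 0) \<and>
     (\<forall>i \<in> {1..n + 1}. (i, i + 1) \<in> Q \<longrightarrow> snd (p i) > snd (p 0)) \<and>
     (\<forall>i \<in> {1..n + 1}. (i + 1, i) \<in> Q \<longrightarrow> snd (p i) < snd (p 0)) \<and>
     (\<forall>i \<in> {0..n + 2}. p i \<notin> convex hull (p ` ({0..n + 2} - {i})))"

lemma polygon_exists:
  assumes Q: "dynkin_quiver_A (n + 2) Q"
  shows "\<exists>p. is_polygon n Q p"
proof -
  define N where "N = real n + 2"
  define s :: "nat \<Rightarrow> real" where "s i = (if (i, i + 1) \<in> Q then 1 else -1)" for i
  define p :: "nat \<Rightarrow> real \<times> real" where "p i = (real i, s i * (real i * (N - real i)))" for i
  have pos: "real i * (N - real i) > 0" if "i \<in> {1..n + 1}" for i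
    using that by (auto simp: N_def)
  have s2: "s i = 1 \<or> s i = -1" for i by (simp add: s_def)
  have not_both: "s i = -1" if "i \<in> {1..n + 1}" "(i + 1, i) \<in> Q" for i
    using Q that unfolding dynkin_quiver_A_def s_def by auto
  have ext: "p i \<notin> convex hull (p ` ({0..n + 2} - {i}))" if i: "i \<le> n + 2" for i
  proof
    define L :: "real \<times> real \<Rightarrow> real" where
      "L z = s i * snd z - (N - 2 * real i) * fst z" for z
    define H where "H = {z. L z < (real i)\<^sup>2}"
    have lin: "linear L" unfolding L_def
      by (rule linearI) (auto simp: algebra_simps)
    have "H = L -` {..<(real i)\<^sup>2}" by (auto simp: H_def)
    then have "convex H" using convex_linear_vimage[OF lin, of "{..<(real i)\<^sup>2}"] by simp
    moreover have "p j \<in> H" if j: "j \<le> n + 2" "j \<noteq> i" for j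
    proof -
      have nn: "real j * (N - real j) \<ge> 0" using j by (auto simp: N_def)
      have "s i * (s j * (real j * (N - real j))) \<le> real j * (N - real j)"
        using s2[of i] s2[of j] nn by auto
      moreover have "(real i - real j)\<^sup>2 > 0" using j by simp
      ultimately show ?thesis
        by (simp add: H_def L_def p_def power2_eq_square algebra_simps)
    qed
    ultimately have "convex hull (p ` ({0..n + 2} - {i})) \<subseteq> H"
      by (intro hull_minimal image_subsetI) auto
    moreover assume "p i \<in> convex hull (p ` ({0..n + 2} - {i}))"
    ultimately have "L (p i) < (real i)\<^sup>2" by (auto simp: H_def)
    moreover have "L (p i) = (real i)\<^sup>2"
      using s2[of i] by (auto simp: L_def p_def power2_eq_square algebra_simps)
    ultimately show False by simp
  qed
  have "is_polygon n Q p"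
    unfolding is_polygon_def
  proof (intro conjI ballI allI impI)
    fix i assume "i \<in> {1..n + 1}" "(i, i + 1) \<in> Q"
    then show "snd (p 0) < snd (p i)" using pos[of i] by (auto simp: p_def s_def)
  next
    fix i assume "i \<in> {1..n + 1}" "(i + 1, i) \<in> Q"
    then show "snd (p i) < snd (p 0)" using pos[of i] not_both[of i] by (auto simp: p_def)
  qed (use ext in \<open>auto simp: p_def N_def\<close>)
  then show ?thesis by blast
qed

text \<open>
  The segment \<open>\<gamma>(i, j)\<close> is recorded by the pair \<open>(i, j)\<close>; distinct pairs give distinct
  segments because the \<open>p i\<close> are extreme points.
\<close>

definition segments :: "nat \<Rightarrow> (nat \<times> nat) set" where
  "segments n = {(i, j). i < j \<and> j \<le> n + 2}"

definition crossing :: "(nat \<Rightarrow> 'a::real_vector) \<Rightarrow> nat \<times> nat \<Rightarrow> nat \<times> nat \<Rightarrow> bool" where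
  "crossing p = (\<lambda>(i, j) (k, l).
     (i, j) \<noteq> (k, l) \<and> open_segment (p i) (p j) \<inter> open_segment (p k) (p l) \<noteq> {})"

definition noncrossing :: "(nat \<Rightarrow> 'a::real_vector) \<Rightarrow> (nat \<times> nat) set \<Rightarrow> bool" where
  "noncrossing p \<T> \<longleftrightarrow> (\<forall>c \<in> \<T>. \<forall>d \<in> \<T>. \<not> crossing p c d)"

definition triangulations :: "nat \<Rightarrow> (nat \<Rightarrow> 'a::real_vector) \<Rightarrow> (nat \<times> nat) set set" where
  "triangulations n p =
     {\<T>. \<T> \<subseteq> segments n \<and> noncrossing p \<T> \<and>
        (\<forall>\<T>'. \<T>' \<subseteq> segments n \<longrightarrow> noncrossing p \<T>' \<longrightarrow> \<T> \<subseteq> \<T>' \<longrightarrow> \<T>' = \<T>)}"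

section \<open>The map from triangulations to representations\<close>

definition interval_rep :: "nat \<Rightarrow> nat \<Rightarrow> 'k::field rep" where
  "interval_rep i j =
     (let d = (\<lambda>v. if i \<le> v \<and> v \<le> j then 1 else 0)
      in \<lparr>vdim = d,
          amap = (\<lambda>(s, t). if d s = 1 \<and> d t = 1 then 1\<^sub>m 1 else 0\<^sub>m (d t) (d s))\<rparr>)"

fun F_obj :: "nat \<times> nat \<Rightarrow> 'k::field rep" where
  "F_obj (i, j) = interval_rep (i + 1) j"

text \<open>The list enumerates \<open>\<T>\<close> without repetition; its order does not affect the class.\<close>

definition F_triangulation ::
  "nat \<Rightarrow> (nat \<times> nat) set \<Rightarrow> (nat \<times> nat) set \<Rightarrow> 'k::field rep set" where
  "F_triangulation n Q \<T> =
     iso_class (n + 2) Q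
       (direct_sum_list
          (map F_obj (filter (\<lambda>c. c \<in> \<T>) (List.product [0..<n + 3] [0..<n + 3]))))"

end

theory Submission
  imports Defs "Jordan_Normal_Form.Determinant"
begin

text \<open>
  Every representation of \<open>Q\<close> is a direct sum of intervals, with unique multiplicities, so an isomorphism
  class is a multiset of segments, and it is basic iff this multiset is a set.  Write an extension of \<open>A\<close>
  by \<open>B\<close> with block triangular maps; then Ext1 is the cokernel of a map between spaces of families of
  matrices, and for two intervals it has dimension at most \<open>1\<close>.  If the intervals are disjoint, a nonsplit
  extension joins them to a longer interval, which is indecomposable.  If they overlap, every extension
  has dimension \<open>2\<close> on the overlap and is decomposable, while Ext1 is nonzero iff at both ends of the overlap
  there is an arrow from the interval of \<open>A\<close> to that of \<open>B\<close>.  An endpoint \<open>k\<close> of one segment strictly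
  between the endpoints of another lies above it iff \<open>k \<rightarrow> k + 1\<close> is an arrow, and comparing the sides
  on which endpoints lie shows that this condition, for one of the two orders of the intervals, says
  exactly that the segments cross.  So almost rigid representations are noncrossing sets of segments.
\<close>


section \<open>Matrices\<close>

text \<open>The existence of interval decompositions is an induction on the number of vertices. Once
  the restriction to the first \<open>m\<close> vertices is decomposed, only the map across the last
  edge is in the way, and only summands ending at \<open>m\<close> see it. Gaussian elimination on
  this map is restricted: a generator may be changed only by generators of intervals to which its
  own interval maps nontrivially. Of two intervals ending at \<open>m\<close> one maps to the other,
  so some interval maps to all the others; one elimination step with it either prolongs it or makes
  its generator vanish under the last map. The opposite direction of the last arrow is reached by
  duality. Rigidity has to be decided for all representations isomorphic to intervals, and Ext1
  consists of classes of sequences. Cochains turn pushouts and pullbacks into matrix products. For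
  overlapping intervals the remaining linear system is a recurrence along a line, so its solvability
  is decided at the two boundary edges. A vertex \<open>k\<close> of the polygon stands for the edge
  between \<open>k\<close> and \<open>k + 1\<close> of the quiver; this is how ends of overlaps and
  sides of endpoints become the same data.\<close>

lemma mult_mat_assoc:
  fixes A :: "'a::semiring_0 mat"
  assumes "dim_col A = dim_row B" "dim_col B = dim_row C"
  shows "A * B * C = A * (B * C)"
  using assms
  by (intro assoc_mult_mat[of _ "dim_row A" "dim_col A" _ "dim_col B" _ "dim_col C"] carrier_matI) simp_all

lemma mult_add_mat:
  fixes A :: "'a::semiring_0 mat"
  assumes "dim_col A = dim_row B" "dim_row C = dim_row B" "dim_col C = dim_col B"
  shows "A * (B + C) = A * B + A * C"
  using assms
  by (intro mult_add_distrib_mat[of _ "dim_row A" "dim_col A" _ "dim_col B"] carrier_matI) simp_all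

lemma add_mult_mat:
  fixes A :: "'a::semiring_0 mat"
  assumes "dim_col A = dim_row C" "dim_row A = dim_row B" "dim_col A = dim_col B"
  shows "(A + B) * C = A * C + B * C"
  using assms
  by (intro add_mult_distrib_mat[of _ "dim_row A" "dim_col A" _ _ "dim_col C"] carrier_matI) simp_all

lemma one_mult_mat [simp]:
  fixes A :: "'a::semiring_1 mat"
  shows "dim_row A = n \<Longrightarrow> 1\<^sub>m n * A = A"
  by (intro left_mult_one_mat[of A n "dim_col A"] carrier_matI) simp_all

lemma mult_one_mat [simp]:
  fixes A :: "'a::semiring_1 mat"
  shows "dim_col A = n \<Longrightarrow> A * 1\<^sub>m n = A"
  by (intro right_mult_one_mat[of A "dim_row A" n] carrier_matI) simp_all

lemma zero_mult_mat [simp]: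
  fixes A :: "'a::semiring_0 mat"
  shows "dim_row A = n \<Longrightarrow> 0\<^sub>m k n * A = 0\<^sub>m k (dim_col A)"
  by (intro left_mult_zero_mat[of A n "dim_col A" k] carrier_matI) simp_all

lemma mult_zero_mat [simp]:
  fixes A :: "'a::semiring_0 mat"
  shows "dim_col A = n \<Longrightarrow> A * 0\<^sub>m n k = 0\<^sub>m (dim_row A) k"
  by (intro right_mult_zero_mat[of A "dim_row A" n k] carrier_matI) simp_all

lemma zero_add_mat [simp]:
  fixes A :: "'a::monoid_add mat"
  shows "dim_row A = n \<Longrightarrow> dim_col A = m \<Longrightarrow> 0\<^sub>m n m + A = A"
  by auto

lemma add_zero_mat [simp]:
  fixes A :: "'a::monoid_add mat"
  shows "dim_row A = n \<Longrightarrow> dim_col A = m \<Longrightarrow> A + 0\<^sub>m n m = A"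
  by auto

lemma smult_mult_mat:
  fixes A :: "'a::comm_semiring_0 mat"
  assumes "dim_col A = dim_row B"
  shows "(c \<cdot>\<^sub>m A) * B = c \<cdot>\<^sub>m (A * B)"
  using assms by (intro eq_matI) (auto simp: scalar_prod_def sum_distrib_left mult.assoc)

lemma mult_smult_mat:
  fixes A :: "'a::comm_semiring_0 mat"
  assumes "dim_col A = dim_row B"
  shows "A * (c \<cdot>\<^sub>m B) = c \<cdot>\<^sub>m (A * B)"
  using assms by (intro eq_matI) (auto simp: scalar_prod_def sum_distrib_left ac_simps)

lemma mat_empty_eq:
  "dim_row A = dim_row B \<Longrightarrow> dim_col A = dim_col B \<Longrightarrow> dim_row A = 0 \<or> dim_col A = 0 \<Longrightarrow> A = B"
  by (intro eq_matI) auto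

lemma mat_1x1_eq:
  "dim_row A = 1 \<Longrightarrow> dim_col A = 1 \<Longrightarrow> dim_row B = 1 \<Longrightarrow> dim_col B = 1 \<Longrightarrow>
    A = B \<longleftrightarrow> A $$ (0, 0) = B $$ (0, 0)"
  by (auto intro!: eq_matI)

lemma index_mult_mat_sum:
  "i < dim_row A \<Longrightarrow> j < dim_col B \<Longrightarrow> dim_col A = dim_row B \<Longrightarrow>
    (A * B) $$ (i, j) = (\<Sum>k < dim_row B. A $$ (i, k) * B $$ (k, j))"
  by (simp add: scalar_prod_def lessThan_atLeast0)

text \<open>If \<open>k < r\<close>, padding \<open>A\<close> and \<open>B\<close> with zeros to
  square matrices keeps the product equal to \<open>1\<close>; for square matrices the product in
  the other order is then \<open>1\<close> too, although its row \<open>k\<close> is zero.\<close>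

lemma right_inverse_dim_le:
  fixes A B :: "'a::field mat"
  assumes A: "A \<in> carrier_mat r k" and B: "B \<in> carrier_mat k r" and AB: "A * B = 1\<^sub>m r"
  shows "r \<le> k"
proof (rule ccontr)
  assume "\<not> r \<le> k"
  then have kr: "k < r" by simp
  define A' where "A' = mat r r (\<lambda>(i, j). if j < k then A $$ (i, j) else 0)"
  define B' where "B' = mat r r (\<lambda>(i, j). if i < k then B $$ (i, j) else 0)"
  have "A' * B' = 1\<^sub>m r"
  proof (rule eq_matI)
    fix i j assume ij: "i < dim_row (1\<^sub>m r :: 'a mat)" "j < dim_col (1\<^sub>m r :: 'a mat)"
    then have "(A' * B') $$ (i, j) = (\<Sum>l < r. A' $$ (i, l) * B' $$ (l, j))"
      by (subst index_mult_mat_sum) (auto simp: A'_def B'_def)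
    also have "\<dots> = (\<Sum>l < k. A $$ (i, l) * B $$ (l, j))"
      using ij kr by (intro sum.mono_neutral_cong_right) (auto simp: A'_def B'_def)
    also have "\<dots> = (A * B) $$ (i, j)" using A B ij by (subst index_mult_mat_sum) auto
    finally show "(A' * B') $$ (i, j) = 1\<^sub>m r $$ (i, j)" using AB by simp
  qed (auto simp: A'_def B'_def)
  then have "B' * A' = 1\<^sub>m r"
    by (rule mat_mult_left_right_inverse[rotated 2]) (auto simp: A'_def B'_def)
  then have "(B' * A') $$ (k, k) = 1" using kr by simp
  moreover have "(B' * A') $$ (k, k) = 0"
    using kr by (subst index_mult_mat_sum) (auto simp: A'_def B'_def)
  ultimately show False by simp
qed

lemma inverse_dim_eq:
  fixes A B :: "'a::field mat"
  assumes "A \<in> carrier_mat r k" "B \<in> carrier_mat k r" "A * B = 1\<^sub>m r" "B * A = 1\<^sub>m k"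
  shows "r = k"
  using right_inverse_dim_le[of A r k B] right_inverse_dim_le[of B k r A] assms by simp

lemma mat_eq_mult_vecI:
  fixes X Y :: "'a::semiring_1 mat"
  assumes "dim_row X = dim_row Y" "dim_col X = dim_col Y"
    and "\<And>y. y \<in> carrier_vec (dim_col Y) \<Longrightarrow> X *\<^sub>v y = Y *\<^sub>v y"
  shows "X = Y"
proof (rule eq_matI)
  fix i j assume "i < dim_row Y" "j < dim_col Y"
  then have "(X *\<^sub>v unit_vec (dim_col Y) j) $ i = X $$ (i, j)" "(Y *\<^sub>v unit_vec (dim_col Y) j) $ i = Y $$ (i, j)"
    using assms by (auto simp: mult_mat_vec_def)
  then show "X $$ (i, j) = Y $$ (i, j)" using assms(3)[of "unit_vec (dim_col Y) j"] by simp
qed (use assms in auto)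

subsection \<open>Injections and projections of a direct sum\<close>

text \<open>Block matrices are handled through the injections and projections of a direct sum,
  indexed by the two dimensions, so that identities follow from biproduct equations instead of
  entries.\<close>

definition inl_mat :: "nat \<Rightarrow> nat \<Rightarrow> 'a::{zero,one} mat" where
  "inl_mat a b = mat (a + b) a (\<lambda>(i, j). if i = j then 1 else 0)"
definition inr_mat :: "nat \<Rightarrow> nat \<Rightarrow> 'a::{zero,one} mat" where
  "inr_mat a b = mat (a + b) b (\<lambda>(i, j). if i = a + j then 1 else 0)"
definition prl_mat :: "nat \<Rightarrow> nat \<Rightarrow> 'a::{zero,one} mat" where
  "prl_mat a b = mat a (a + b) (\<lambda>(i, j). if i = j then 1 else 0)"
definition prr_mat :: "nat \<Rightarrow> nat \<Rightarrow> 'a::{zero,one} mat" where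
  "prr_mat a b = mat b (a + b) (\<lambda>(i, j). if j = a + i then 1 else 0)"

lemma biproduct_dims [simp]:
  "dim_row (inl_mat a b) = a + b" "dim_col (inl_mat a b) = a"
  "dim_row (inr_mat a b) = a + b" "dim_col (inr_mat a b) = b"
  "dim_row (prl_mat a b) = a" "dim_col (prl_mat a b) = a + b"
  "dim_row (prr_mat a b) = b" "dim_col (prr_mat a b) = a + b"
  by (simp_all add: inl_mat_def inr_mat_def prl_mat_def prr_mat_def)

lemma biproduct_carrier [simp]:
  "inl_mat a b \<in> carrier_mat (a + b) a" "inr_mat a b \<in> carrier_mat (a + b) b"
  "prl_mat a b \<in> carrier_mat a (a + b)" "prr_mat a b \<in> carrier_mat b (a + b)"
  by (auto intro: carrier_matI)

lemma index_prl_mult: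
  fixes X :: "'a::semiring_1 mat"
  shows "dim_row X = a + b \<Longrightarrow> i < a \<Longrightarrow> j < dim_col X \<Longrightarrow> (prl_mat a b * X) $$ (i, j) = X $$ (i, j)"
  by (subst index_mult_mat_sum) (auto simp: prl_mat_def if_distrib[of "\<lambda>x. x * _"] cong: if_cong)

lemma index_prr_mult:
  fixes X :: "'a::semiring_1 mat"
  shows "dim_row X = a + b \<Longrightarrow> i < b \<Longrightarrow> j < dim_col X \<Longrightarrow> (prr_mat a b * X) $$ (i, j) = X $$ (a + i, j)"
  by (subst index_mult_mat_sum) (auto simp: prr_mat_def if_distrib[of "\<lambda>x. x * _"] cong: if_cong)

lemma index_inl_mult:
  fixes X :: "'a::semiring_1 mat"
  shows "dim_row X = a \<Longrightarrow> i < a + b \<Longrightarrow> j < dim_col X \<Longrightarrow>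
    (inl_mat a b * X) $$ (i, j) = (if i < a then X $$ (i, j) else 0)"
  by (subst index_mult_mat_sum) (auto simp: inl_mat_def if_distrib[of "\<lambda>x. x * _"] cong: if_cong)

lemma index_inr_mult:
  fixes X :: "'a::semiring_1 mat"
  assumes "dim_row X = b" "i < a + b" "j < dim_col X"
  shows "(inr_mat a b * X) $$ (i, j) = (if i < a then 0 else X $$ (i - a, j))"
proof -
  have "(inr_mat a b * X) $$ (i, j) = (\<Sum>k<b. if i = a + k then X $$ (k, j) else 0)"
    using assms by (subst index_mult_mat_sum) (auto simp: inr_mat_def intro!: sum.cong)
  also have "\<dots> = (\<Sum>k<b. if k = i - a \<and> a \<le> i then X $$ (k, j) else 0)"
    by (intro sum.cong) auto
  also have "\<dots> = (if i < a then 0 else X $$ (i - a, j))" using assms by (auto simp: sum.delta)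
  finally show ?thesis .
qed

lemma index_mult_prl:
  fixes X :: "'a::semiring_1 mat"
  shows "dim_col X = a \<Longrightarrow> i < dim_row X \<Longrightarrow> j < a + b \<Longrightarrow>
    (X * prl_mat a b) $$ (i, j) = (if j < a then X $$ (i, j) else 0)"
  by (subst index_mult_mat_sum) (auto simp: prl_mat_def if_distrib[of "\<lambda>x. _ * x"] cong: if_cong)

lemma index_mult_prr:
  fixes X :: "'a::semiring_1 mat"
  assumes "dim_col X = b" "i < dim_row X" "j < a + b"
  shows "(X * prr_mat a b) $$ (i, j) = (if j < a then 0 else X $$ (i, j - a))"
proof -
  have "(X * prr_mat a b) $$ (i, j) = (\<Sum>k<b. if j = a + k then X $$ (i, k) else 0)"
    using assms by (subst index_mult_mat_sum) (auto simp: prr_mat_def intro!: sum.cong)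
  also have "\<dots> = (\<Sum>k<b. if k = j - a \<and> a \<le> j then X $$ (i, k) else 0)"
    by (intro sum.cong) auto
  also have "\<dots> = (if j < a then 0 else X $$ (i, j - a))" using assms by (auto simp: sum.delta)
  finally show ?thesis .
qed

lemma biproduct_simps [simp]:
  "prl_mat a b * inl_mat a b = (1\<^sub>m a :: 'a::semiring_1 mat)"
  "prr_mat a b * inr_mat a b = (1\<^sub>m b :: 'a mat)"
  "prl_mat a b * inr_mat a b = (0\<^sub>m a b :: 'a mat)"
  "prr_mat a b * inl_mat a b = (0\<^sub>m b a :: 'a mat)"
  by (rule eq_matI; simp add: index_prl_mult index_prr_mult del: index_mult_mat(1);
      simp add: inl_mat_def inr_mat_def)+

text \<open>The equations again for products nested to the right, the normal form produced by
  \<open>mult_mat_assoc\<close>.\<close>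

lemma biproduct_assoc_simps [simp]:
  fixes X :: "'a::semiring_1 mat"
  shows "dim_row X = a \<Longrightarrow> prl_mat a b * (inl_mat a b * X) = X"
  "dim_row X = b \<Longrightarrow> prr_mat a b * (inr_mat a b * X) = X"
  "dim_row X = b \<Longrightarrow> prl_mat a b * (inr_mat a b * X) = 0\<^sub>m a (dim_col X)"
  "dim_row X = a \<Longrightarrow> prr_mat a b * (inl_mat a b * X) = 0\<^sub>m b (dim_col X)"
  by (simp_all flip: mult_mat_assoc)

lemma biproduct_sum:
  "inl_mat a b * prl_mat a b + inr_mat a b * prr_mat a b = (1\<^sub>m (a + b) :: 'a::semiring_1 mat)"
  by (rule eq_matI)
    (auto simp: index_inl_mult index_inr_mult simp del: index_mult_mat(1), auto simp: prl_mat_def prr_mat_def)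

lemma biproduct_row_ext:
  fixes X Y :: "'a::semiring_1 mat"
  assumes "dim_row X = a + b" "dim_row Y = a + b" "dim_col X = dim_col Y"
    "prl_mat a b * X = prl_mat a b * Y" "prr_mat a b * X = prr_mat a b * Y"
  shows "X = Y"
proof -
  have "Z = inl_mat a b * (prl_mat a b * Z) + inr_mat a b * (prr_mat a b * Z)"
    if "dim_row Z = a + b" for Z :: "'a mat"
  proof -
    have "Z = (inl_mat a b * prl_mat a b + inr_mat a b * prr_mat a b) * Z"
      using that by (simp add: biproduct_sum)
    also have "\<dots> = inl_mat a b * (prl_mat a b * Z) + inr_mat a b * (prr_mat a b * Z)"
      using that by (simp add: add_mult_mat mult_mat_assoc)
    finally show ?thesis .
  qed
  from this[of X] this[of Y] show ?thesis using assms by metis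
qed

lemma block_diag_dims [simp]:
  "dim_row (block_diag X Y) = dim_row X + dim_row Y"
  "dim_col (block_diag X Y) = dim_col X + dim_col Y"
  by (simp_all add: block_diag_def)

lemma index_block_diag:
  "i < dim_row X + dim_row Y \<Longrightarrow> j < dim_col X + dim_col Y \<Longrightarrow> block_diag X Y $$ (i, j) =
     (if i < dim_row X then if j < dim_col X then X $$ (i, j) else 0
      else if j < dim_col X then 0 else Y $$ (i - dim_row X, j - dim_col X))"
  by (auto simp: block_diag_def)

lemma block_diag_eq:
  fixes X Y :: "'a::semiring_1 mat"
  shows "block_diag X Y =
    inl_mat (dim_row X) (dim_row Y) * (X * prl_mat (dim_col X) (dim_col Y)) +
    inr_mat (dim_row X) (dim_row Y) * (Y * prr_mat (dim_col X) (dim_col Y))"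
  by (rule eq_matI)
    (auto simp: index_block_diag index_inl_mult index_inr_mult index_mult_prl index_mult_prr
      simp del: index_mult_mat(1))

lemma block_diag_simps:
  fixes X Y :: "'a::semiring_1 mat"
  assumes "dim_row X = a" "dim_row Y = b" "dim_col X = c" "dim_col Y = d"
  shows "prl_mat a b * block_diag X Y = X * prl_mat c d"
    and "prr_mat a b * block_diag X Y = Y * prr_mat c d"
    and "block_diag X Y * inl_mat c d = inl_mat a b * X"
    and "block_diag X Y * inr_mat c d = inr_mat a b * Y"
  using assms by (auto simp: block_diag_eq mult_add_mat add_mult_mat mult_mat_assoc)

lemma block_diag_assoc: "block_diag (block_diag X Y) Z = block_diag X (block_diag Y Z)"
  by (rule eq_matI) (auto simp: index_block_diag add.assoc less_diff_conv2 not_less)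

lemma block_diag_zero_left [simp]: "block_diag (0\<^sub>m 0 0) Y = Y"
  by (rule eq_matI) (auto simp: index_block_diag)

lemma append_columns_eq:
  "append_columns (1\<^sub>m a) (0\<^sub>m a b) = prl_mat a b"
  "append_columns (0\<^sub>m b a) (1\<^sub>m b) = prr_mat a b"
  by (rule eq_matI; force simp: append_columns_def prl_mat_def prr_mat_def)+

lemma append_rows_eq:
  "1\<^sub>m a @\<^sub>r 0\<^sub>m b a = inl_mat a b"
  by (rule eq_matI; force simp: append_rows_def inl_mat_def)

lemma diagonal_eq:
  "1\<^sub>m a @\<^sub>r 1\<^sub>m a = (inl_mat a a + inr_mat a a :: 'a::semiring_1 mat)"
  by (rule eq_matI; auto simp: append_rows_def inl_mat_def inr_mat_def)

lemma codiagonal_eq: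
  "append_columns (1\<^sub>m a) (1\<^sub>m a) = (prl_mat a a + prr_mat a a :: 'a::semiring_1 mat)"
  by (rule eq_matI; auto simp: append_columns_def prl_mat_def prr_mat_def)


section \<open>Complements of split maps, and a linear alternative\<close>

lemma biproduct_complement:
  fixes P J :: "'a::field mat"
  assumes P: "P \<in> carrier_mat r n" and I: "I \<in> carrier_mat n r"
    and K: "K \<in> carrier_mat m n" and J: "J \<in> carrier_mat n m" and n: "n = r + m"
    and eqs: "P * I = 1\<^sub>m r" "K * J = 1\<^sub>m m" "K * I = 0\<^sub>m m r" "P * J = 0\<^sub>m r m"
  shows "I * P + J * K = 1\<^sub>m n"
proof -
  note dims = carrier_matD[OF P] carrier_matD[OF I] carrier_matD[OF K] carrier_matD[OF J]
  define M where "M = inl_mat r m * P + inr_mat r m * K"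
  define M' where "M' = I * prl_mat r m + J * prr_mat r m"
  have M: "M \<in> carrier_mat n n" "M' \<in> carrier_mat n n"
    using dims n by (auto simp: M_def M'_def)
  \<comment> \<open>The four hypotheses \<open>eqs\<close> are the blocks of this equation. Both
    matrices are square, so the opposite product, which is the claimed sum, is also
    \<open>1\<close>.\<close>
  have "M * M' = 1\<^sub>m n"
    unfolding M_def M'_def n using dims eqs
    by (simp add: mult_add_mat add_mult_mat mult_mat_assoc biproduct_sum flip: mult_mat_assoc[of P] mult_mat_assoc[of K])
  from mat_mult_left_right_inverse[OF M this] have "M' * M = 1\<^sub>m n" .
  moreover have "M' * M = I * P + J * K"
    unfolding M_def M'_def using dims n
    by (simp add: mult_add_mat add_mult_mat mult_mat_assoc)
  ultimately show ?thesis by simp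
qed

text \<open>For \<open>r = 1\<close>, \<open>I\<close> is a vector \<open>x\<close> and
  \<open>P\<close> a functional \<open>f\<close> with \<open>f x = 1\<close>. Given a pivot
  \<open>x k \<noteq> 0\<close>, the other coordinates, corrected so as to vanish on
  \<open>x\<close>, form \<open>K\<close>; the other basis vectors, corrected so as to lie in the
  kernel of \<open>f\<close>, form \<open>J\<close>.\<close>

lemma retract_complement:
  fixes P I :: "'a::field mat"
  assumes P: "P \<in> carrier_mat r n" and I: "I \<in> carrier_mat n r" and PI: "P * I = 1\<^sub>m r" and r: "r \<le> 1"
  shows "r \<le> n \<and> (\<exists>K J. K \<in> carrier_mat (n - r) n \<and> J \<in> carrier_mat n (n - r) \<and>
    K * J = 1\<^sub>m (n - r) \<and> K * I = 0\<^sub>m (n - r) r \<and> P * J = 0\<^sub>m r (n - r) \<and> I * P + J * K = 1\<^sub>m n)"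
proof (cases "r = 0")
  case True
  have "I * P = 0\<^sub>m n n"
    using P I True by (intro eq_matI) (auto simp: scalar_prod_def)
  then show ?thesis using P I True
    by (intro conjI exI[of _ "1\<^sub>m n"]) (auto intro: mat_empty_eq)
next
  case False
  with r have r1: "r = 1" by simp
  define x f where "x j = I $$ (j, 0)" and "f j = P $$ (0, j)" for j
  have "(P * I) $$ (0, 0) = 1" using PI r1 by simp
  then have fx: "(\<Sum>j<n. f j * x j) = 1"
    using P I r1 by (subst (asm) index_mult_mat_sum) (auto simp: f_def x_def)
  obtain k where k: "k < n" "x k \<noteq> 0"
  proof -
    have "(\<Sum>j<n. f j * x j) = 0" if "\<forall>k<n. x k = 0" using that by (intro sum.neutral) auto
    then have "\<not> (\<forall>k<n. x k = 0)" using fx zero_neq_one by metis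
    then show ?thesis using that by blast
  qed
  define m where "m = n - 1"
  have n: "n = Suc m" using k by (simp add: m_def)
  \<comment> \<open>\<open>s\<close> enumerates the indices other than the pivot
    \<open>k\<close>.\<close>
  define s where "s = insert_index k"
  have s: "s a < n" "s a \<noteq> k" if "a < m" for a
    using that n by (auto simp: s_def insert_index_def)
  have s_inj: "s a = s b \<longleftrightarrow> a = b" for a b by (auto simp: s_def insert_index_def)
  define K where "K = mat m n (\<lambda>(a, j). (if j = s a then 1 else 0) - (if j = k then x (s a) / x k else 0))"
  define J where "J = mat n m (\<lambda>(i, a). (if i = s a then 1 else 0) - x i * f (s a))"
  have KX: "(K * X) $$ (a, b) = X $$ (s a, b) - x (s a) / x k * X $$ (k, b)"
    if "a < m" "b < dim_col X" "dim_row X = n" for X a b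
    using that s[of a] k
    by (subst index_mult_mat_sum)
      (auto simp: K_def left_diff_distrib sum_subtractf if_distrib[of "\<lambda>x. x * _"] cong: if_cong)
  have car: "K \<in> carrier_mat m n" "J \<in> carrier_mat n m" by (auto simp: K_def J_def)
  have KJ: "K * J = 1\<^sub>m m"
  proof (rule eq_matI)
    fix a b assume "a < dim_row (1\<^sub>m m :: 'a mat)" "b < dim_col (1\<^sub>m m :: 'a mat)"
    then show "(K * J) $$ (a, b) = 1\<^sub>m m $$ (a, b)"
      using s[of a] s[of b] k car by (subst KX) (auto simp: J_def s_inj)
  qed (use car in auto)
  have KI: "K * I = 0\<^sub>m m 1"
  proof (rule eq_matI)
    fix a b assume "a < dim_row (0\<^sub>m m 1 :: 'a mat)" "b < dim_col (0\<^sub>m m 1 :: 'a mat)"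
    then show "(K * I) $$ (a, b) = 0\<^sub>m m 1 $$ (a, b)"
      using s[of a] k I r1 by (subst KX) (auto simp: x_def[symmetric])
  qed (use car I r1 in auto)
  have PJ: "P * J = 0\<^sub>m 1 m"
  proof (rule eq_matI)
    fix a b assume ab: "a < dim_row (0\<^sub>m 1 m :: 'a mat)" "b < dim_col (0\<^sub>m 1 m :: 'a mat)"
    then have "(P * J) $$ (a, b) = (\<Sum>j<n. f j * ((if j = s b then 1 else 0) - x j * f (s b)))"
      using P r1 by (subst index_mult_mat_sum) (auto simp: J_def f_def)
    also have "\<dots> = f (s b) - (\<Sum>j<n. f j * x j) * f (s b)"
      using ab s[of b] by (simp add: right_diff_distrib sum_subtractf sum_distrib_right mult.assoc
        if_distrib[of "\<lambda>x. _ * x"] cong: if_cong)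
    finally show "(P * J) $$ (a, b) = 0\<^sub>m 1 m $$ (a, b)" using ab fx by simp
  qed (use car P r1 in auto)
  have "I * P + J * K = 1\<^sub>m n"
    using P I car PI KJ KI PJ r1 n by (intro biproduct_complement) auto
  moreover have "n - r = m" using n r1 by simp
  ultimately show ?thesis using car KJ KI PJ r1 n by auto
qed

text \<open>Fredholm alternative, by induction on the number of rows \<open>c i\<close>. If the new
  row does not kill the vector \<open>l\<close> found so far, subtract from \<open>\<psi>\<close>
  the multiple of the new row that makes it vanish at \<open>l\<close>, and use the induction
  hypothesis a second time.\<close>

lemma functional_alternative:
  fixes c :: "nat \<Rightarrow> 'b \<Rightarrow> 'k::field"
  assumes B: "finite B"
  shows "(\<exists>\<mu>. \<forall>b\<in>B. \<psi> b = (\<Sum>i<w. \<mu> i * c i b)) \<or>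
    (\<exists>l. (\<forall>i<w. (\<Sum>b\<in>B. c i b * l b) = 0) \<and> (\<Sum>b\<in>B. \<psi> b * l b) = 1)"
proof (induction w arbitrary: \<psi>)
  case 0
  show ?case
  proof (cases "\<forall>b\<in>B. \<psi> b = 0")
    case False
    then obtain b0 where b0: "b0 \<in> B" "\<psi> b0 \<noteq> 0" by blast
    have "(\<Sum>b\<in>B. \<psi> b * (if b = b0 then 1 / \<psi> b0 else 0)) = 1"
      using b0 B by (simp add: if_distrib[of "\<lambda>x. _ * x"] cong: if_cong)
    then show ?thesis by (intro disjI2 exI conjI) auto
  qed simp
next
  case (Suc w)
  from Suc.IH[of \<psi>] show ?case
  proof (elim disjE exE conjE)
    fix \<mu> assume "\<forall>b\<in>B. \<psi> b = (\<Sum>i<w. \<mu> i * c i b)"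
    then have "\<forall>b\<in>B. \<psi> b = (\<Sum>i<Suc w. (\<mu>(w := 0)) i * c i b)" by simp
    then show ?thesis by blast
  next
    fix l assume l: "\<forall>i<w. (\<Sum>b\<in>B. c i b * l b) = 0" "(\<Sum>b\<in>B. \<psi> b * l b) = 1"
    define t where "t = (\<Sum>b\<in>B. c w b * l b)"
    show ?thesis
    proof (cases "t = 0")
      case True
      then show ?thesis using l unfolding t_def by (metis less_SucE)
    next
      case False
      from Suc.IH[of "\<lambda>b. \<psi> b - c w b / t"] show ?thesis
      proof (elim disjE exE conjE)
        fix \<mu> assume "\<forall>b\<in>B. \<psi> b - c w b / t = (\<Sum>i<w. \<mu> i * c i b)"
        then have "\<forall>b\<in>B. \<psi> b = (\<Sum>i<Suc w. (\<mu>(w := 1 / t)) i * c i b)" by (auto simp: algebra_simps)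
        then show ?thesis by blast
      next
        fix l' assume l': "\<forall>i<w. (\<Sum>b\<in>B. c i b * l' b) = 0" "(\<Sum>b\<in>B. (\<psi> b - c w b / t) * l' b) = 1"
        define S where "S = (\<Sum>b\<in>B. c w b * l' b)"
        \<comment> \<open>The correction by \<open>l\<close> makes the new row vanish on
          \<open>m\<close>; the old rows vanish on \<open>l\<close> and \<open>l'\<close> alike, and
          \<open>\<psi>\<close> takes on \<open>m\<close> the value of the modified functional on
          \<open>l'\<close>.\<close>
        define m where "m b = l' b - S / t * l b" for b
        have lin: "(\<Sum>b\<in>B. g b * m b) = (\<Sum>b\<in>B. g b * l' b) - S / t * (\<Sum>b\<in>B. g b * l b)" for g
          by (simp add: m_def right_diff_distrib sum_subtractf sum_distrib_left ac_simps)
        have "(\<Sum>b\<in>B. \<psi> b * l' b) - S / t = 1"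
          using l'(2) by (simp add: S_def left_diff_distrib sum_subtractf sum_divide_distrib)
        then have "(\<Sum>b\<in>B. \<psi> b * m b) = 1" using l(2) by (simp add: lin)
        moreover have "(\<Sum>b\<in>B. c i b * m b) = 0" if "i < Suc w" for i
          using that l(1) l'(1) False by (cases "i = w") (auto simp: lin t_def[symmetric] S_def[symmetric])
        ultimately show ?thesis by blast
      qed
    qed
  qed
qed


section \<open>Morphisms and direct sums of representations\<close>

lemma is_hom_dims:
  assumes "is_hom N Q R S h" "v \<in> {1..N}"
  shows "dim_row (h v) = vdim S v" "dim_col (h v) = vdim R v"
  using assms by (auto simp: is_hom_def)

lemma is_hom_arrow:
  assumes "is_hom N Q R S h" "(s, t) \<in> Q"
  shows "h t * amap R (s, t) = amap S (s, t) * h s"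
  using assms by (auto simp: is_hom_def)

lemma is_homI:
  assumes "\<And>v. v \<in> {1..N} \<Longrightarrow> dim_row (h v) = vdim S v"
    and "\<And>v. v \<in> {1..N} \<Longrightarrow> dim_col (h v) = vdim R v"
    and "\<And>s t. (s, t) \<in> Q \<Longrightarrow> h t * amap R (s, t) = amap S (s, t) * h s"
  shows "is_hom N Q R S h"
  using assms by (auto simp: is_hom_def)

lemma is_rep_dims:
  assumes "is_rep N Q R" "(s, t) \<in> Q"
  shows "dim_row (amap R (s, t)) = vdim R t" "dim_col (amap R (s, t)) = vdim R s"
  using assms by (auto simp: is_rep_def)

lemma is_repI:
  assumes "\<And>s t. (s, t) \<in> Q \<Longrightarrow> dim_row (amap R (s, t)) = vdim R t"
    and "\<And>s t. (s, t) \<in> Q \<Longrightarrow> dim_col (amap R (s, t)) = vdim R s"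
  shows "is_rep N Q R"
  using assms by (auto simp: is_rep_def)

lemma vdim_direct_sum [simp]: "vdim (direct_sum R S) v = vdim R v + vdim S v"
  by (simp add: direct_sum_def)

lemma amap_direct_sum [simp]: "amap (direct_sum R S) a = block_diag (amap R a) (amap S a)"
  by (simp add: direct_sum_def)

lemma direct_sum_assoc: "direct_sum (direct_sum R S) T = direct_sum R (direct_sum S T)"
  by (simp add: direct_sum_def block_diag_assoc add.assoc)

lemma direct_sum_zero_rep [simp]: "direct_sum zero_rep R = R"
  by (simp add: direct_sum_def zero_rep_def)

lemma direct_sum_list_simps [simp]:
  "direct_sum_list [] = zero_rep"
  "direct_sum_list (R # Rs) = direct_sum R (direct_sum_list Rs)"
  by (simp_all add: direct_sum_list_def)

lemma direct_sum_list_append: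
  "direct_sum_list (Rs @ Ss) = direct_sum (direct_sum_list Rs) (direct_sum_list Ss)"
  by (induction Rs) (auto simp: direct_sum_assoc)

lemma is_rep_direct_sum:
  "is_rep N Q R \<Longrightarrow> is_rep N Q S \<Longrightarrow> is_rep N Q (direct_sum R S)"
  by (intro is_repI) (auto simp: is_rep_dims)

lemma is_rep_zero_rep: "is_rep N Q zero_rep"
  by (intro is_repI) (auto simp: zero_rep_def)

lemma is_rep_direct_sum_list:
  "(\<And>R. R \<in> set Rs \<Longrightarrow> is_rep N Q R) \<Longrightarrow> is_rep N Q (direct_sum_list Rs)"
  by (induction Rs) (auto intro: is_rep_direct_sum is_rep_zero_rep)

text \<open>Interpreted not only for \<open>Q\<close> but also for its restriction to the first
  \<open>m\<close> vertices, whose representations are decomposed by induction.\<close>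

locale quiver =
  fixes N :: nat and Q :: "(nat \<times> nat) set"
  assumes Q_vertices: "(s, t) \<in> Q \<Longrightarrow> s \<in> {1..N} \<and> t \<in> {1..N}"
begin

abbreviation "rep \<equiv> is_rep N Q"
abbreviation "qhom \<equiv> is_hom N Q"
abbreviation "qiso \<equiv> isomorphic N Q"

lemma hom_comp:
  assumes h: "qhom R S h" and g: "qhom S T g" and rep: "rep R" "rep S" "rep T"
  shows "qhom R T (\<lambda>v. g v * h v)"
proof (rule is_homI)
  fix s t assume st: "(s, t) \<in> Q"
  then have v: "s \<in> {1..N}" "t \<in> {1..N}" using Q_vertices by auto
  note dims = is_hom_dims[OF h v(1)] is_hom_dims[OF h v(2)] is_hom_dims[OF g v(1)] is_hom_dims[OF g v(2)]
    is_rep_dims[OF rep(1) st] is_rep_dims[OF rep(2) st] is_rep_dims[OF rep(3) st]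
  have "g t * h t * amap R (s, t) = g t * (amap S (s, t) * h s)"
    using dims by (simp add: mult_mat_assoc is_hom_arrow[OF h st])
  also have "\<dots> = amap T (s, t) * g s * h s"
    using dims by (simp add: is_hom_arrow[OF g st] flip: mult_mat_assoc)
  also have "\<dots> = amap T (s, t) * (g s * h s)" using dims by (simp add: mult_mat_assoc)
  finally show "g t * h t * amap R (s, t) = amap T (s, t) * (g s * h s)" .
qed (use is_hom_dims[OF h] is_hom_dims[OF g] in auto)

lemma hom_id: "rep R \<Longrightarrow> qhom R R (\<lambda>v. 1\<^sub>m (vdim R v))"
  by (rule is_homI) (auto simp: is_rep_dims)

lemma hom_inverse:
  assumes h: "qhom R S h" and rep: "rep R" "rep S"
    and g: "\<And>v. v \<in> {1..N} \<Longrightarrow> g v \<in> carrier_mat (vdim R v) (vdim S v)"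
    and gh: "\<And>v. v \<in> {1..N} \<Longrightarrow> g v * h v = 1\<^sub>m (vdim R v)"
    and hg: "\<And>v. v \<in> {1..N} \<Longrightarrow> h v * g v = 1\<^sub>m (vdim S v)"
  shows "qhom S R g"
proof (rule is_homI)
  fix s t assume st: "(s, t) \<in> Q"
  then have v: "s \<in> {1..N}" "t \<in> {1..N}" using Q_vertices by auto
  note dims = is_hom_dims[OF h v(1)] is_hom_dims[OF h v(2)]
    carrier_matD[OF g[OF v(1)]] carrier_matD[OF g[OF v(2)]]
    is_rep_dims[OF rep(1) st] is_rep_dims[OF rep(2) st]
  have "g t * amap S (s, t) = g t * (amap S (s, t) * (h s * g s))" using dims hg[OF v(1)] by simp
  also have "\<dots> = g t * (h t * amap R (s, t) * g s)"
    using dims by (simp add: is_hom_arrow[OF h st] mult_mat_assoc)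
  also have "\<dots> = g t * h t * (amap R (s, t) * g s)" using dims by (simp add: mult_mat_assoc)
  also have "\<dots> = amap R (s, t) * g s" using dims gh[OF v(2)] by simp
  finally show "g t * amap S (s, t) = amap R (s, t) * g s" .
qed (use g in auto)

text \<open>\<open>invertible_mat\<close> demands square matrices; a two-sided inverse forces the
  two dimensions to agree.\<close>

lemma isomorphicI:
  assumes h: "qhom R S h"
    and g: "\<And>v. v \<in> {1..N} \<Longrightarrow> g v \<in> carrier_mat (vdim R v) (vdim S v)"
    and gh: "\<And>v. v \<in> {1..N} \<Longrightarrow> g v * h v = 1\<^sub>m (vdim R v)"
    and hg: "\<And>v. v \<in> {1..N} \<Longrightarrow> h v * g v = 1\<^sub>m (vdim S v)"
  shows "is_iso N Q R S h"
  unfolding is_iso_def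
proof (intro conjI ballI)
  fix v assume v: "v \<in> {1..N}"
  note dims = is_hom_dims[OF h v] carrier_matD[OF g[OF v]]
  have "vdim R v = vdim S v"
    using inverse_dim_eq[OF g[OF v] _ gh[OF v] hg[OF v]] dims by auto
  then show "invertible_mat (h v)"
    unfolding invertible_mat_def inverts_mat_def using gh[OF v] hg[OF v] dims by auto
qed (rule h)

lemma is_isoE:
  assumes iso: "is_iso N Q R S h" and rep: "rep R" "rep S"
  obtains g where "qhom S R g"
    "\<And>v. v \<in> {1..N} \<Longrightarrow> g v * h v = 1\<^sub>m (vdim R v)" "\<And>v. v \<in> {1..N} \<Longrightarrow> h v * g v = 1\<^sub>m (vdim S v)"
    "\<And>v. v \<in> {1..N} \<Longrightarrow> vdim R v = vdim S v"
proof -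
  have h: "qhom R S h" and inv: "\<And>v. v \<in> {1..N} \<Longrightarrow> invertible_mat (h v)"
    using iso by (auto simp: is_iso_def)
  have sq: "vdim R v = vdim S v" if "v \<in> {1..N}" for v
    using inv[OF that] is_hom_dims[OF h that] by (auto simp: invertible_mat_def)
  have "\<forall>v\<in>{1..N}. \<exists>B. B \<in> carrier_mat (vdim R v) (vdim S v) \<and>
      B * h v = 1\<^sub>m (vdim R v) \<and> h v * B = 1\<^sub>m (vdim S v)"
  proof
    fix v assume v: "v \<in> {1..N}"
    from inv[OF v] obtain B where B: "h v * B = 1\<^sub>m (dim_row (h v))" "B * h v = 1\<^sub>m (dim_row B)"
      by (auto simp: invertible_mat_def inverts_mat_def)
    have "dim_col (h v * B) = dim_row (h v)" "dim_col (B * h v) = dim_row B" using B by simp_all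
    then have "B \<in> carrier_mat (vdim R v) (vdim S v)"
      using is_hom_dims[OF h v] by auto
    then show "\<exists>B. B \<in> carrier_mat (vdim R v) (vdim S v) \<and>
      B * h v = 1\<^sub>m (vdim R v) \<and> h v * B = 1\<^sub>m (vdim S v)"
      using B is_hom_dims[OF h v] by auto
  qed
  then obtain g where g: "\<And>v. v \<in> {1..N} \<Longrightarrow> g v \<in> carrier_mat (vdim R v) (vdim S v)"
     "\<And>v. v \<in> {1..N} \<Longrightarrow> g v * h v = 1\<^sub>m (vdim R v)" "\<And>v. v \<in> {1..N} \<Longrightarrow> h v * g v = 1\<^sub>m (vdim S v)"
    by metis
  show ?thesis using that[OF hom_inverse[OF h rep g] g(2,3) sq] by blast
qed

lemma isoE:
  assumes "qiso R S" and rep: "rep R" "rep S"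
  obtains h g where "qhom R S h" "qhom S R g"
    "\<And>v. v \<in> {1..N} \<Longrightarrow> g v * h v = 1\<^sub>m (vdim R v)" "\<And>v. v \<in> {1..N} \<Longrightarrow> h v * g v = 1\<^sub>m (vdim S v)"
    "\<And>v. v \<in> {1..N} \<Longrightarrow> vdim R v = vdim S v"
proof -
  from assms(1) obtain h where h: "is_iso N Q R S h" by (auto simp: isomorphic_def)
  then have "qhom R S h" by (simp add: is_iso_def)
  with is_isoE[OF h rep] that show ?thesis by metis
qed

lemma isoI:
  assumes "qhom R S h" "qhom S R g"
    "\<And>v. v \<in> {1..N} \<Longrightarrow> g v * h v = 1\<^sub>m (vdim R v)" "\<And>v. v \<in> {1..N} \<Longrightarrow> h v * g v = 1\<^sub>m (vdim S v)"
  shows "qiso R S"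
proof -
  have "g v \<in> carrier_mat (vdim R v) (vdim S v)" if "v \<in> {1..N}" for v
    using is_hom_dims[OF assms(2) that] by auto
  from isomorphicI[OF assms(1) this assms(3,4)] show ?thesis by (auto simp: isomorphic_def)
qed

lemma iso_vdim: "qiso R S \<Longrightarrow> rep R \<Longrightarrow> rep S \<Longrightarrow> v \<in> {1..N} \<Longrightarrow> vdim R v = vdim S v"
  by (elim isoE) auto

lemma iso_refl: "rep R \<Longrightarrow> qiso R R"
  by (rule isoI[OF hom_id hom_id]) auto

lemma iso_sym: "qiso R S \<Longrightarrow> rep R \<Longrightarrow> rep S \<Longrightarrow> qiso S R"
  by (elim isoE) (auto intro: isoI)

lemma comp_inverse:
  assumes "qhom R S h" "qhom S R g" "qhom S T h'" "qhom T S g'" "v \<in> {1..N}"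
    "g v * h v = 1\<^sub>m (vdim R v)" "g' v * h' v = 1\<^sub>m (vdim S v)"
  shows "(g v * g' v) * (h' v * h v) = 1\<^sub>m (vdim R v)"
proof -
  note dims = is_hom_dims[OF assms(1,5)] is_hom_dims[OF assms(2,5)] is_hom_dims[OF assms(3,5)]
    is_hom_dims[OF assms(4,5)]
  have "(g v * g' v) * (h' v * h v) = g v * ((g' v * h' v) * h v)"
    using dims by (simp add: mult_mat_assoc)
  also have "\<dots> = 1\<^sub>m (vdim R v)" using assms dims by simp
  finally show ?thesis .
qed

lemma iso_trans:
  assumes "qiso R S" "qiso S T" and rep: "rep R" "rep S" "rep T"
  shows "qiso R T"
proof -
  from isoE[OF assms(1) rep(1,2)] obtain h g where hg: "qhom R S h" "qhom S R g"
    "\<And>v. v \<in> {1..N} \<Longrightarrow> g v * h v = 1\<^sub>m (vdim R v)" "\<And>v. v \<in> {1..N} \<Longrightarrow> h v * g v = 1\<^sub>m (vdim S v)"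
    by metis
  from isoE[OF assms(2) rep(2,3)] obtain h' g' where hg': "qhom S T h'" "qhom T S g'"
    "\<And>v. v \<in> {1..N} \<Longrightarrow> g' v * h' v = 1\<^sub>m (vdim S v)" "\<And>v. v \<in> {1..N} \<Longrightarrow> h' v * g' v = 1\<^sub>m (vdim T v)"
    by metis
  show ?thesis
    by (rule isoI[OF hom_comp[OF hg(1) hg'(1) rep] hom_comp[OF hg'(2) hg(2) rep(3,2,1)]])
      (use comp_inverse[OF hg(1,2) hg'(1,2)] comp_inverse[OF hg'(2,1) hg(2,1)] hg hg' in auto)
qed

lemma hom_inl: "rep R \<Longrightarrow> rep S \<Longrightarrow> qhom R (direct_sum R S) (\<lambda>v. inl_mat (vdim R v) (vdim S v))"
  by (intro is_homI) (auto simp: is_rep_dims block_diag_simps(3))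

lemma hom_inr: "rep R \<Longrightarrow> rep S \<Longrightarrow> qhom S (direct_sum R S) (\<lambda>v. inr_mat (vdim R v) (vdim S v))"
  by (intro is_homI) (auto simp: is_rep_dims block_diag_simps(4))

lemma hom_prl: "rep R \<Longrightarrow> rep S \<Longrightarrow> qhom (direct_sum R S) R (\<lambda>v. prl_mat (vdim R v) (vdim S v))"
  by (intro is_homI) (auto simp: is_rep_dims block_diag_simps(1))

lemma hom_prr: "rep R \<Longrightarrow> rep S \<Longrightarrow> qhom (direct_sum R S) S (\<lambda>v. prr_mat (vdim R v) (vdim S v))"
  by (intro is_homI) (auto simp: is_rep_dims block_diag_simps(2))

lemma hom_pair:
  assumes f: "qhom T R f" and g: "qhom T S g" and rep: "rep R" "rep S" "rep T"
  shows "qhom T (direct_sum R S)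
    (\<lambda>v. inl_mat (vdim R v) (vdim S v) * f v + inr_mat (vdim R v) (vdim S v) * g v)"
proof (rule is_homI)
  fix s t assume st: "(s, t) \<in> Q"
  then have v: "s \<in> {1..N}" "t \<in> {1..N}" using Q_vertices by auto
  note dims = is_hom_dims[OF f v(1)] is_hom_dims[OF f v(2)] is_hom_dims[OF g v(1)] is_hom_dims[OF g v(2)]
    is_rep_dims[OF rep(1) st] is_rep_dims[OF rep(2) st] is_rep_dims[OF rep(3) st]
  note bd = block_diag_simps(3,4)[OF dims(9,11,10,12)]
  show "(inl_mat (vdim R t) (vdim S t) * f t + inr_mat (vdim R t) (vdim S t) * g t) * amap T (s, t) =
    amap (direct_sum R S) (s, t) * (inl_mat (vdim R s) (vdim S s) * f s + inr_mat (vdim R s) (vdim S s) * g s)"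
    using dims bd
    by (simp add: mult_add_mat add_mult_mat mult_mat_assoc is_hom_arrow[OF f st] is_hom_arrow[OF g st])
       (simp add: bd flip: mult_mat_assoc)
qed (use is_hom_dims[OF f] is_hom_dims[OF g] in auto)

lemma hom_copair:
  assumes f: "qhom R T f" and g: "qhom S T g" and rep: "rep R" "rep S" "rep T"
  shows "qhom (direct_sum R S) T
    (\<lambda>v. f v * prl_mat (vdim R v) (vdim S v) + g v * prr_mat (vdim R v) (vdim S v))"
proof (rule is_homI)
  fix s t assume st: "(s, t) \<in> Q"
  then have v: "s \<in> {1..N}" "t \<in> {1..N}" using Q_vertices by auto
  note dims = is_hom_dims[OF f v(1)] is_hom_dims[OF f v(2)] is_hom_dims[OF g v(1)] is_hom_dims[OF g v(2)]
    is_rep_dims[OF rep(1) st] is_rep_dims[OF rep(2) st] is_rep_dims[OF rep(3) st]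
  note bd = block_diag_simps(1,2)[OF dims(9,11,10,12)]
  show "(f t * prl_mat (vdim R t) (vdim S t) + g t * prr_mat (vdim R t) (vdim S t)) * amap (direct_sum R S) (s, t) =
    amap T (s, t) * (f s * prl_mat (vdim R s) (vdim S s) + g s * prr_mat (vdim R s) (vdim S s))"
    using dims bd
    by (simp add: mult_add_mat add_mult_mat mult_mat_assoc)
       (simp add: is_hom_arrow[OF f st] is_hom_arrow[OF g st] flip: mult_mat_assoc)
qed (use is_hom_dims[OF f] is_hom_dims[OF g] in auto)

lemma block_diag_inverse:
  assumes "X \<in> carrier_mat a b" "X' \<in> carrier_mat b a" "Y \<in> carrier_mat c d" "Y' \<in> carrier_mat d c"
    and "X * X' = (1\<^sub>m a :: 'k::field mat)" "Y * Y' = 1\<^sub>m c"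
  shows "block_diag X Y * block_diag X' Y' = 1\<^sub>m (a + c)"
proof -
  have "block_diag X Y * block_diag X' Y' = inl_mat a c * (X * X') * prl_mat a c + inr_mat a c * (Y * Y') * prr_mat a c"
    using assms(1-4) by (simp add: block_diag_eq mult_add_mat add_mult_mat mult_mat_assoc)
  then show ?thesis using assms by (simp add: biproduct_sum)
qed

lemma hom_block_diag:
  assumes f: "qhom R R' f" and g: "qhom S S' g" and rep: "rep R" "rep S" "rep R'" "rep S'"
  shows "qhom (direct_sum R S) (direct_sum R' S') (\<lambda>v. block_diag (f v) (g v))"
proof (rule is_homI)
  fix s t assume st: "(s, t) \<in> Q"
  then have v: "s \<in> {1..N}" "t \<in> {1..N}" using Q_vertices by auto
  note dims = is_hom_dims[OF f v(1)] is_hom_dims[OF f v(2)] is_hom_dims[OF g v(1)] is_hom_dims[OF g v(2)]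
    is_rep_dims[OF rep(1) st] is_rep_dims[OF rep(2) st] is_rep_dims[OF rep(3) st] is_rep_dims[OF rep(4) st]
  have "block_diag X Y * block_diag Z W = block_diag (X * Z) (Y * W)"
    if "dim_col X = dim_row Z" "dim_col Y = dim_row W" for X Y Z W :: "'a mat"
    using that by (simp add: block_diag_eq mult_add_mat add_mult_mat mult_mat_assoc)
  then show "block_diag (f t) (g t) * amap (direct_sum R S) (s, t) =
       amap (direct_sum R' S') (s, t) * block_diag (f s) (g s)"
    using dims by (simp add: is_hom_arrow[OF f st] is_hom_arrow[OF g st])
qed (use is_hom_dims[OF f] is_hom_dims[OF g] in auto)

lemma direct_sum_cong:
  assumes "qiso R R'" "qiso S S'" and rep: "rep R" "rep S" "rep R'" "rep S'"
  shows "qiso (direct_sum R S) (direct_sum R' S')"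
proof -
  from isoE[OF assms(1) rep(1,3)] obtain h g where hg: "qhom R R' h" "qhom R' R g"
    "\<And>v. v \<in> {1..N} \<Longrightarrow> g v * h v = 1\<^sub>m (vdim R v)" "\<And>v. v \<in> {1..N} \<Longrightarrow> h v * g v = 1\<^sub>m (vdim R' v)"
    by metis
  from isoE[OF assms(2) rep(2,4)] obtain h' g' where hg': "qhom S S' h'" "qhom S' S g'"
    "\<And>v. v \<in> {1..N} \<Longrightarrow> g' v * h' v = 1\<^sub>m (vdim S v)" "\<And>v. v \<in> {1..N} \<Longrightarrow> h' v * g' v = 1\<^sub>m (vdim S' v)"
    by metis
  have car: "h v \<in> carrier_mat (vdim R' v) (vdim R v)" "g v \<in> carrier_mat (vdim R v) (vdim R' v)"
    "h' v \<in> carrier_mat (vdim S' v) (vdim S v)" "g' v \<in> carrier_mat (vdim S v) (vdim S' v)"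
    if "v \<in> {1..N}" for v using hg hg' that by (auto simp: is_hom_def)
  show ?thesis
    by (rule isoI[OF hom_block_diag[OF hg(1) hg'(1) rep] hom_block_diag[OF hg(2) hg'(2) rep(3,4,1,2)]])
     (use block_diag_inverse[OF car(2,1,4,3)] block_diag_inverse[OF car(1,2,3,4)] hg hg' in auto)
qed

lemma biproduct_swap:
  "(inr_mat b a * prl_mat a b + inl_mat b a * prr_mat a b) *
     (inr_mat a b * prl_mat b a + inl_mat a b * prr_mat b a) = (1\<^sub>m (b + a) :: 'k::field mat)"
  by (simp add: mult_add_mat add_mult_mat mult_mat_assoc biproduct_sum)

lemma direct_sum_commute:
  assumes rep: "rep R" "rep S"
  shows "qiso (direct_sum R S) (direct_sum S R)"
  by (rule isoI[OF hom_copair[OF hom_inr[OF rep(2,1)] hom_inl[OF rep(2,1)]]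
        hom_copair[OF hom_inr[OF rep] hom_inl[OF rep]]])
    (use rep biproduct_swap in \<open>auto intro: is_rep_direct_sum\<close>)

text \<open>The complement is the quotient of \<open>R\<close> by the image of \<open>x\<close>, in
  coordinates \<open>K\<close> chosen vertexwise, and \<open>(f, K)\<close> is the isomorphism. The
  bound \<open>thin\<close> is what \<open>retract_complement\<close> asks for.\<close>

lemma split_retract:
  fixes R A :: "'k::field rep"
  assumes x: "qhom A R x" and f: "qhom R A f" and rep: "rep A" "rep R"
    and fx: "\<And>v. v \<in> {1..N} \<Longrightarrow> f v * x v = 1\<^sub>m (vdim A v)"
    and thin: "\<And>v. v \<in> {1..N} \<Longrightarrow> vdim A v \<le> 1"
  shows "\<exists>C. rep C \<and> qiso R (direct_sum A C)"
proof -
  define P where "P v K J \<longleftrightarrow> K \<in> carrier_mat (vdim R v - vdim A v) (vdim R v) \<and>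
     J \<in> carrier_mat (vdim R v) (vdim R v - vdim A v) \<and> vdim A v \<le> vdim R v \<and>
    K * J = 1\<^sub>m (vdim R v - vdim A v) \<and> K * x v = 0\<^sub>m (vdim R v - vdim A v) (vdim A v) \<and>
    f v * J = 0\<^sub>m (vdim A v) (vdim R v - vdim A v) \<and> x v * f v + J * K = 1\<^sub>m (vdim R v)" for v K J
  have "\<forall>v\<in>{1..N}. \<exists>K J. P v K J"
  proof
    fix v assume v: "v \<in> {1..N}"
    have "f v \<in> carrier_mat (vdim A v) (vdim R v)" "x v \<in> carrier_mat (vdim R v) (vdim A v)"
      using x f v by (auto simp: is_hom_def)
    from retract_complement[OF this fx[OF v] thin[OF v]] show "\<exists>K J. P v K J"
      unfolding P_def by blast
  qed
  then obtain K J where "\<And>v. v \<in> {1..N} \<Longrightarrow> P v (K v) (J v)" by metis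
  then have KJ:
    "\<And>v. v \<in> {1..N} \<Longrightarrow> K v \<in> carrier_mat (vdim R v - vdim A v) (vdim R v)"
    "\<And>v. v \<in> {1..N} \<Longrightarrow> J v \<in> carrier_mat (vdim R v) (vdim R v - vdim A v)"
    "\<And>v. v \<in> {1..N} \<Longrightarrow> vdim A v \<le> vdim R v"
    "\<And>v. v \<in> {1..N} \<Longrightarrow> K v * J v = 1\<^sub>m (vdim R v - vdim A v)"
    "\<And>v. v \<in> {1..N} \<Longrightarrow> K v * x v = 0\<^sub>m (vdim R v - vdim A v) (vdim A v)"
    "\<And>v. v \<in> {1..N} \<Longrightarrow> f v * J v = 0\<^sub>m (vdim A v) (vdim R v - vdim A v)"
    "\<And>v. v \<in> {1..N} \<Longrightarrow> x v * f v + J v * K v = 1\<^sub>m (vdim R v)"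
    unfolding P_def by blast+
  define C where "C = \<lparr>vdim = (\<lambda>v. vdim R v - vdim A v), amap = (\<lambda>(s, t). K t * amap R (s, t) * J s)\<rparr>"
  have C[simp]: "vdim C v = vdim R v - vdim A v" "amap C (s, t) = K t * amap R (s, t) * J s" for v s t
    by (simp_all add: C_def)
  have repC: "rep C"
    using carrier_matD[OF KJ(1)] carrier_matD[OF KJ(2)] Q_vertices by (intro is_repI) auto
  have homK: "qhom R C K"
  proof (rule is_homI)
    fix s t assume st: "(s, t) \<in> Q"
    then have v: "s \<in> {1..N}" "t \<in> {1..N}" using Q_vertices by auto
    note dims = is_hom_dims[OF f v(1)] is_hom_dims[OF f v(2)] is_hom_dims[OF x v(1)] is_hom_dims[OF x v(2)]
      is_rep_dims[OF rep(1) st] is_rep_dims[OF rep(2) st]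
      carrier_matD[OF KJ(1)[OF v(1)]] carrier_matD[OF KJ(1)[OF v(2)]]
      carrier_matD[OF KJ(2)[OF v(1)]] carrier_matD[OF KJ(2)[OF v(2)]]
    \<comment> \<open>Insert the identity in the middle: the part through \<open>x\<close> dies,
      because the image of \<open>x\<close> is a subrepresentation and \<open>K\<close> kills
      it.\<close>
    have "K t * amap R (s, t) = K t * (amap R (s, t) * (x s * f s + J s * K s))"
      using dims KJ(7)[OF v(1)] by simp
    also have "\<dots> = K t * (amap R (s, t) * x s) * f s + K t * amap R (s, t) * J s * K s"
      using dims by (simp add: mult_add_mat mult_mat_assoc)
    also have "K t * (amap R (s, t) * x s) = K t * x t * amap A (s, t)"
      using dims by (simp add: is_hom_arrow[OF x st, symmetric] mult_mat_assoc)
    finally show "K t * amap R (s, t) = amap C (s, t) * K s"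
      using dims KJ(5)[OF v(2)] by simp
  qed (use carrier_matD[OF KJ(1)] in auto)
  have "is_iso N Q R (direct_sum A C)
    (\<lambda>v. inl_mat (vdim A v) (vdim C v) * f v + inr_mat (vdim A v) (vdim C v) * K v)"
  proof (rule isomorphicI[OF hom_pair[OF f homK rep(1) repC rep(2)], where g =
        "\<lambda>v. x v * prl_mat (vdim A v) (vdim C v) + J v * prr_mat (vdim A v) (vdim C v)"])
    fix v assume v: "v \<in> {1..N}"
    note dims = is_hom_dims[OF f v] is_hom_dims[OF x v] carrier_matD[OF KJ(1)[OF v]] carrier_matD[OF KJ(2)[OF v]]
    show "x v * prl_mat (vdim A v) (vdim C v) + J v * prr_mat (vdim A v) (vdim C v)
      \<in> carrier_mat (vdim R v) (vdim (direct_sum A C) v)" using dims KJ(3)[OF v] by auto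
    show "(x v * prl_mat (vdim A v) (vdim C v) + J v * prr_mat (vdim A v) (vdim C v)) *
         (inl_mat (vdim A v) (vdim C v) * f v + inr_mat (vdim A v) (vdim C v) * K v) = 1\<^sub>m (vdim R v)"
      using dims KJ(7)[OF v] by (simp add: mult_add_mat add_mult_mat mult_mat_assoc)
    show "(inl_mat (vdim A v) (vdim C v) * f v + inr_mat (vdim A v) (vdim C v) * K v) *
       (x v * prl_mat (vdim A v) (vdim C v) + J v * prr_mat (vdim A v) (vdim C v)) = 1\<^sub>m (vdim (direct_sum A C) v)"
      using dims fx[OF v] KJ(4-6)[OF v]
      by (simp add: mult_add_mat add_mult_mat mult_mat_assoc biproduct_sum flip: mult_mat_assoc[of "f v"] mult_mat_assoc[of "K v"])
  qed
  then show ?thesis using repC by (auto simp: isomorphic_def)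
qed

end


section \<open>Interval representations\<close>

text \<open>Half-open because \<open>F_obj (i, j)\<close> starts at vertex \<open>i + 1\<close>.
  Thus an endpoint \<open>k\<close> of a segment marks the edge between \<open>k\<close> and
  \<open>k + 1\<close> at which the interval is cut off.\<close>

definition ivl :: "nat \<times> nat \<Rightarrow> nat \<Rightarrow> bool" where
  "ivl c v \<longleftrightarrow> fst c < v \<and> v \<le> snd c"

text \<open>Indexed by the number of vertices of the quiver, the parameter of the induction;
  \<open>segments n\<close> is \<open>segs (n + 2)\<close>.\<close>

definition segs :: "nat \<Rightarrow> (nat \<times> nat) set" where
  "segs m = {(i, j). i < j \<and> j \<le> m}"

lemma vdim_F_obj [simp]: "vdim (F_obj c) v = (if ivl c v then 1 else 0)"
  by (cases c) (auto simp: interval_rep_def ivl_def Let_def)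

lemma amap_F_obj: "amap (F_obj c) (s, t) =
    (if ivl c s \<and> ivl c t then 1\<^sub>m 1 else 0\<^sub>m (if ivl c t then 1 else 0) (if ivl c s then 1 else 0))"
  by (cases c) (auto simp: interval_rep_def ivl_def Let_def)

lemma is_rep_F_obj: "is_rep N Q (F_obj c)"
  by (intro is_repI) (auto simp: amap_F_obj)

text \<open>At an arrow starting outside \<open>c\<close> both sides of the commutation equation
  have no columns, so conditions remain only at arrows starting in \<open>c\<close>.\<close>

lemma hom_from_F_objI:
  assumes rep: "is_rep N Q R"
    and "\<And>v. v \<in> {1..N} \<Longrightarrow> dim_row (x v) = vdim R v"
    and "\<And>v. v \<in> {1..N} \<Longrightarrow> dim_col (x v) = (if ivl c v then 1 else 0)"
    and "\<And>s t. (s, t) \<in> Q \<Longrightarrow> s \<in> {1..N} \<and> t \<in> {1..N}"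
    and "\<And>s t. (s, t) \<in> Q \<Longrightarrow> ivl c s \<Longrightarrow> ivl c t \<Longrightarrow> amap R (s, t) * x s = x t"
    and "\<And>s t. (s, t) \<in> Q \<Longrightarrow> ivl c s \<Longrightarrow> \<not> ivl c t \<Longrightarrow> amap R (s, t) * x s = 0\<^sub>m (vdim R t) 1"
  shows "is_hom N Q (F_obj c) R x"
proof (rule is_homI)
  fix s t assume st: "(s, t) \<in> Q"
  have v: "s \<in> {1..N}" "t \<in> {1..N}" using assms(4)[OF st] by auto
  note dims = is_rep_dims[OF rep st] assms(2,3)[OF v(1)] assms(2,3)[OF v(2)]
  show "x t * amap (F_obj c) (s, t) = amap R (s, t) * x s"
  proof (cases "ivl c s")
    case True
    then show ?thesis using assms(5,6)[OF st] dims by (cases "ivl c t") (auto simp: amap_F_obj)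
  next
    case False
    then show ?thesis using dims by (intro mat_empty_eq) (auto simp: amap_F_obj)
  qed
qed (use assms in auto)

lemma hom_to_F_objI:
  assumes rep: "is_rep N Q R"
    and "\<And>v. v \<in> {1..N} \<Longrightarrow> dim_row (f v) = (if ivl c v then 1 else 0)"
    and "\<And>v. v \<in> {1..N} \<Longrightarrow> dim_col (f v) = vdim R v"
    and "\<And>s t. (s, t) \<in> Q \<Longrightarrow> s \<in> {1..N} \<and> t \<in> {1..N}"
    and "\<And>s t. (s, t) \<in> Q \<Longrightarrow> ivl c t \<Longrightarrow> ivl c s \<Longrightarrow> f t * amap R (s, t) = f s"
    and "\<And>s t. (s, t) \<in> Q \<Longrightarrow> ivl c t \<Longrightarrow> \<not> ivl c s \<Longrightarrow> f t * amap R (s, t) = 0\<^sub>m 1 (vdim R s)"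
  shows "is_hom N Q R (F_obj c) f"
proof (rule is_homI)
  fix s t assume st: "(s, t) \<in> Q"
  have v: "s \<in> {1..N}" "t \<in> {1..N}" using assms(4)[OF st] by auto
  note dims = is_rep_dims[OF rep st] assms(2,3)[OF v(1)] assms(2,3)[OF v(2)]
  show "f t * amap R (s, t) = amap (F_obj c) (s, t) * f s"
  proof (cases "ivl c t")
    case True
    then show ?thesis using assms(5,6)[OF st] dims by (cases "ivl c s") (auto simp: amap_F_obj)
  next
    case False
    then show ?thesis using dims by (intro mat_empty_eq) (auto simp: amap_F_obj)
  qed
qed (use assms in auto)

context quiver
begin

lemma hom_from_F_objD:
  assumes x: "qhom (F_obj c) R x" and st: "(s, t) \<in> Q" "ivl c s"
  shows "ivl c t \<Longrightarrow> amap R (s, t) * x s = x t"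
    and "\<not> ivl c t \<Longrightarrow> amap R (s, t) * x s = 0\<^sub>m (vdim R t) 1"
  using is_hom_arrow[OF x st(1)] is_hom_dims[OF x, of s] is_hom_dims[OF x, of t] Q_vertices[OF st(1)] st(2)
  by (auto simp: amap_F_obj)

lemma hom_to_F_objD:
  assumes x: "qhom R (F_obj c) f" and st: "(s, t) \<in> Q" "ivl c t"
  shows "ivl c s \<Longrightarrow> f t * amap R (s, t) = f s"
    and "\<not> ivl c s \<Longrightarrow> f t * amap R (s, t) = 0\<^sub>m 1 (vdim R s)"
  using is_hom_arrow[OF x st(1)] is_hom_dims[OF x, of s] is_hom_dims[OF x, of t] Q_vertices[OF st(1)] st(2)
  by (auto simp: amap_F_obj)

end

text \<open>
  The inclusions and projections of a decomposition of \<open>R\<close> into the intervals listed in \<open>xs\<close>.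
  Completeness, that is, \<open>\<Sum> \<iota> a * \<pi> a = 1\<close>, is expressed through scalars, because matrices of
  varying dimensions do not form a type on which \<open>\<Sum>\<close> is available.
\<close>

definition decomposition ::
  "nat \<Rightarrow> (nat \<times> nat) set \<Rightarrow> 'k::field rep \<Rightarrow> (nat \<times> nat) list \<Rightarrow>
    (nat \<Rightarrow> 'k family) \<Rightarrow> (nat \<Rightarrow> 'k family) \<Rightarrow> bool" where
  "decomposition N Q R xs \<iota> \<pi> \<longleftrightarrow>
    (\<forall>a<length xs. is_hom N Q (F_obj (xs ! a)) R (\<iota> a) \<and> is_hom N Q R (F_obj (xs ! a)) (\<pi> a)) \<and>
    (\<forall>a<length xs. \<forall>b<length xs. \<forall>v\<in>{1..N}. ivl (xs ! a) v \<longrightarrow> ivl (xs ! b) v \<longrightarrow>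
       (\<pi> a v * \<iota> b v) $$ (0, 0) = (if a = b then 1 else 0)) \<and>
    (\<forall>v\<in>{1..N}. \<forall>Y Z. dim_row Y = 1 \<longrightarrow> dim_col Y = vdim R v \<longrightarrow> dim_row Z = vdim R v \<longrightarrow> dim_col Z = 1 \<longrightarrow>
       (Y * Z) $$ (0, 0) = (\<Sum>a<length xs. if ivl (xs ! a) v
          then (Y * \<iota> a v) $$ (0, 0) * (\<pi> a v * Z) $$ (0, 0) else 0))"

lemma decompositionD:
  assumes "decomposition N Q R xs \<iota> \<pi>"
  shows "a < length xs \<Longrightarrow> is_hom N Q (F_obj (xs ! a)) R (\<iota> a)"
    and "a < length xs \<Longrightarrow> is_hom N Q R (F_obj (xs ! a)) (\<pi> a)"
    and "a < length xs \<Longrightarrow> b < length xs \<Longrightarrow> v \<in> {1..N} \<Longrightarrow> ivl (xs ! a) v \<Longrightarrow> ivl (xs ! b) v \<Longrightarrow>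
       (\<pi> a v * \<iota> b v) $$ (0, 0) = (if a = b then 1 else 0)"
    and "v \<in> {1..N} \<Longrightarrow> dim_row Y = 1 \<Longrightarrow> dim_col Y = vdim R v \<Longrightarrow> dim_row Z = vdim R v \<Longrightarrow> dim_col Z = 1 \<Longrightarrow>
       (Y * Z) $$ (0, 0) = (\<Sum>a<length xs. if ivl (xs ! a) v
          then (Y * \<iota> a v) $$ (0, 0) * (\<pi> a v * Z) $$ (0, 0) else 0)"
  using assms by (auto simp: decomposition_def)

lemma index_mult_1x1:
  fixes A B :: "'a::semiring_0 mat"
  assumes "dim_row A = 1" "dim_col A = 1" "dim_row B = 1" "dim_col B = 1"
  shows "(A * B) $$ (0, 0) = A $$ (0, 0) * B $$ (0, 0)"
  using assms by (subst index_mult_mat_sum) auto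

context quiver
begin

lemma decomposition_zero_rep: "decomposition N Q zero_rep [] \<iota> \<pi>"
  unfolding decomposition_def by (auto simp: zero_rep_def scalar_prod_def)

lemma decomposition_Cons:
  assumes d: "decomposition N Q R xs \<iota> \<pi>" and rep: "rep R"
  shows "decomposition N Q (direct_sum (F_obj c) R) (c # xs)
    (\<lambda>a v. case a of 0 \<Rightarrow> inl_mat ((if ivl c v then 1 else 0)) (vdim R v) | Suc a \<Rightarrow> inr_mat ((if ivl c v then 1 else 0)) (vdim R v) * \<iota> a v)
    (\<lambda>a v. case a of 0 \<Rightarrow> prl_mat ((if ivl c v then 1 else 0)) (vdim R v) | Suc a \<Rightarrow> \<pi> a v * prr_mat ((if ivl c v then 1 else 0)) (vdim R v))"
  (is "decomposition N Q ?S (c # xs) ?i ?p")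
proof -
  have rc: "rep (F_obj c)" by (rule is_rep_F_obj)
  have rs: "rep ?S" using rc rep by (rule is_rep_direct_sum)
  have ip: "qhom (F_obj ((c # xs) ! a)) ?S (?i a) \<and> qhom ?S (F_obj ((c # xs) ! a)) (?p a)"
    if "a < length (c # xs)" for a
  proof (cases a)
    case 0
    then show ?thesis using hom_inl[OF rc rep] hom_prl[OF rc rep] by simp
  next
    case (Suc b)
    then have b: "b < length xs" using that by simp
    show ?thesis using Suc hom_comp[OF decompositionD(1)[OF d b] hom_inr[OF rc rep] is_rep_F_obj rep rs]
       hom_comp[OF hom_prr[OF rc rep] decompositionD(2)[OF d b] rs rep is_rep_F_obj] by simp
  qed
  have dual: "(?p a v * ?i b v) $$ (0, 0) = (if a = b then 1 else 0)"
    if ab: "a < length (c # xs)" "b < length (c # xs)" and v: "v \<in> {1..N}"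
      and iv: "ivl ((c # xs) ! a) v" "ivl ((c # xs) ! b) v" for a b v
  proof (cases a; cases b)
    fix a' b' assume eq: "a = Suc a'" "b = Suc b'"
    then have ab': "a' < length xs" "b' < length xs" "ivl (xs ! a') v" "ivl (xs ! b') v" using ab iv by auto
    note dims = is_hom_dims[OF decompositionD(1)[OF d ab'(2)] v] is_hom_dims[OF decompositionD(2)[OF d ab'(1)] v]
    show ?thesis using decompositionD(3)[OF d ab'(1,2) v ab'(3,4)] dims eq
      by (simp add: mult_mat_assoc)
  next
    fix a' assume eq: "a = Suc a'" "b = 0"
    then have ab': "a' < length xs" "ivl (xs ! a') v" using ab iv by auto
    note dims = is_hom_dims[OF decompositionD(2)[OF d ab'(1)] v]
    show ?thesis using dims eq iv ab' by (simp add: mult_mat_assoc)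
  next
    fix b' assume eq: "a = 0" "b = Suc b'"
    then have ab': "b' < length xs" "ivl (xs ! b') v" using ab iv by auto
    note dims = is_hom_dims[OF decompositionD(1)[OF d ab'(1)] v]
    show ?thesis using dims eq iv ab' by (simp add: mult_mat_assoc)
  qed (use iv in simp)
  have compl: "(Y * Z) $$ (0, 0) = (\<Sum>a<length (c # xs). if ivl ((c # xs) ! a) v
          then (Y * ?i a v) $$ (0, 0) * (?p a v * Z) $$ (0, 0) else 0)"
    if v: "v \<in> {1..N}" and Y: "dim_row Y = 1" "dim_col Y = vdim ?S v"
      and Z: "dim_row Z = vdim ?S v" "dim_col Z = 1" for v Y Z
  proof -
    let ?a = "if ivl c v then 1 else 0 :: nat" and ?b = "vdim R v"
    \<comment> \<open>Insert the identity of the direct sum. The first term is the contribution of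
      the new summand, with index \<open>0\<close>; the second is expanded by the completeness of
      the given decomposition, whose indices shift by one.\<close>
    have "Y * Z = Y * ((inl_mat ?a ?b * prl_mat ?a ?b + inr_mat ?a ?b * prr_mat ?a ?b) * Z)"
      using Y Z by (simp add: biproduct_sum)
    also have "\<dots> = (Y * inl_mat ?a ?b) * (prl_mat ?a ?b * Z) + (Y * inr_mat ?a ?b) * (prr_mat ?a ?b * Z)"
      using Y Z by (simp add: mult_add_mat add_mult_mat mult_mat_assoc split del: if_split)
    finally have "(Y * Z) $$ (0, 0) = ((Y * inl_mat ?a ?b) * (prl_mat ?a ?b * Z)) $$ (0, 0) +
       ((Y * inr_mat ?a ?b) * (prr_mat ?a ?b * Z)) $$ (0, 0)" using Y Z by (simp del: index_mult_mat(1) split del: if_split)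
    also have "((Y * inl_mat ?a ?b) * (prl_mat ?a ?b * Z)) $$ (0, 0) =
       (if ivl c v then (Y * inl_mat ?a ?b) $$ (0, 0) * (prl_mat ?a ?b * Z) $$ (0, 0) else 0)"
    proof (cases "ivl c v")
      case True
      then show ?thesis using Y Z by (subst index_mult_1x1) auto
    next
      case False
      then show ?thesis using Y Z by (subst index_mult_mat_sum) auto
    qed
    also have "((Y * inr_mat ?a ?b) * (prr_mat ?a ?b * Z)) $$ (0, 0) =
       (\<Sum>a<length xs. if ivl (xs ! a) v
          then (Y * ?i (Suc a) v) $$ (0, 0) * (?p (Suc a) v * Z) $$ (0, 0) else 0)"
    proof (subst decompositionD(4)[OF d v])
      show "(\<Sum>a<length xs. if ivl (xs ! a) v
          then (Y * inr_mat ?a ?b * \<iota> a v) $$ (0, 0) * (\<pi> a v * (prr_mat ?a ?b * Z)) $$ (0, 0) else 0) =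
        (\<Sum>a<length xs. if ivl (xs ! a) v
          then (Y * ?i (Suc a) v) $$ (0, 0) * (?p (Suc a) v * Z) $$ (0, 0) else 0)"
      proof (rule sum.cong[OF refl])
        fix a assume "a \<in> {..<length xs}"
        then have a: "a < length xs" by simp
        note dims = is_hom_dims[OF decompositionD(2)[OF d a] v] is_hom_dims[OF decompositionD(1)[OF d a] v]
        show "(if ivl (xs ! a) v then (Y * inr_mat ?a ?b * \<iota> a v) $$ (0, 0) * (\<pi> a v * (prr_mat ?a ?b * Z)) $$ (0, 0) else 0) =
          (if ivl (xs ! a) v then (Y * ?i (Suc a) v) $$ (0, 0) * (?p (Suc a) v * Z) $$ (0, 0) else 0)"
          using dims Y Z by (cases "ivl (xs ! a) v") (simp_all add: mult_mat_assoc del: index_mult_mat(1) split del: if_split)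
      qed
    qed (use Y Z in auto)
    finally show ?thesis by (simp add: sum.lessThan_Suc_shift del: sum.lessThan_Suc index_mult_mat(1))
  qed
  show ?thesis unfolding decomposition_def using ip dual compl by blast
qed

lemma decomposition_iso:
  assumes d: "decomposition N Q S xs \<iota> \<pi>" and rep: "rep R" "rep S" and iso: "qiso R S"
  shows "\<exists>\<iota> \<pi>. decomposition N Q R xs \<iota> \<pi>"
proof -
  from isoE[OF iso rep] obtain h g where hg: "qhom R S h" "qhom S R g"
    "\<And>v. v \<in> {1..N} \<Longrightarrow> g v * h v = 1\<^sub>m (vdim R v)" "\<And>v. v \<in> {1..N} \<Longrightarrow> h v * g v = 1\<^sub>m (vdim S v)"
    by metis
  have "decomposition N Q R xs (\<lambda>a v. g v * \<iota> a v) (\<lambda>a v. \<pi> a v * h v)"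
    unfolding decomposition_def
  proof (intro conjI allI impI ballI)
    fix a assume a: "a < length xs"
    show "qhom (F_obj (xs ! a)) R (\<lambda>v. g v * \<iota> a v)" "qhom R (F_obj (xs ! a)) (\<lambda>v. \<pi> a v * h v)"
      using hom_comp[OF decompositionD(1)[OF d a] hg(2) is_rep_F_obj rep(2,1)]
        hom_comp[OF hg(1) decompositionD(2)[OF d a] rep is_rep_F_obj] by auto
  next
    fix a b v assume ab: "a < length xs" "b < length xs" and v: "v \<in> {1..N}" and iv: "ivl (xs ! a) v" "ivl (xs ! b) v"
    note dims = is_hom_dims[OF decompositionD(1)[OF d ab(2)] v] is_hom_dims[OF decompositionD(2)[OF d ab(1)] v]
      is_hom_dims[OF hg(1) v] is_hom_dims[OF hg(2) v]
    have "(\<pi> a v * h v) * (g v * \<iota> b v) = \<pi> a v * ((h v * g v) * \<iota> b v)"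
      using dims by (simp add: mult_mat_assoc)
    also have "\<dots> = \<pi> a v * \<iota> b v" using dims hg(4)[OF v] by simp
    finally show "((\<pi> a v * h v) * (g v * \<iota> b v)) $$ (0, 0) = (if a = b then 1 else 0)"
      using decompositionD(3)[OF d ab v iv] by simp
  next
    fix v and Y Z :: "'a mat"
    assume v: "v \<in> {1..N}" and Y: "dim_row Y = 1" "dim_col Y = vdim R v"
      and Z: "dim_row Z = vdim R v" "dim_col Z = 1"
    note dims = is_hom_dims[OF hg(1) v] is_hom_dims[OF hg(2) v]
    have "Y * Z = Y * ((g v * h v) * Z)" using Y Z hg(3)[OF v] by simp
    also have "\<dots> = (Y * g v) * (h v * Z)" using Y Z dims by (simp add: mult_mat_assoc)
    finally have "(Y * Z) $$ (0, 0) = ((Y * g v) * (h v * Z)) $$ (0, 0)" by simp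
    also have "\<dots> = (\<Sum>a<length xs. if ivl (xs ! a) v
        then (Y * g v * \<iota> a v) $$ (0, 0) * (\<pi> a v * (h v * Z)) $$ (0, 0) else 0)"
      using Y Z dims by (intro decompositionD(4)[OF d v]) auto
    also have "\<dots> = (\<Sum>a<length xs. if ivl (xs ! a) v
        then (Y * (g v * \<iota> a v)) $$ (0, 0) * (\<pi> a v * h v * Z) $$ (0, 0) else 0)"
    proof (rule sum.cong[OF refl])
      fix a assume "a \<in> {..<length xs}"
      then have a: "a < length xs" by simp
      note dims2 = is_hom_dims[OF decompositionD(2)[OF d a] v] is_hom_dims[OF decompositionD(1)[OF d a] v]
      show "(if ivl (xs ! a) v then (Y * g v * \<iota> a v) $$ (0, 0) * (\<pi> a v * (h v * Z)) $$ (0, 0) else 0) =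
        (if ivl (xs ! a) v then (Y * (g v * \<iota> a v)) $$ (0, 0) * (\<pi> a v * h v * Z) $$ (0, 0) else 0)"
        using dims dims2 Y Z by (cases "ivl (xs ! a) v") (simp_all add: mult_mat_assoc del: index_mult_mat(1))
    qed
    finally show "(Y * Z) $$ (0, 0) = (\<Sum>a<length xs. if ivl (xs ! a) v
        then (Y * (g v * \<iota> a v)) $$ (0, 0) * (\<pi> a v * h v * Z) $$ (0, 0) else 0)" .
  qed
  then show ?thesis by blast
qed

abbreviation "ivl_sum xs \<equiv> direct_sum_list (map F_obj xs)"

lemma rep_ivl_sum: "rep (ivl_sum xs)"
  by (rule is_rep_direct_sum_list) (auto intro: is_rep_F_obj)

lemma decomposition_exists:
  assumes rep: "rep R" and iso: "qiso R (ivl_sum xs)"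
  obtains \<iota> \<pi> where "decomposition N Q R xs \<iota> \<pi>"
proof -
  have "\<exists>\<iota> \<pi>. decomposition N Q (ivl_sum xs) xs \<iota> \<pi>"
  proof (induction xs)
    case (Cons c xs)
    then show ?case using decomposition_Cons[OF _ rep_ivl_sum] by (simp only: list.map direct_sum_list_simps) blast
  qed (use decomposition_zero_rep in auto)
  then show ?thesis using decomposition_iso[OF _ rep rep_ivl_sum iso] that by blast
qed

end


section \<open>Every representation is a sum of intervals\<close>

lemma dynkin_arrow:
  assumes "dynkin_quiver_A N Q" "(s, t) \<in> Q"
  obtains "t = Suc s" "s \<in> {1..<N}" | "s = Suc t" "t \<in> {1..<N}"
  using assms unfolding dynkin_quiver_A_def by fastforce

lemma quiver_dynkin: "dynkin_quiver_A N Q \<Longrightarrow> quiver N Q"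
  by unfold_locales (erule (1) dynkin_arrow; auto)

lemma dynkin_choice:
  "dynkin_quiver_A N Q \<Longrightarrow> i \<in> {1..<N} \<Longrightarrow> (i, Suc i) \<in> Q \<longleftrightarrow> (Suc i, i) \<notin> Q"
  unfolding dynkin_quiver_A_def by auto

lemma dynkin_restrict:
  assumes "dynkin_quiver_A (Suc m) Q"
  shows "dynkin_quiver_A m {(s, t) \<in> Q. s \<le> m \<and> t \<le> m}"
  unfolding dynkin_quiver_A_def
proof (intro conjI ballI)
  fix a assume a: "a \<in> {(s, t) \<in> Q. s \<le> m \<and> t \<le> m}"
  obtain s t where "a = (s, t)" by (cases a)
  with a have st: "(s, t) \<in> Q" "s \<le> m" "t \<le> m" by auto
  from assms st(1) show "case a of (s, t) \<Rightarrow> \<exists>i\<in>{1..<m}. (s, t) = (i, i + 1) \<or> (s, t) = (i + 1, i)"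
    by (cases rule: dynkin_arrow) (use st \<open>a = (s, t)\<close> in auto)
next
  fix i assume "i \<in> {1..<m}"
  then show "((i, i + 1) \<in> {(s, t) \<in> Q. s \<le> m \<and> t \<le> m}) \<noteq> ((i + 1, i) \<in> {(s, t) \<in> Q. s \<le> m \<and> t \<le> m})"
    using dynkin_choice[OF assms, of i] by auto
qed

lemma dynkin_converse: "dynkin_quiver_A N Q \<Longrightarrow> dynkin_quiver_A N (Q\<inverse>)"
  unfolding dynkin_quiver_A_def by fastforce

section \<open>Splitting one interval off a nonzero representation\<close>

definition retract :: "nat \<Rightarrow> (nat \<times> nat) set \<Rightarrow> 'k::field rep \<Rightarrow> nat \<times> nat \<Rightarrow> bool" where
  "retract N Q R c \<longleftrightarrow> (\<exists>x f. is_hom N Q (F_obj c) R x \<and> is_hom N Q R (F_obj c) f \<and>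
     (\<forall>v\<in>{1..N}. f v * x v = 1\<^sub>m (if ivl c v then 1 else 0)))"

lemma retractI:
  assumes x: "is_hom N Q (F_obj c) R x" and f: "is_hom N Q R (F_obj c) f"
    and fx: "\<And>v. v \<in> {1..N} \<Longrightarrow> ivl c v \<Longrightarrow> (f v * x v) $$ (0, 0) = 1"
  shows "retract N Q R c"
  unfolding retract_def
proof (intro exI conjI ballI, rule x, rule f)
  fix v assume v: "v \<in> {1..N}"
  show "f v * x v = 1\<^sub>m (if ivl c v then 1 else 0)"
  proof (cases "ivl c v")
    case True
    then show ?thesis using is_hom_dims[OF x v] is_hom_dims[OF f v] fx[OF v]
      by (subst mat_1x1_eq) auto
  next
    case False
    then show ?thesis using is_hom_dims[OF x v] is_hom_dims[OF f v]
      by (intro mat_empty_eq) auto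
  qed
qed

text \<open>Every arrow that meets an interval ending before \<open>m\<close> lies within the first
  \<open>m\<close> vertices, so its inclusion and projection stay morphisms when extended by zero to
  \<open>Suc m\<close>.\<close>

lemma retract_of_inner_interval:
  fixes R :: "'k::field rep"
  assumes Q: "dynkin_quiver_A (Suc m) Q" and rep: "is_rep (Suc m) Q R"
    and dec: "decomposition m {(s, t) \<in> Q. s \<le> m \<and> t \<le> m} R xs \<iota> \<pi>"
    and a: "a < length xs" and inner: "snd (xs ! a) < m"
  shows "retract (Suc m) Q R (xs ! a)"
proof -
  let ?Q = "{(s, t) \<in> Q. s \<le> m \<and> t \<le> m}"
  interpret quiver "Suc m" Q by (rule quiver_dynkin[OF Q])
  interpret q: quiver m ?Q by (rule quiver_dynkin[OF dynkin_restrict[OF Q]])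
  define x where "x v = (if v \<le> m then \<iota> a v else 0\<^sub>m (vdim R v) 0)" for v
  define f where "f v = (if v \<le> m then \<pi> a v else 0\<^sub>m 0 (vdim R v))" for v
  note hom = decompositionD(1,2)[OF dec a]
  have lt: "v < m" if "ivl (xs ! a) v" for v using that inner by (simp add: ivl_def)
  have small: "(s, t) \<in> ?Q" if "(s, t) \<in> Q" "ivl (xs ! a) s \<or> ivl (xs ! a) t" for s t
    using that(2) lt[of s] lt[of t] that(1) by (auto elim: dynkin_arrow[OF Q])
  show ?thesis
  proof (rule retractI)
    show "is_hom (Suc m) Q (F_obj (xs ! a)) R x"
    proof (rule hom_from_F_objI[OF rep])
      fix v assume "v \<in> {1..Suc m}"
      then show "dim_row (x v) = vdim R v" "dim_col (x v) = (if ivl (xs ! a) v then 1 else 0)"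
        using is_hom_dims[OF hom(1), of v] lt[of v] by (auto simp: x_def)
    next
      fix s t assume "(s, t) \<in> Q" "ivl (xs ! a) s"
      with small have st: "(s, t) \<in> ?Q" by blast
      then have "x s = \<iota> a s" "x t = \<iota> a t" by (auto simp: x_def)
      with q.hom_from_F_objD[OF hom(1) st \<open>ivl (xs ! a) s\<close>]
      show "ivl (xs ! a) t \<Longrightarrow> amap R (s, t) * x s = x t"
        "\<not> ivl (xs ! a) t \<Longrightarrow> amap R (s, t) * x s = 0\<^sub>m (vdim R t) 1" by auto
    qed (use Q_vertices in auto)
    show "is_hom (Suc m) Q R (F_obj (xs ! a)) f"
    proof (rule hom_to_F_objI[OF rep])
      fix v assume "v \<in> {1..Suc m}"
      then show "dim_col (f v) = vdim R v" "dim_row (f v) = (if ivl (xs ! a) v then 1 else 0)"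
        using is_hom_dims[OF hom(2), of v] lt[of v] by (auto simp: f_def)
    next
      fix s t assume "(s, t) \<in> Q" "ivl (xs ! a) t"
      with small have st: "(s, t) \<in> ?Q" by blast
      then have "f s = \<pi> a s" "f t = \<pi> a t" by (auto simp: f_def)
      with q.hom_to_F_objD[OF hom(2) st \<open>ivl (xs ! a) t\<close>]
      show "ivl (xs ! a) s \<Longrightarrow> f t * amap R (s, t) = f s"
        "\<not> ivl (xs ! a) s \<Longrightarrow> f t * amap R (s, t) = 0\<^sub>m 1 (vdim R s)" by auto
    qed (use Q_vertices in auto)
    fix v assume "v \<in> {1..Suc m}" "ivl (xs ! a) v"
    then show "(f v * x v) $$ (0, 0) = 1"
      using decompositionD(3)[OF dec a a, of v] lt[of v] by (simp add: f_def x_def)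
  qed
qed

lemma index_mult_unit_col:
  fixes X :: "'a::semiring_1 mat"
  shows "i < dim_row X \<Longrightarrow> j < dim_col X \<Longrightarrow> dim_col X = n \<Longrightarrow>
    (X * mat n 1 (\<lambda>(i, _). if i = j then 1 else 0)) $$ (i, 0) = X $$ (i, j)"
  by (subst index_mult_mat_sum) (auto simp: if_distrib[of "\<lambda>x. _ * x"] cong: if_cong)

text \<open>Completeness with no summands makes every product of a row and a column zero, which
  fails for a coordinate functional and its basis vector.\<close>

lemma decomposition_empty_vdim:
  assumes dec: "decomposition N Q R [] \<iota> \<pi>" and v: "v \<in> {1..N}"
  shows "vdim R v = 0"
proof (rule ccontr)
  assume "vdim R v \<noteq> 0"
  define Y where "Y = mat 1 (vdim R v) (\<lambda>(_, i). if i = 0 then 1 else 0 :: 'a)"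
  have "(Y * mat (vdim R v) 1 (\<lambda>(i, _). if i = 0 then 1 else 0)) $$ (0, 0) = Y $$ (0, 0)"
    using \<open>vdim R v \<noteq> 0\<close> by (intro index_mult_unit_col) (auto simp: Y_def)
  moreover have "(Y * mat (vdim R v) 1 (\<lambda>(i, _). if i = 0 then 1 else 0)) $$ (0, 0) = 0"
    using decompositionD(4)[OF dec v, of Y "mat (vdim R v) 1 (\<lambda>(i, _). if i = 0 then 1 else 0)"]
    by (simp add: Y_def)
  ultimately show False using \<open>vdim R v \<noteq> 0\<close> by (simp add: Y_def)
qed

text \<open>All neighbours of \<open>Suc m\<close> carry the zero space, so any basis vector there,
  with its coordinate functional, splits off a simple summand.\<close>

lemma retract_of_last_vertex:
  fixes R :: "'k::field rep"
  assumes Q: "dynkin_quiver_A (Suc m) Q" and rep: "is_rep (Suc m) Q R"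
    and zero: "\<And>v. v \<in> {1..m} \<Longrightarrow> vdim R v = 0" and nz: "\<not> is_zero_rep (Suc m) R"
  shows "retract (Suc m) Q R (m, Suc m)"
proof -
  interpret quiver "Suc m" Q by (rule quiver_dynkin[OF Q])
  have pos: "vdim R (Suc m) > 0" using nz zero unfolding is_zero_rep_def by (metis atLeastAtMost_iff gr0I le_SucE)
  define x where "x v = mat (vdim R v) (if v = Suc m then 1 else 0) (\<lambda>(i, _). if i = 0 then 1 else 0 :: 'k)" for v
  define f where "f v = mat (if v = Suc m then 1 else 0) (vdim R v) (\<lambda>(_, i). if i = 0 then 1 else 0 :: 'k)" for v
  have iv: "ivl (m, Suc m) v \<longleftrightarrow> v = Suc m" for v by (auto simp: ivl_def)
  have st: "s \<in> {1..m} \<and> t = Suc m \<or> s = Suc m \<and> t \<in> {1..m}" if "(s, t) \<in> Q" "s = Suc m \<or> t = Suc m" for s t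
    using that by (auto elim: dynkin_arrow[OF Q])
  show ?thesis
  proof (rule retractI)
    show "is_hom (Suc m) Q (F_obj (m, Suc m)) R x"
    proof (rule hom_from_F_objI[OF rep])
      fix s t assume "(s, t) \<in> Q" "ivl (m, Suc m) s" "\<not> ivl (m, Suc m) t"
      moreover from this have "vdim R t = 0" using st[of s t] zero by (auto simp: iv)
      ultimately show "amap R (s, t) * x s = 0\<^sub>m (vdim R t) 1"
        using is_rep_dims[OF rep, of s t] by (intro mat_empty_eq) (auto simp: iv x_def)
    next
      fix s t assume "(s, t) \<in> Q" "ivl (m, Suc m) s" "ivl (m, Suc m) t"
      then show "amap R (s, t) * x s = x t" using st[of s t] by (auto simp: iv)
    qed (use Q_vertices in \<open>auto simp: x_def iv\<close>)
    show "is_hom (Suc m) Q R (F_obj (m, Suc m)) f"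
    proof (rule hom_to_F_objI[OF rep])
      fix s t assume "(s, t) \<in> Q" "ivl (m, Suc m) t" "\<not> ivl (m, Suc m) s"
      moreover from this have "vdim R s = 0" using st[of s t] zero by (auto simp: iv)
      ultimately show "f t * amap R (s, t) = 0\<^sub>m 1 (vdim R s)"
        using is_rep_dims[OF rep, of s t] by (intro mat_empty_eq) (auto simp: iv f_def)
    next
      fix s t assume "(s, t) \<in> Q" "ivl (m, Suc m) t" "ivl (m, Suc m) s"
      then show "f t * amap R (s, t) = f s" using st[of s t] by (auto simp: iv)
    qed (use Q_vertices in \<open>auto simp: f_def iv\<close>)
    fix v assume "v \<in> {1..Suc m}" "ivl (m, Suc m) v"
    then have "v = Suc m" by (simp add: iv)
    then have "f v * x v = f v * mat (vdim R v) 1 (\<lambda>(i, _). if i = 0 then 1 else 0)" by (simp add: x_def)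
    also have "\<dots> $$ (0, 0) = f v $$ (0, 0)"
      using pos \<open>v = Suc m\<close> by (intro index_mult_unit_col) (auto simp: f_def)
    finally show "(f v * x v) $$ (0, 0) = 1" using pos \<open>v = Suc m\<close> by (simp add: f_def)
  qed
qed

text \<open>
  The interval numbered \<open>a\<close> has a morphism to each of the others which is the identity at \<open>m\<close>;
  the conclusion says this in terms of arrows.
\<close>

lemma flexible_interval_exists:
  assumes Q: "dynkin_quiver_A m Q" and xs: "xs \<noteq> []" "set xs \<subseteq> segs m" "\<forall>a<length xs. snd (xs ! a) = m"
  shows "\<exists>a<length xs. \<forall>b s t. b < length xs \<longrightarrow> (s, t) \<in> Q \<longrightarrow> ivl (xs ! a) s \<longrightarrow> ivl (xs ! b) t \<longrightarrow>
       ivl (xs ! b) s \<and> ivl (xs ! a) t"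
proof -
  define S where "S = fst ` set xs"
  \<comment> \<open>A morphism that is the identity at \<open>m\<close>, from left end
    \<open>i\<close> to left end \<open>j\<close>, needs the arrow
    \<open>Suc j \<rightarrow> j\<close> if \<open>i < j\<close>, and the arrow
    \<open>i \<rightarrow> Suc i\<close> if \<open>j < i\<close>. The largest left end with
    \<open>i \<rightarrow> Suc i\<close>, or the least left end if there is none, meets all these
    demands; it is \<open>Max D\<close>.\<close>
  define D where "D = {i \<in> S. i = Min S \<or> (i, Suc i) \<in> Q}"
  have S: "finite S" "S \<noteq> {}" using xs by (auto simp: S_def)
  have "Min S \<in> D" using Min_in[OF S] by (simp add: D_def)
  then have "D \<noteq> {}" by blast
  moreover have "finite D" using S by (simp add: D_def)
  ultimately have D: "finite D" "D \<noteq> {}" by auto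
  define i where "i = Max D"
  have i: "i \<in> D" "i \<in> S" using Max_in[OF D] by (auto simp: i_def D_def)
  then obtain a where a: "a < length xs" "fst (xs ! a) = i" by (auto simp: S_def in_set_conv_nth)
  have "ivl (xs ! b) s \<and> ivl (xs ! a) t"
    if b: "b < length xs" and st: "(s, t) \<in> Q" and s: "ivl (xs ! a) s" and t: "ivl (xs ! b) t" for b s t
  proof -
    define j where "j = fst (xs ! b)"
    have j: "j \<in> S" "j < m" using b xs by (auto simp: j_def S_def segs_def dest: nth_mem)
    have iv: "ivl (xs ! a) v \<longleftrightarrow> i < v \<and> v \<le> m" "ivl (xs ! b) v \<longleftrightarrow> j < v \<and> v \<le> m" for v
      using a xs(3) b by (auto simp: ivl_def j_def)
    have up: "(j, Suc j) \<notin> Q" if "i < j"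
      using that Max_ge[OF D(1), of j] j by (auto simp: i_def D_def)
    have down: "(Suc i, i) \<notin> Q" if "j < i"
    proof -
      have "i \<noteq> Min S" using that Min_le[OF S(1) j(1)] by auto
      then have "(i, Suc i) \<in> Q" using i by (simp add: D_def)
      moreover from this have "i \<in> {1..<m}" by (auto elim: dynkin_arrow[OF Q])
      ultimately show ?thesis using dynkin_choice[OF Q, of i] by blast
    qed
    from Q st show ?thesis
    proof (cases rule: dynkin_arrow)
      case 1
      have "j \<noteq> s" using up s st 1 by (auto simp: iv)
      then show ?thesis using 1 s t by (auto simp: iv)
    next
      case 2
      have "i \<noteq> t" using down t st 2 by (auto simp: iv)
      then show ?thesis using 2 s t by (auto simp: iv)
    qed
  qed
  with a(1) show ?thesis by blast
qed

text \<open>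
  Let \<open>A\<close> be the map from \<open>m\<close> to \<open>Suc m\<close>, and \<open>e b\<close> the generator at \<open>m\<close> of the summand \<open>xs ! b\<close>.
  Either a functional takes \<open>A (e a)\<close> to \<open>1\<close> and the other \<open>A (e b)\<close> to \<open>0\<close>, and the summand \<open>a\<close>
  extends to \<open>Suc m\<close>; or \<open>A (\<Sum>b. l b * e b) = 0\<close> with \<open>l a = 1\<close>, and the choice of \<open>a\<close> allows
  to replace its generator by this combination.
\<close>

lemma retract_of_outer_interval:
  fixes R :: "'k::field rep"
  assumes Q: "dynkin_quiver_A (Suc m) Q" and rep: "is_rep (Suc m) Q R" and arr: "(Suc m, m) \<notin> Q"
    and dec: "decomposition m {(s, t) \<in> Q. s \<le> m \<and> t \<le> m} R xs \<iota> \<pi>"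
    and xs: "xs \<noteq> []" "set xs \<subseteq> segs m" "\<And>a. a < length xs \<Longrightarrow> snd (xs ! a) = m"
  shows "\<exists>c\<in>segs (Suc m). retract (Suc m) Q R c"
proof -
  let ?Q = "{(s, t) \<in> Q. s \<le> m \<and> t \<le> m}"
  interpret quiver "Suc m" Q by (rule quiver_dynkin[OF Q])
  interpret q: quiver m ?Q by (rule quiver_dynkin[OF dynkin_restrict[OF Q]])
  obtain a where a: "a < length xs" and flex': "\<forall>b s t. b < length xs \<longrightarrow> (s, t) \<in> ?Q \<longrightarrow>
      ivl (xs ! a) s \<longrightarrow> ivl (xs ! b) t \<longrightarrow> ivl (xs ! b) s \<and> ivl (xs ! a) t"
    using flexible_interval_exists[OF dynkin_restrict[OF Q] xs(1,2)] xs(3) by auto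
  have flex: "ivl (xs ! b) s \<and> ivl (xs ! a) t"
    if "b < length xs" "(s, t) \<in> ?Q" "ivl (xs ! a) s" "ivl (xs ! b) t" for b s t
    using flex'[rule_format, OF that] .
  define i where "i = fst (xs ! a)"
  have xa: "xs ! a = (i, m)" using xs(3)[OF a] by (cases "xs ! a") (simp add: i_def)
  have im: "i < m" using nth_mem[OF a] xs(2) xa by (auto simp: segs_def)
  have m: "m \<in> {1..m}" using im by auto
  have new: "s = m \<and> t = Suc m \<or> (s, t) \<in> ?Q" if "(s, t) \<in> Q" for s t
    using Q that
  proof (cases rule: dynkin_arrow)
    case 1
    then show ?thesis using that by (cases "s = m") auto
  next
    case 2
    then show ?thesis using that arr by (cases "t = m") auto
  qed
  have Qm: "(m, Suc m) \<in> Q" using dynkin_choice[OF Q, of m] arr m by auto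
  have ivm: "ivl (xs ! b) m" if "b < length xs" for b
    using nth_mem[OF that] xs(2) xs(3)[OF that] by (auto simp: segs_def ivl_def)
  define A where "A = amap R (m, Suc m)"
  define w where "w = vdim R (Suc m)"
  have A: "dim_row A = w" "dim_col A = vdim R m" using is_rep_dims[OF rep Qm] by (auto simp: A_def w_def)
  define G where "G b = A * \<iota> b m" for b
  note hom1 = decompositionD(1)[OF dec] and hom2 = decompositionD(2)[OF dec]
  have dim\<iota>: "dim_row (\<iota> b v) = vdim R v" "dim_col (\<iota> b v) = (if ivl (xs ! b) v then 1 else 0)"
    if "b < length xs" "v \<in> {1..m}" for b v using is_hom_dims[OF hom1[OF that(1)] that(2)] by auto
  have dim\<pi>: "dim_col (\<pi> b v) = vdim R v" "dim_row (\<pi> b v) = (if ivl (xs ! b) v then 1 else 0)"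
    if "b < length xs" "v \<in> {1..m}" for b v using is_hom_dims[OF hom2[OF that(1)] that(2)] by auto
  have G: "dim_row (G b) = w" "dim_col (G b) = 1" if "b < length xs" for b
    using dim\<iota>[OF that m] A ivm[OF that] by (auto simp: G_def)
  \<comment> \<open>The alternative is applied to the coordinate functional of \<open>a\<close> and
    to the \<open>w\<close> rows of the matrix with columns \<open>G b\<close>.\<close>
  have "(\<exists>\<mu>. \<forall>b\<in>{..<length xs}. (if b = a then 1 else 0) = (\<Sum>k<w. \<mu> k * G b $$ (k, 0))) \<or>
    (\<exists>l. (\<forall>k<w. (\<Sum>b\<in>{..<length xs}. G b $$ (k, 0) * l b) = 0) \<and>
      (\<Sum>b\<in>{..<length xs}. (if b = a then 1 else 0) * l b) = 1)"
    by (rule functional_alternative) simp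
  then show ?thesis
  proof (elim disjE exE conjE)
    fix \<mu> assume \<mu>: "\<forall>b\<in>{..<length xs}. (if b = a then 1 else 0) = (\<Sum>k<w. \<mu> k * G b $$ (k, 0))"
    define c where "c = (i, Suc m)"
    have iv: "ivl c v \<longleftrightarrow> v = Suc m \<or> ivl (xs ! a) v" for v using im by (auto simp: c_def xa ivl_def)
    define M where "M = mat 1 w (\<lambda>(_, k). \<mu> k)"
    have M: "dim_row M = 1" "dim_col M = w" by (auto simp: M_def)
    have MG: "(M * G b) $$ (0, 0) = (if b = a then 1 else 0)" if "b < length xs" for b
      using \<mu> that G[OF that] by (subst index_mult_mat_sum) (auto simp: M_def)
    define x where "x v = (if v \<le> m then \<iota> a v else G a)" for v
    define f where "f v = (if v \<le> m then \<pi> a v else M)" for v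
    \<comment> \<open>Compatibility of the projection with the new arrow. By completeness it
      suffices to compare the two functionals on the generators \<open>\<iota> b m\<close>, where
      both are the Kronecker delta.\<close>
    have MA: "M * A = \<pi> a m"
    proof (rule eq_matI)
      fix r j assume "r < dim_row (\<pi> a m)" and j: "j < dim_col (\<pi> a m)"
      then have r: "r = 0" using dim\<pi>[OF a m] ivm[OF a] by auto
      define Z where "Z = mat (vdim R m) 1 (\<lambda>(i, _). if i = j then 1 else 0 :: 'k)"
      have "(M * A) $$ (0, j) = (M * A * Z) $$ (0, 0)"
        unfolding Z_def using j dim\<pi>[OF a m] M A by (intro index_mult_unit_col[symmetric]) auto
      also have "\<dots> = (\<Sum>b<length xs. if ivl (xs ! b) m
          then (M * A * \<iota> b m) $$ (0, 0) * (\<pi> b m * Z) $$ (0, 0) else 0)"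
        using M A by (intro decompositionD(4)[OF dec m]) (auto simp: Z_def)
      also have "\<dots> = (\<Sum>b<length xs. if b = a then (\<pi> b m * Z) $$ (0, 0) else 0)"
      proof (rule sum.cong[OF refl])
        fix b assume "b \<in> {..<length xs}"
        then have b: "b < length xs" by simp
        have "M * A * \<iota> b m = M * G b" using dim\<iota>[OF b m] M A by (simp add: G_def mult_mat_assoc)
        then show "(if ivl (xs ! b) m then (M * A * \<iota> b m) $$ (0, 0) * (\<pi> b m * Z) $$ (0, 0) else 0) =
          (if b = a then (\<pi> b m * Z) $$ (0, 0) else 0)" using MG[OF b] ivm[OF b] by simp
      qed
      also have "\<dots> = (\<pi> a m * Z) $$ (0, 0)" using a by simp
      also have "\<dots> = \<pi> a m $$ (0, j)"
        unfolding Z_def using j dim\<pi>[OF a m] ivm[OF a] by (intro index_mult_unit_col) auto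
      finally show "(M * A) $$ (r, j) = \<pi> a m $$ (r, j)" using r by simp
    qed (use M A dim\<pi>[OF a m] ivm[OF a] in auto)
    have "retract (Suc m) Q R c"
    proof (rule retractI)
      show "is_hom (Suc m) Q (F_obj c) R x"
      proof (rule hom_from_F_objI[OF rep])
        fix v assume "v \<in> {1..Suc m}"
        then show "dim_row (x v) = vdim R v" "dim_col (x v) = (if ivl c v then 1 else 0)"
          using dim\<iota>[OF a, of v] G[OF a] by (auto simp: x_def iv w_def le_Suc_eq)
      next
        fix s t assume st: "(s, t) \<in> Q" "ivl c s" "ivl c t"
        from new[OF st(1)] show "amap R (s, t) * x s = x t"
          using st q.hom_from_F_objD[OF hom1[OF a], of s t] by (auto simp: x_def iv G_def A_def)
      next
        fix s t assume st: "(s, t) \<in> Q" "ivl c s" "\<not> ivl c t"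
        from new[OF st(1)] show "amap R (s, t) * x s = 0\<^sub>m (vdim R t) 1"
          using st q.hom_from_F_objD[OF hom1[OF a], of s t] by (auto simp: x_def iv)
      qed (use Q_vertices in auto)
      show "is_hom (Suc m) Q R (F_obj c) f"
      proof (rule hom_to_F_objI[OF rep])
        fix v assume "v \<in> {1..Suc m}"
        then show "dim_col (f v) = vdim R v" "dim_row (f v) = (if ivl c v then 1 else 0)"
          using dim\<pi>[OF a, of v] M by (auto simp: f_def iv w_def le_Suc_eq)
      next
        fix s t assume st: "(s, t) \<in> Q" "ivl c t" "ivl c s"
        from new[OF st(1)] show "f t * amap R (s, t) = f s"
          using st MA q.hom_to_F_objD[OF hom2[OF a], of s t] by (auto simp: f_def iv A_def)
      next
        fix s t assume st: "(s, t) \<in> Q" "ivl c t" "\<not> ivl c s"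
        from new[OF st(1)] show "f t * amap R (s, t) = 0\<^sub>m 1 (vdim R s)"
          using st ivm[OF a] q.hom_to_F_objD[OF hom2[OF a], of s t] by (auto simp: f_def iv)
      qed (use Q_vertices in auto)
      fix v assume "v \<in> {1..Suc m}" "ivl c v"
      then show "(f v * x v) $$ (0, 0) = 1"
        using decompositionD(3)[OF dec a a, of v] MG[OF a] by (auto simp: f_def x_def iv le_Suc_eq)
    qed
    moreover have "c \<in> segs (Suc m)" using im by (auto simp: c_def segs_def)
    ultimately show ?thesis by blast
  next
    fix l assume l: "\<forall>k<w. (\<Sum>b\<in>{..<length xs}. G b $$ (k, 0) * l b) = 0"
      "(\<Sum>b\<in>{..<length xs}. (if b = a then 1 else 0) * l b) = 1"
    have la: "l a = 1" using l(2) a by (simp add: if_distrib[of "\<lambda>x. x * _"] cong: if_cong)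
    define c where "c = xs ! a"
    have c_le: "v \<le> m" if "ivl c v" for v using that by (simp add: c_def xa ivl_def)
    \<comment> \<open>The combination with coefficients \<open>l b\<close> of all inclusions present
      at \<open>v\<close>, kept only on the vertices of \<open>c\<close>. The projection remains
      that of \<open>a\<close>, which suits because \<open>l a = 1\<close>.\<close>
    define x where "x v = mat (vdim R v) (if ivl c v then 1 else 0)
      (\<lambda>(k, _). \<Sum>b<length xs. if ivl (xs ! b) v then \<iota> b v $$ (k, 0) * l b else 0)" for v
    define f where "f v = (if v \<le> m then \<pi> a v else 0\<^sub>m 0 (vdim R v))" for v
    have mult_x: "(X * x v) $$ (r, 0) = (\<Sum>b<length xs. if ivl (xs ! b) v then (X * \<iota> b v) $$ (r, 0) * l b else 0)"
      if X: "dim_col X = vdim R v" "r < dim_row X" and v: "v \<in> {1..m}" "ivl c v" for X v r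
    proof -
      have "(X * x v) $$ (r, 0) = (\<Sum>k<vdim R v. X $$ (r, k) *
          (\<Sum>b<length xs. if ivl (xs ! b) v then \<iota> b v $$ (k, 0) * l b else 0))"
        using X v by (subst index_mult_mat_sum) (auto simp: x_def)
      also have "\<dots> = (\<Sum>b<length xs. \<Sum>k<vdim R v. if ivl (xs ! b) v then X $$ (r, k) * \<iota> b v $$ (k, 0) * l b else 0)"
        by (subst sum.swap) (auto simp: sum_distrib_left mult.assoc intro!: sum.cong)
      also have "\<dots> = (\<Sum>b<length xs. if ivl (xs ! b) v then (X * \<iota> b v) $$ (r, 0) * l b else 0)"
      proof (rule sum.cong[OF refl])
        fix b assume "b \<in> {..<length xs}"
        then have b: "b < length xs" by simp
        show "(\<Sum>k<vdim R v. if ivl (xs ! b) v then X $$ (r, k) * \<iota> b v $$ (k, 0) * l b else 0) =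
          (if ivl (xs ! b) v then (X * \<iota> b v) $$ (r, 0) * l b else 0)"
        proof (cases "ivl (xs ! b) v")
          case True
          then have "(X * \<iota> b v) $$ (r, 0) = (\<Sum>k<vdim R v. X $$ (r, k) * \<iota> b v $$ (k, 0))"
            using X dim\<iota>[OF b v(1)] by (subst index_mult_mat_sum) auto
          then show ?thesis using True by (simp add: sum_distrib_right)
        qed simp
      qed
      finally show ?thesis .
    qed
    have arrow_x: "(amap R (s, t) * x s) $$ (r, 0) =
        (\<Sum>b<length xs. if ivl (xs ! b) s \<and> ivl (xs ! b) t then \<iota> b t $$ (r, 0) * l b else 0)"
      if st: "(s, t) \<in> ?Q" and s: "ivl c s" and r: "r < vdim R t" for s t r
    proof -
      have stQ: "(s, t) \<in> Q" and v: "s \<in> {1..m}" "t \<in> {1..m}" using q.Q_vertices[OF st] st by auto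
      have "(amap R (s, t) * x s) $$ (r, 0) =
         (\<Sum>b<length xs. if ivl (xs ! b) s then (amap R (s, t) * \<iota> b s) $$ (r, 0) * l b else 0)"
        using is_rep_dims[OF rep stQ] r v s by (intro mult_x) auto
      also have "\<dots> = (\<Sum>b<length xs. if ivl (xs ! b) s \<and> ivl (xs ! b) t then \<iota> b t $$ (r, 0) * l b else 0)"
      proof (rule sum.cong[OF refl])
        fix b assume "b \<in> {..<length xs}"
        then have b: "b < length xs" by simp
        show "(if ivl (xs ! b) s then (amap R (s, t) * \<iota> b s) $$ (r, 0) * l b else 0) =
          (if ivl (xs ! b) s \<and> ivl (xs ! b) t then \<iota> b t $$ (r, 0) * l b else 0)"
          using q.hom_from_F_objD[OF hom1[OF b] st] r by auto
      qed
      finally show ?thesis .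
    qed
    have "retract (Suc m) Q R c"
    proof (rule retractI)
      show "is_hom (Suc m) Q (F_obj c) R x"
      proof (rule hom_from_F_objI[OF rep])
        fix s t assume st: "(s, t) \<in> Q" "ivl c s" "ivl c t"
        from new[OF st(1)] c_le[OF st(3)] have st': "(s, t) \<in> ?Q" by auto
        show "amap R (s, t) * x s = x t"
        proof (rule eq_matI)
          fix r k assume "r < dim_row (x t)" "k < dim_col (x t)"
          then have r: "r < vdim R t" "k = 0" using st by (auto simp: x_def)
          have "x t $$ (r, 0) = (\<Sum>b<length xs. if ivl (xs ! b) t then \<iota> b t $$ (r, 0) * l b else 0)"
            using r st by (simp add: x_def)
          \<comment> \<open>By the choice of \<open>a\<close>, a summand present at \<open>t\<close>
            is also present at \<open>s\<close>.\<close>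
          also have "\<dots> = (\<Sum>b<length xs. if ivl (xs ! b) s \<and> ivl (xs ! b) t then \<iota> b t $$ (r, 0) * l b else 0)"
            using flex[OF _ st'] st(2) by (intro sum.cong refl) (auto simp: c_def)
          finally show "(amap R (s, t) * x s) $$ (r, k) = x t $$ (r, k)"
            using arrow_x[OF st' st(2) r(1)] r by simp
        qed (use is_rep_dims[OF rep st(1)] st in \<open>auto simp: x_def\<close>)
      next
        fix s t assume st: "(s, t) \<in> Q" "ivl c s" "\<not> ivl c t"
        show "amap R (s, t) * x s = 0\<^sub>m (vdim R t) 1"
        proof (rule eq_matI)
          fix r k assume "r < dim_row (0\<^sub>m (vdim R t) 1 :: 'k mat)" "k < dim_col (0\<^sub>m (vdim R t) 1 :: 'k mat)"
          then have r: "r < vdim R t" "k = 0" by auto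
          from new[OF st(1)] have "(amap R (s, t) * x s) $$ (r, 0) = 0"
          proof
            assume st': "(s, t) \<in> ?Q"
            \<comment> \<open>A summand present at \<open>t\<close> would, by the choice of
              \<open>a\<close>, force \<open>t\<close> into \<open>c\<close>; so no term
              survives.\<close>
            show ?thesis unfolding arrow_x[OF st' st(2) r(1)]
              using flex[OF _ st'] st by (intro sum.neutral) (auto simp: c_def)
          next
            assume eq: "s = m \<and> t = Suc m"
            have "(A * x m) $$ (r, 0) = (\<Sum>b<length xs. if ivl (xs ! b) m then (A * \<iota> b m) $$ (r, 0) * l b else 0)"
              using A r eq st m by (intro mult_x) (auto simp: w_def)
            also have "\<dots> = (\<Sum>b<length xs. G b $$ (r, 0) * l b)"
              using ivm by (intro sum.cong) (auto simp: G_def)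
            also have "\<dots> = 0" using l(1) r eq by (auto simp: w_def)
            finally show ?thesis using eq by (simp add: A_def)
          qed
          then show "(amap R (s, t) * x s) $$ (r, k) = 0\<^sub>m (vdim R t) 1 $$ (r, k)" using r by simp
        qed (use is_rep_dims[OF rep st(1)] st in \<open>auto simp: x_def\<close>)
      qed (use Q_vertices in \<open>auto simp: x_def\<close>)
      show "is_hom (Suc m) Q R (F_obj c) f"
      proof (rule hom_to_F_objI[OF rep])
        fix v assume "v \<in> {1..Suc m}"
        then show "dim_col (f v) = vdim R v" "dim_row (f v) = (if ivl c v then 1 else 0)"
          using dim\<pi>[OF a, of v] c_le[of v] by (auto simp: f_def c_def)
      next
        fix s t assume st: "(s, t) \<in> Q" "ivl c t"
        from new[OF st(1)] c_le[OF st(2)] have st': "(s, t) \<in> ?Q" by auto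
        then have "f t = \<pi> a t" "f s = \<pi> a s" by (auto simp: f_def)
        with q.hom_to_F_objD[OF hom2[OF a] st'] st(2) show "ivl c s \<Longrightarrow> f t * amap R (s, t) = f s"
          "\<not> ivl c s \<Longrightarrow> f t * amap R (s, t) = 0\<^sub>m 1 (vdim R s)" by (auto simp: c_def)
      qed (use Q_vertices in auto)
      fix v assume v: "v \<in> {1..Suc m}" "ivl c v"
      then have vm: "v \<in> {1..m}" using c_le[of v] by auto
      have "(f v * x v) $$ (0, 0) = (\<pi> a v * x v) $$ (0, 0)" using vm by (simp add: f_def)
      also have "\<dots> = (\<Sum>b<length xs. if ivl (xs ! b) v then (\<pi> a v * \<iota> b v) $$ (0, 0) * l b else 0)"
        using vm v dim\<pi>[OF a vm] by (intro mult_x) (auto simp: c_def)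
      also have "\<dots> = (\<Sum>b<length xs. if b = a then l b else 0)"
        using decompositionD(3)[OF dec a _ vm] v by (intro sum.cong) (auto simp: c_def)
      also have "\<dots> = 1" using a la by simp
      finally show "(f v * x v) $$ (0, 0) = 1" .
    qed
    moreover have "c \<in> segs (Suc m)" using im by (auto simp: c_def xa segs_def)
    ultimately show ?thesis by blast
  qed
qed


section \<open>Duality, and the existence of interval decompositions\<close>

lemma transpose_mult_dims:
  fixes A B :: "'a::comm_semiring_0 mat"
  shows "dim_col A = dim_row B \<Longrightarrow> transpose_mat (A * B) = transpose_mat B * transpose_mat A"
  by (intro transpose_mult[of _ "dim_row A" "dim_col A" _ "dim_col B"] carrier_matI) simp_all

text \<open>The vector space dual, a representation of the opposite quiver in which intervals remain
  the same intervals. It exchanges the two directions of the arrow at the last edge.\<close>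

definition dual_rep :: "'k rep \<Rightarrow> 'k rep" where
  "dual_rep R = \<lparr>vdim = vdim R, amap = (\<lambda>(s, t). transpose_mat (amap R (t, s)))\<rparr>"

lemma dual_rep_simps [simp]:
  "vdim (dual_rep R) = vdim R" "amap (dual_rep R) (s, t) = transpose_mat (amap R (t, s))"
  by (simp_all add: dual_rep_def)

lemma is_rep_dual: "is_rep N Q R \<Longrightarrow> is_rep N (Q\<inverse>) (dual_rep R)"
  by (intro is_repI) (auto simp: is_rep_dims)

lemma amap_F_obj_dims [simp]:
  "dim_row (amap (F_obj c) (s, t)) = (if ivl c t then 1 else 0)"
  "dim_col (amap (F_obj c) (s, t)) = (if ivl c s then 1 else 0)"
  by (auto simp: amap_F_obj)

lemma transpose_F_obj: "transpose_mat (amap (F_obj c) (s, t)) = amap (F_obj c) (t, s)"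
  by (auto simp: amap_F_obj)

text \<open>Transposition exchanges the roles of inclusion and projection.\<close>

lemma retract_dual:
  fixes R :: "'k::field rep"
  assumes Q: "quiver N Q" and rep: "is_rep N Q R" and ret: "retract N (Q\<inverse>) (dual_rep R) c"
  shows "retract N Q R c"
proof -
  interpret quiver N Q by fact
  obtain x f where x: "is_hom N (Q\<inverse>) (F_obj c) (dual_rep R) x" and f: "is_hom N (Q\<inverse>) (dual_rep R) (F_obj c) f"
    and fx: "\<And>v. v \<in> {1..N} \<Longrightarrow> f v * x v = 1\<^sub>m (if ivl c v then 1 else 0)"
    using ret by (auto simp: retract_def)
  note xd = is_hom_dims[OF x, simplified] and fd = is_hom_dims[OF f, simplified]
  have "is_hom N Q (F_obj c) R (\<lambda>v. transpose_mat (f v))"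
  proof (rule is_homI)
    fix s t assume st: "(s, t) \<in> Q"
    then have v: "s \<in> {1..N}" "t \<in> {1..N}" using Q_vertices by auto
    have "f s * transpose_mat (amap R (s, t)) = amap (F_obj c) (t, s) * f t"
      using is_hom_arrow[OF f, of t s] st by simp
    moreover have "transpose_mat (f s * transpose_mat (amap R (s, t))) = amap R (s, t) * transpose_mat (f s)"
      "transpose_mat (amap (F_obj c) (t, s) * f t) = transpose_mat (f t) * amap (F_obj c) (s, t)"
      using fd[of s] fd[of t] v is_rep_dims[OF rep st]
      by (simp_all add: transpose_mult_dims transpose_F_obj)
    ultimately show "transpose_mat (f t) * amap (F_obj c) (s, t) = amap R (s, t) * transpose_mat (f s)" by metis
  qed (use fd in auto)
  moreover have "is_hom N Q R (F_obj c) (\<lambda>v. transpose_mat (x v))"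
  proof (rule is_homI)
    fix s t assume st: "(s, t) \<in> Q"
    then have v: "s \<in> {1..N}" "t \<in> {1..N}" using Q_vertices by auto
    have "x s * amap (F_obj c) (t, s) = transpose_mat (amap R (s, t)) * x t"
      using is_hom_arrow[OF x, of t s] st by simp
    moreover have "transpose_mat (transpose_mat (amap R (s, t)) * x t) = transpose_mat (x t) * amap R (s, t)"
      "transpose_mat (x s * amap (F_obj c) (t, s)) = amap (F_obj c) (s, t) * transpose_mat (x s)"
      using xd[of s] xd[of t] v is_rep_dims[OF rep st]
      by (simp_all add: transpose_mult_dims transpose_F_obj)
    ultimately show "transpose_mat (x t) * amap R (s, t) = amap (F_obj c) (s, t) * transpose_mat (x s)" by metis
  qed (use xd in auto)
  moreover have "transpose_mat (x v) * transpose_mat (f v) = 1\<^sub>m (if ivl c v then 1 else 0)" if "v \<in> {1..N}" for v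
    using fx[OF that] xd[of v] fd[of v] that by (simp flip: transpose_mult_dims)
  ultimately show ?thesis unfolding retract_def by blast
qed

text \<open>The restriction to the first \<open>m\<close> vertices has a summand that does not reach
  \<open>m\<close>, or is zero, or has only summands ending at \<open>m\<close>; each case supplies
  its own retract.\<close>

lemma retract_exists_forward:
  fixes R :: "'k::field rep"
  assumes IH: "\<And>Q (R :: 'k rep). dynkin_quiver_A m Q \<Longrightarrow> is_rep m Q R \<Longrightarrow>
      \<exists>xs. set xs \<subseteq> segs m \<and> isomorphic m Q R (direct_sum_list (map F_obj xs))"
    and Q: "dynkin_quiver_A (Suc m) Q" and rep: "is_rep (Suc m) Q R"
    and nz: "\<not> is_zero_rep (Suc m) R" and arr: "(Suc m, m) \<notin> Q"
  shows "\<exists>c\<in>segs (Suc m). retract (Suc m) Q R c"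
proof -
  let ?Q = "{(s, t) \<in> Q. s \<le> m \<and> t \<le> m}"
  note Q' = dynkin_restrict[OF Q]
  have rep': "is_rep m ?Q R" using rep by (auto simp: is_rep_def)
  obtain xs where xs: "set xs \<subseteq> segs m" "isomorphic m ?Q R (direct_sum_list (map F_obj xs))"
    using IH[OF Q' rep'] by blast
  obtain \<iota> \<pi> where dec: "decomposition m ?Q R xs \<iota> \<pi>"
    using quiver.decomposition_exists[OF quiver_dynkin[OF Q'] rep' xs(2)] by blast
  have le: "snd (xs ! a) \<le> m" if "a < length xs" for a
    using nth_mem[OF that] xs(1) by (auto simp: segs_def)
  consider a where "a < length xs" "snd (xs ! a) < m" | "xs = []" |
    "xs \<noteq> []" "\<And>a. a < length xs \<Longrightarrow> snd (xs ! a) = m"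
    using le by (meson le_neq_implies_less)
  then show ?thesis
  proof cases
    case 1
    have "xs ! a \<in> segs m" using nth_mem[OF 1(1)] xs(1) by blast
    then have "xs ! a \<in> segs (Suc m)" by (auto simp: segs_def)
    then show ?thesis using retract_of_inner_interval[OF Q rep dec 1] by blast
  next
    case 2
    have "retract (Suc m) Q R (m, Suc m)"
      using decomposition_empty_vdim dec 2 by (intro retract_of_last_vertex[OF Q rep _ nz]) blast
    then show ?thesis by (auto simp: segs_def)
  next
    case 3
    then show ?thesis using retract_of_outer_interval[OF Q rep arr dec 3(1) xs(1)] by blast
  qed
qed

lemma retract_exists:
  fixes R :: "'k::field rep"
  assumes IH: "\<And>Q (R :: 'k rep). dynkin_quiver_A m Q \<Longrightarrow> is_rep m Q R \<Longrightarrow>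
      \<exists>xs. set xs \<subseteq> segs m \<and> isomorphic m Q R (direct_sum_list (map F_obj xs))"
    and Q: "dynkin_quiver_A (Suc m) Q" and rep: "is_rep (Suc m) Q R"
    and nz: "\<not> is_zero_rep (Suc m) R"
  shows "\<exists>c\<in>segs (Suc m). retract (Suc m) Q R c"
proof (cases "(Suc m, m) \<in> Q")
  case False
  then show ?thesis using retract_exists_forward[OF IH Q rep nz] by blast
next
  case True
  from Q this have "m \<in> {1..<Suc m}" by (cases rule: dynkin_arrow) auto
  then have "(Suc m, m) \<notin> Q\<inverse>" using dynkin_choice[OF Q, of m] True by auto
  moreover have "\<not> is_zero_rep (Suc m) (dual_rep R)" using nz by (simp add: is_zero_rep_def)
  ultimately obtain c where "c \<in> segs (Suc m)" "retract (Suc m) (Q\<inverse>) (dual_rep R) c"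
    using retract_exists_forward[OF IH dynkin_converse[OF Q] is_rep_dual[OF rep]] by blast
  then show ?thesis using retract_dual[OF quiver_dynkin[OF Q] rep] by blast
qed

lemma (in quiver) iso_zero:
  assumes "is_zero_rep N R" "is_zero_rep N S" "rep R" "rep S"
  shows "qiso R (S :: 'k::field rep)"
proof -
  have *: "qhom R S (\<lambda>v. 0\<^sub>m (vdim S v) (vdim R v))" if "is_zero_rep N R" "rep R" "rep S" for R S :: "'k rep"
    using that Q_vertices by (intro is_homI) (auto simp: is_zero_rep_def is_rep_dims intro!: mat_empty_eq)
  show ?thesis
    by (rule isoI[OF *[OF assms(1,3,4)] *[OF assms(2,4,3)]])
      (use assms in \<open>auto simp: is_zero_rep_def intro!: mat_empty_eq\<close>)
qed

lemma is_zero_rep_zero_rep: "is_zero_rep N zero_rep"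
  by (simp add: is_zero_rep_def zero_rep_def)

text \<open>Two nested inductions: the outer one, on the number of vertices, provides a retract of a
  nonzero \<open>R\<close>; the inner one, on the total dimension, decomposes the complement of that
  retract.\<close>

theorem interval_decomposition:
  fixes R :: "'k::field rep"
  assumes "dynkin_quiver_A m Q" "is_rep m Q R"
  shows "\<exists>xs. set xs \<subseteq> segs m \<and> isomorphic m Q R (direct_sum_list (map F_obj xs))"
  using assms
proof (induction m arbitrary: Q R)
  case 0
  interpret quiver 0 Q by (rule quiver_dynkin) fact
  have "qiso R zero_rep" using 0 by (intro iso_zero is_rep_zero_rep is_zero_rep_zero_rep) (auto simp: is_zero_rep_def)
  then show ?case by (intro exI[of _ "[]"]) simp
next
  case (Suc m)
  interpret quiver "Suc m" Q by (rule quiver_dynkin) fact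
  from \<open>is_rep (Suc m) Q R\<close> show ?case
  proof (induction "\<Sum>v\<in>{1..Suc m}. vdim R v" arbitrary: R rule: less_induct)
    case less
    show ?case
    proof (cases "is_zero_rep (Suc m) R")
      case True
      then have "qiso R zero_rep" using less by (intro iso_zero is_rep_zero_rep is_zero_rep_zero_rep)
      then show ?thesis by (intro exI[of _ "[]"]) simp
    next
      case False
      obtain c where c: "c \<in> segs (Suc m)" "retract (Suc m) Q R c"
        using retract_exists[OF Suc.IH Suc.prems(1) less.prems False] by blast
      obtain x f where xf: "qhom (F_obj c) R x" "qhom R (F_obj c) f"
        "\<And>v. v \<in> {1..Suc m} \<Longrightarrow> f v * x v = 1\<^sub>m (if ivl c v then 1 else 0)"
        using c(2) by (auto simp: retract_def)
      have "\<exists>C. rep C \<and> qiso R (direct_sum (F_obj c) C)"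
        by (rule split_retract[OF xf(1,2) is_rep_F_obj less.prems]) (use xf(3) in auto)
      then obtain C where C: "rep C" "qiso R (direct_sum (F_obj c) C)" by blast
      have eq: "vdim R v = (if ivl c v then 1 else 0) + vdim C v" if "v \<in> {1..Suc m}" for v
        using iso_vdim[OF C(2) less.prems is_rep_direct_sum[OF is_rep_F_obj C(1)] that] by simp
      have "(\<Sum>v\<in>{1..Suc m}. vdim C v) < (\<Sum>v\<in>{1..Suc m}. vdim R v)"
      proof (rule sum_strict_mono_ex1)
        show "\<exists>v\<in>{1..Suc m}. vdim C v < vdim R v"
          using c(1) eq[of "snd c"] by (intro bexI[of _ "snd c"]) (auto simp: segs_def ivl_def)
      qed (use eq in auto)
      from less.hyps[OF this C(1)] obtain xs where xs: "set xs \<subseteq> segs (Suc m)" "qiso C (ivl_sum xs)" by blast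
      have "qiso (direct_sum (F_obj c) C) (direct_sum (F_obj c) (ivl_sum xs))"
        by (intro direct_sum_cong iso_refl is_rep_F_obj C rep_ivl_sum xs)
      then have "qiso R (ivl_sum (c # xs))"
        using iso_trans[OF C(2) _ less.prems is_rep_direct_sum[OF is_rep_F_obj C(1)] rep_ivl_sum[of "c # xs"]]
        by simp
      then show ?thesis using xs(1) c(1) by (intro exI[of _ "c # xs"]) auto
    qed
  qed
qed

section \<open>Uniqueness of the decomposition\<close>

locale dynkin =
  fixes N :: nat and Q :: "(nat \<times> nat) set"
  assumes dynkin: "dynkin_quiver_A N Q"

sublocale dynkin \<subseteq> quiver N Q
  by (rule quiver_dynkin[OF dynkin])

context dynkin
begin

lemma arrow_between: "u \<in> {1..<N} \<Longrightarrow> (u, Suc u) \<in> Q \<or> (Suc u, u) \<in> Q"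
  using dynkin_choice[OF dynkin] by blast

lemma interval_hom_arrow_eq:
  assumes L: "qhom (F_obj d) (F_obj c) L" and st: "(s, t) \<in> Q"
    and "ivl c s" "ivl d s" "ivl c t" "ivl d t"
  shows "L t $$ (0, 0) = L s $$ (0, 0)"
  using arg_cong[OF is_hom_arrow[OF L st], of "\<lambda>A. A $$ (0, 0)"] is_hom_dims[OF L] Q_vertices[OF st] assms
  by (simp add: amap_F_obj)

lemma interval_hom_source_zero:
  assumes L: "qhom (F_obj d) (F_obj c) L" and st: "(s, t) \<in> Q"
    and "ivl c s" "ivl d s" "ivl c t" "\<not> ivl d t"
  shows "L s $$ (0, 0) = 0"
  using arg_cong[OF is_hom_arrow[OF L st], of "\<lambda>A. A $$ (0, 0)"] is_hom_dims[OF L] Q_vertices[OF st] assms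
  by (simp add: amap_F_obj)

lemma interval_hom_target_zero:
  assumes L: "qhom (F_obj d) (F_obj c) L" and st: "(s, t) \<in> Q"
    and "ivl c t" "ivl d t" "ivl d s" "\<not> ivl c s"
  shows "L t $$ (0, 0) = 0"
  using arg_cong[OF is_hom_arrow[OF L st], of "\<lambda>A. A $$ (0, 0)"] is_hom_dims[OF L] Q_vertices[OF st] assms
  by (simp add: amap_F_obj)

text \<open>The intersection of two intervals is connected, so single steps reach all of it.\<close>

lemma interval_const:
  assumes step: "\<And>v. ivl c v \<Longrightarrow> ivl d v \<Longrightarrow> ivl c (Suc v) \<Longrightarrow> ivl d (Suc v) \<Longrightarrow> p (Suc v) = p v"
    and u: "ivl c u" "ivl d u" and v: "ivl c v" "ivl d v"
  shows "p u = p v"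
proof -
  have "p v = p u" if "u \<le> v" "ivl c u" "ivl d u" "ivl c v" "ivl d v" for u v
    using that
  proof (induction rule: dec_induct)
    case (step w)
    then show ?case using assms(1)[of w] by (auto simp: ivl_def)
  qed simp
  then show ?thesis using u v by (metis nle_le)
qed

text \<open>The product of the two scalars is constant on the intersection. Since \<open>c\<close>
  and \<open>d\<close> differ, some edge leads from the intersection to a vertex of exactly one of
  them, and whichever way its arrow points, it forces one of the two morphisms to vanish at that
  end.\<close>

lemma interval_hom_composite_zero:
  assumes L: "qhom (F_obj d) (F_obj c) L" and M: "qhom (F_obj c) (F_obj d) M"
    and cd: "c \<noteq> d" "c \<in> segs N" "d \<in> segs N" and v: "ivl c v" "ivl d v"
  shows "L v $$ (0, 0) * M v $$ (0, 0) = 0"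
proof -
  define p where "p v = L v $$ (0, 0) * M v $$ (0, 0)" for v
  have vert: "v \<in> {1..N}" if "ivl c v" for v using that cd by (auto simp: segs_def ivl_def)
  have const: "p (Suc v) = p v" if "ivl c v" "ivl d v" "ivl c (Suc v)" "ivl d (Suc v)" for v
  proof -
    have "v \<in> {1..<N}" using vert[OF that(1)] vert[OF that(3)] by auto
    from arrow_between[OF this] show ?thesis
      using interval_hom_arrow_eq[OF L] interval_hom_arrow_eq[OF M] that unfolding p_def by metis
  qed
  have edge: "p u = 0" if u: "ivl c u" "ivl d u" and w: "ivl c w \<noteq> ivl d w"
    and uw: "(u, w) \<in> Q \<or> (w, u) \<in> Q" for u w
    using uw w u interval_hom_source_zero[OF L, of u w] interval_hom_source_zero[OF M, of u w]
      interval_hom_target_zero[OF L, of w u] interval_hom_target_zero[OF M, of w u]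
    unfolding p_def by fastforce
  have "\<exists>u w. ivl c u \<and> ivl d u \<and> ivl c w \<noteq> ivl d w \<and> ((u, w) \<in> Q \<or> (w, u) \<in> Q)"
  proof (cases "fst c = fst d")
    case False
    define w where "w = max (fst c) (fst d)"
    have "w \<in> {1..<N}" using False v cd by (auto simp: w_def ivl_def segs_def max_def)
    moreover have "ivl c (Suc w)" "ivl d (Suc w)" "ivl c w \<noteq> ivl d w"
      using False v by (auto simp: w_def ivl_def max_def)
    ultimately show ?thesis using arrow_between[of w] by blast
  next
    case True
    then have ne: "snd c \<noteq> snd d" using cd(1) by (cases c; cases d) auto
    define u where "u = min (snd c) (snd d)"
    have "u \<in> {1..<N}" using True ne v cd by (auto simp: u_def ivl_def segs_def min_def)
    moreover have "ivl c u" "ivl d u" "ivl c (Suc u) \<noteq> ivl d (Suc u)"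
      using True ne v by (auto simp: u_def ivl_def min_def)
    ultimately show ?thesis using arrow_between[of u] by blast
  qed
  then obtain u where u: "ivl c u" "ivl d u" "p u = 0" using edge by blast
  have "p u = p v" by (rule interval_const[where p = p and c = c and d = d]) (use const u v in auto)
  then show ?thesis using u by (simp add: p_def)
qed

text \<open>
  The scalars \<open>\<pi> a * \<iota>' b\<close> and \<open>\<pi>' b * \<iota> a\<close>, taken over the copies of \<open>c\<close> only, form matrices
  with product \<open>1\<close>, because morphisms \<open>c \<rightarrow> d \<rightarrow> c\<close> compose to zero for \<open>d \<noteq> c\<close>.
\<close>

lemma decomposition_count_le:
  assumes rep: "rep R" and d: "decomposition N Q R xs \<iota> \<pi>" and d': "decomposition N Q R ys \<iota>' \<pi>'"
    and xs: "set xs \<subseteq> segs N" and ys: "set ys \<subseteq> segs N" and c: "c \<in> segs N"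
  shows "count (mset xs) c \<le> count (mset ys) c"
proof -
  define A where "A = {a. a < length xs \<and> c = xs ! a}"
  define B where "B = {b. b < length ys \<and> c = ys ! b}"
  have card: "count (mset xs) c = card A" "count (mset ys) c = card B"
    by (simp_all add: count_mset count_list_eq_length_filter length_filter_conv_card A_def B_def)
  have fin: "finite A" "finite B" by (auto simp: A_def B_def)
  obtain g where g: "bij_betw g {0..<card A} A" using ex_bij_betw_nat_finite[OF fin(1)] by blast
  obtain h where h: "bij_betw h {0..<card B} B" using ex_bij_betw_nat_finite[OF fin(2)] by blast
  \<comment> \<open>All scalars are read off at one vertex of \<open>c\<close>; its right end always
    belongs to it.\<close>
  define v where "v = snd c"
  have cv: "ivl c v" and v: "v \<in> {1..N}" using c by (auto simp: v_def ivl_def segs_def)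
  have gA: "g i \<in> A" if "i < card A" for i using g that by (auto simp: bij_betw_def)
  have key: "(\<Sum>b\<in>B. (\<pi> a v * \<iota>' b v) $$ (0, 0) * (\<pi>' b v * \<iota> a' v) $$ (0, 0)) = (if a = a' then 1 else 0)"
    if aa: "a \<in> A" "a' \<in> A" for a a'
  proof -
    have a: "a < length xs" "xs ! a = c" "a' < length xs" "xs ! a' = c" using aa by (auto simp: A_def)
    note hom = decompositionD(2)[OF d a(1), unfolded a(2)] decompositionD(1)[OF d a(3), unfolded a(4)]
    have "(if a = a' then 1 else 0) = (\<pi> a v * \<iota> a' v) $$ (0, 0)"
      using decompositionD(3)[OF d a(1,3) v] a cv by simp
    also have "\<dots> = (\<Sum>b<length ys. if ivl (ys ! b) v
        then (\<pi> a v * \<iota>' b v) $$ (0, 0) * (\<pi>' b v * \<iota> a' v) $$ (0, 0) else 0)"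
      using is_hom_dims[OF hom(1) v] is_hom_dims[OF hom(2) v] cv
      by (intro decompositionD(4)[OF d' v]) auto
    also have "\<dots> = (\<Sum>b\<in>B. (\<pi> a v * \<iota>' b v) $$ (0, 0) * (\<pi>' b v * \<iota> a' v) $$ (0, 0))"
    proof (rule sum.mono_neutral_cong_right)
      show "\<forall>b\<in>{..<length ys} - B. (if ivl (ys ! b) v
        then (\<pi> a v * \<iota>' b v) $$ (0, 0) * (\<pi>' b v * \<iota> a' v) $$ (0, 0) else 0) = 0"
      proof
        fix b assume "b \<in> {..<length ys} - B"
        then have b: "b < length ys" "c \<noteq> ys ! b" by (auto simp: B_def)
        have bs: "ys ! b \<in> segs N" using ys nth_mem[OF b(1)] by blast
        have "qhom (F_obj (ys ! b)) (F_obj c) (\<lambda>v. \<pi> a v * \<iota>' b v)"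
          "qhom (F_obj c) (F_obj (ys ! b)) (\<lambda>v. \<pi>' b v * \<iota> a' v)"
          using hom_comp[OF decompositionD(1)[OF d' b(1)] hom(1) is_rep_F_obj rep is_rep_F_obj]
            hom_comp[OF hom(2) decompositionD(2)[OF d' b(1)] is_rep_F_obj rep is_rep_F_obj] by auto
        from interval_hom_composite_zero[OF this b(2) c bs cv]
        show "(if ivl (ys ! b) v
          then (\<pi> a v * \<iota>' b v) $$ (0, 0) * (\<pi>' b v * \<iota> a' v) $$ (0, 0) else 0) = 0" by simp
      qed
      show "(if ivl (ys ! b) v then (\<pi> a v * \<iota>' b v) $$ (0, 0) * (\<pi>' b v * \<iota> a' v) $$ (0, 0) else 0) =
         (\<pi> a v * \<iota>' b v) $$ (0, 0) * (\<pi>' b v * \<iota> a' v) $$ (0, 0)" if "b \<in> B" for b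
        using that cv by (simp add: B_def)
    qed (auto simp: B_def)
    finally show ?thesis by simp
  qed
  define G where "G = mat (card A) (card B) (\<lambda>(i, j). (\<pi> (g i) v * \<iota>' (h j) v) $$ (0, 0))"
  define H where "H = mat (card B) (card A) (\<lambda>(j, i). (\<pi>' (h j) v * \<iota> (g i) v) $$ (0, 0))"
  have "G * H = 1\<^sub>m (card A)"
  proof (rule eq_matI)
    fix i j assume ij: "i < dim_row (1\<^sub>m (card A) :: 'a mat)" "j < dim_col (1\<^sub>m (card A) :: 'a mat)"
    then have "(G * H) $$ (i, j) = (\<Sum>k\<in>{0..<card B}. (\<pi> (g i) v * \<iota>' (h k) v) $$ (0, 0) * (\<pi>' (h k) v * \<iota> (g j) v) $$ (0, 0))"
      by (subst index_mult_mat_sum) (auto simp: G_def H_def lessThan_atLeast0)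
    also have "\<dots> = (\<Sum>b\<in>B. (\<pi> (g i) v * \<iota>' b v) $$ (0, 0) * (\<pi>' b v * \<iota> (g j) v) $$ (0, 0))"
      by (rule sum.reindex_bij_betw[OF h])
    also have "\<dots> = (if g i = g j then 1 else 0)" using key gA ij by simp
    also have "g i = g j \<longleftrightarrow> i = j" using g ij by (auto simp: bij_betw_def inj_on_def)
    finally show "(G * H) $$ (i, j) = 1\<^sub>m (card A) $$ (i, j)" using ij by simp
  qed (auto simp: G_def H_def)
  then have "card A \<le> card B" by (intro right_inverse_dim_le[of G _ _ H]) (auto simp: G_def H_def)
  then show ?thesis using card by simp
qed

theorem interval_decomposition_unique:
  assumes rep: "rep R" and iso: "qiso R (ivl_sum xs)" "qiso R (ivl_sum ys)"
    and xs: "set xs \<subseteq> segs N" and ys: "set ys \<subseteq> segs N"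
  shows "mset xs = mset ys"
proof (rule multiset_eqI)
  fix c
  obtain \<iota> \<pi> where d: "decomposition N Q R xs \<iota> \<pi>" using decomposition_exists[OF rep iso(1)] by blast
  obtain \<iota>' \<pi>' where d': "decomposition N Q R ys \<iota>' \<pi>'" using decomposition_exists[OF rep iso(2)] by blast
  show "count (mset xs) c = count (mset ys) c"
  proof (cases "c \<in> segs N")
    case True
    then show ?thesis
      using decomposition_count_le[OF rep d d' xs ys] decomposition_count_le[OF rep d' d ys xs] by (simp add: le_antisym)
  next
    case False
    then show ?thesis using xs ys by (metis count_mset_0_iff subsetD)
  qed
qed

end


section \<open>Isomorphism classes as multisets of segments\<close>

lemma direct_sum_zero_rep_right [simp]: "direct_sum R zero_rep = R"
proof -
  have "block_diag X (0\<^sub>m 0 0) = X" for X :: "'a mat"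
    by (rule eq_matI) (auto simp: index_block_diag)
  then show ?thesis by (simp add: direct_sum_def zero_rep_def)
qed

text \<open>The condition that \<open>almost_rigid\<close> imposes on an ordered pair of summands,
  isolated in order to be decided for intervals.\<close>

definition rigid_pair :: "nat \<Rightarrow> (nat \<times> nat) set \<Rightarrow> 'k::field rep \<Rightarrow> 'k rep \<Rightarrow> bool" where
  "rigid_pair N Q A B \<longleftrightarrow> Ext1_is_zero N Q A B \<or>
     (Ext1_iso_field N Q A B \<and>
      (\<exists>E f g. (E, f, g) \<in> extensions N Q A B \<and> generates_Ext1 N Q A B (E, f, g) \<and> indecomposable N Q E))"

context dynkin
begin

lemma ivl_sum_append: "ivl_sum (xs @ ys) = direct_sum (ivl_sum xs) (ivl_sum ys)"
  by (simp add: direct_sum_list_append)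

lemma ivl_sum_mset_cong:
  "mset xs = mset ys \<Longrightarrow> qiso (ivl_sum xs) (ivl_sum ys :: 'k::field rep)"
proof (induction xs arbitrary: ys)
  case Nil
  then show ?case using iso_refl[OF is_rep_zero_rep] by simp
next
  case (Cons c xs)
  then have "c \<in> set ys" by (metis list.set_intros(1) mset_eq_setD)
  then obtain us vs where ys: "ys = us @ c # vs" by (meson split_list)
  then have "mset xs = mset (us @ vs)" using Cons.prems by simp
  from Cons.IH[OF this] have "qiso (ivl_sum xs) (ivl_sum (us @ vs) :: 'k rep)" .
  from direct_sum_cong[OF iso_refl[OF is_rep_F_obj] this is_rep_F_obj rep_ivl_sum is_rep_F_obj rep_ivl_sum, of c]
  have 1: "qiso (ivl_sum (c # xs)) (ivl_sum (c # us @ vs) :: 'k rep)" by simp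
  have "qiso (direct_sum (direct_sum (F_obj c) (ivl_sum us)) (ivl_sum vs))
     (direct_sum (direct_sum (ivl_sum us) (F_obj c)) (ivl_sum vs) :: 'k rep)"
    by (intro direct_sum_cong direct_sum_commute iso_refl is_rep_direct_sum is_rep_F_obj rep_ivl_sum)
  then have 2: "qiso (ivl_sum (c # us @ vs)) (ivl_sum ys :: 'k rep)"
    by (simp add: ys direct_sum_list_append direct_sum_assoc)
  show ?case by (rule iso_trans[OF 1 2 rep_ivl_sum rep_ivl_sum rep_ivl_sum])
qed

lemma decompositionE:
  assumes "rep R"
  obtains xs where "set xs \<subseteq> segs N" "qiso R (ivl_sum xs)"
  using interval_decomposition[OF dynkin assms] by blast

lemma ivl_sum_iso_iff:
  assumes "set xs \<subseteq> segs N" "set ys \<subseteq> segs N"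
  shows "qiso (ivl_sum xs) (ivl_sum ys :: 'k::field rep) \<longleftrightarrow> mset xs = mset ys"
  using interval_decomposition_unique[OF rep_ivl_sum iso_refl[OF rep_ivl_sum] _ assms, where 'a = 'k]
    ivl_sum_mset_cong by blast

lemma is_zero_ivl_sum_iff:
  assumes "set xs \<subseteq> segs N"
  shows "is_zero_rep N (ivl_sum xs :: 'k::field rep) \<longleftrightarrow> xs = []"
proof (cases xs)
  case (Cons c ys)
  then have "snd c \<in> {1..N}" "ivl c (snd c)" using assms by (auto simp: segs_def ivl_def)
  then show ?thesis using Cons by (auto simp: is_zero_rep_def intro!: bexI[of _ "snd c"])
qed (simp add: is_zero_rep_zero_rep)

lemma direct_sum_iso_ivl_sum:
  assumes "qiso A (ivl_sum xs)" "qiso B (ivl_sum ys)" "rep A" "rep B"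
  shows "qiso (direct_sum A B) (ivl_sum (xs @ ys))"
  unfolding ivl_sum_append using assms by (intro direct_sum_cong rep_ivl_sum)

lemma is_zero_rep_iso:
  assumes "qiso A B" "rep A" "rep B"
  shows "is_zero_rep N A \<longleftrightarrow> is_zero_rep N B"
  using iso_vdim[OF assms] by (auto simp: is_zero_rep_def)

lemma indecomposable_F_obj:
  assumes c: "c \<in> segs N"
  shows "indecomposable N Q (F_obj c :: 'k::field rep)"
  unfolding indecomposable_def
proof (intro conjI allI impI)
  show "\<not> is_zero_rep N (F_obj c :: 'k rep)" using is_zero_ivl_sum_iff[of "[c]", where 'k = 'k] c by simp
  fix A B :: "'k rep" assume rep: "rep A" "rep B" and iso: "qiso (F_obj c) (direct_sum A B)"
  obtain xs where xs: "set xs \<subseteq> segs N" "qiso A (ivl_sum xs)" using decompositionE[OF rep(1)] .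
  obtain ys where ys: "set ys \<subseteq> segs N" "qiso B (ivl_sum ys)" using decompositionE[OF rep(2)] .
  have "qiso (F_obj c) (ivl_sum (xs @ ys) :: 'k rep)"
    using iso direct_sum_iso_ivl_sum[OF xs(2) ys(2) rep]
    by (rule iso_trans) (intro is_rep_F_obj is_rep_direct_sum rep rep_ivl_sum)+
  then have "mset [c] = mset (xs @ ys)"
    using ivl_sum_iso_iff[of "[c]" "xs @ ys", where 'k = 'k] xs ys c by simp
  then have "length [c] = length (xs @ ys)" by (rule mset_eq_length)
  then have "xs = [] \<or> ys = []" by (cases xs; cases ys) auto
  then show "is_zero_rep N A \<or> is_zero_rep N B"
    using is_zero_rep_iso[OF xs(2) rep(1) rep_ivl_sum] is_zero_rep_iso[OF ys(2) rep(2) rep_ivl_sum]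
    by (auto simp: is_zero_rep_zero_rep)
qed (rule is_rep_F_obj)

lemma indecomposable_iso:
  assumes "qiso A B" "indecomposable N Q B" "rep A"
  shows "indecomposable N Q A"
  using assms iso_trans[OF iso_sym[OF assms(1)]] is_rep_direct_sum is_zero_rep_iso[OF assms(1)]
  unfolding indecomposable_def by (metis (no_types, lifting))

lemma indecomposable_iff:
  "indecomposable N Q A \<longleftrightarrow> rep A \<and> (\<exists>c\<in>segs N. qiso A (F_obj c))"
proof
  assume A: "indecomposable N Q A"
  then have rep: "rep A" by (simp add: indecomposable_def)
  obtain xs where xs: "set xs \<subseteq> segs N" "qiso A (ivl_sum xs)" using decompositionE[OF rep] .
  show "rep A \<and> (\<exists>c\<in>segs N. qiso A (F_obj c))"
  proof (cases xs)
    case Nil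
    then have "is_zero_rep N A" using is_zero_rep_iso[OF xs(2) rep rep_ivl_sum] by (simp add: is_zero_rep_zero_rep)
    then show ?thesis using A by (simp add: indecomposable_def)
  next
    case (Cons c ys)
    then have c: "c \<in> segs N" "set ys \<subseteq> segs N" using xs by auto
    have "qiso A (direct_sum (F_obj c) (ivl_sum ys))" using xs(2) Cons by simp
    then have "is_zero_rep N (F_obj c :: 'a rep) \<or> is_zero_rep N (ivl_sum ys :: 'a rep)"
      using A is_rep_F_obj rep_ivl_sum unfolding indecomposable_def by blast
    then have "ys = []" using indecomposable_F_obj[OF c(1)] is_zero_ivl_sum_iff[OF c(2)]
      unfolding indecomposable_def by blast
    then show ?thesis using rep xs(2) Cons c(1) by auto
  qed
next
  assume "rep A \<and> (\<exists>c\<in>segs N. qiso A (F_obj c))"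
  then show "indecomposable N Q A" using indecomposable_iso indecomposable_F_obj by blast
qed

text \<open>A complement has a decomposition of its own, and uniqueness compares the multisets;
  conversely, the intervals left over in the difference of the multisets build a complement.\<close>

lemma is_summand_iff:
  assumes rep: "rep A" "rep T" and A: "qiso A (ivl_sum zs)" and T: "qiso T (ivl_sum xs)"
    and zs: "set zs \<subseteq> segs N" and xs: "set xs \<subseteq> segs N"
  shows "is_summand N Q A T \<longleftrightarrow> mset zs \<subseteq># mset xs"
proof
  assume "is_summand N Q A T"
  then obtain C where C: "rep C" "qiso T (direct_sum A C)" by (auto simp: is_summand_def)
  obtain ws where ws: "set ws \<subseteq> segs N" "qiso C (ivl_sum ws)" using decompositionE[OF C(1)] .
  have TC: "qiso T (ivl_sum (zs @ ws))"
    using C(2) direct_sum_iso_ivl_sum[OF A ws(2) rep(1) C(1)]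
    by (rule iso_trans) (intro rep C is_rep_direct_sum rep_ivl_sum)+
  then have "mset xs = mset (zs @ ws)"
    using interval_decomposition_unique[OF rep(2) T TC xs] zs ws by simp
  then show "mset zs \<subseteq># mset xs" by simp
next
  assume le: "mset zs \<subseteq># mset xs"
  obtain ws where ws: "mset ws = mset xs - mset zs" using ex_mset by blast
  then have eq: "mset xs = mset (zs @ ws)" using le by simp
  have 1: "qiso T (ivl_sum (zs @ ws))"
    by (rule iso_trans[OF T ivl_sum_mset_cong[OF eq] rep(2) rep_ivl_sum rep_ivl_sum])
  have 2: "qiso (ivl_sum (zs @ ws)) (direct_sum A (ivl_sum ws))"
    unfolding ivl_sum_append
    by (intro direct_sum_cong iso_sym[OF A] iso_refl rep rep_ivl_sum)
  have "qiso T (direct_sum A (ivl_sum ws))"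
    by (rule iso_trans[OF 1 2 rep(2) rep_ivl_sum is_rep_direct_sum[OF rep(1) rep_ivl_sum]])
  then show "is_summand N Q A T" using rep rep_ivl_sum by (auto simp: is_summand_def)
qed

lemma basic_iff:
  assumes rep: "rep T" and T: "qiso T (ivl_sum xs)" and xs: "set xs \<subseteq> segs N"
  shows "basic N Q T \<longleftrightarrow> distinct xs"
proof -
  have "(\<exists>A. indecomposable N Q A \<and> is_summand N Q (direct_sum A A) T) \<longleftrightarrow>
     (\<exists>c\<in>segs N. {#c, c#} \<subseteq># mset xs)"
  proof
    assume "\<exists>A. indecomposable N Q A \<and> is_summand N Q (direct_sum A A) T"
    then obtain A c where A: "rep A" "c \<in> segs N" "qiso A (ivl_sum [c])" "is_summand N Q (direct_sum A A) T"
      by (auto simp: indecomposable_iff)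
    have "qiso (direct_sum A A) (ivl_sum ([c] @ [c]))" by (intro direct_sum_iso_ivl_sum A)
    from is_summand_iff[OF is_rep_direct_sum[OF A(1,1)] rep this T _ xs] A
    have "{#c, c#} \<subseteq># mset xs" by simp
    then show "\<exists>c\<in>segs N. {#c, c#} \<subseteq># mset xs" using A by blast
  next
    assume "\<exists>c\<in>segs N. {#c, c#} \<subseteq># mset xs"
    then obtain c where c: "c \<in> segs N" "{#c, c#} \<subseteq># mset xs" by blast
    have "is_summand N Q (ivl_sum [c, c]) T"
      using is_summand_iff[OF rep_ivl_sum rep iso_refl[OF rep_ivl_sum] T _ xs, of "[c, c]"] c by simp
    then show "\<exists>A. indecomposable N Q A \<and> is_summand N Q (direct_sum A A) T"
      using indecomposable_F_obj[OF c(1)] by auto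
  qed
  also have "\<dots> \<longleftrightarrow> (\<exists>c. count (mset xs) c \<ge> 2)"
  proof -
    have "{#c, c#} \<subseteq># mset xs \<longleftrightarrow> count (mset xs) c \<ge> 2" for c
      by (simp add: count_le_replicate_mset_subset_eq numeral_2_eq_2)
    moreover have "c \<in> segs N" if "count (mset xs) c \<ge> 2" for c
    proof -
      have "c \<in># mset xs" using that by (metis count_eq_zero_iff not_numeral_le_zero)
      then show ?thesis using xs by auto
    qed
    ultimately show ?thesis by blast
  qed
  also have "\<dots> \<longleftrightarrow> \<not> distinct xs"
  proof
    assume "\<exists>c. 2 \<le> count (mset xs) c"
    then show "\<not> distinct xs" by (metis count_mset_0_iff distinct_count_atmost_1 not_numeral_le_zero
      numeral_le_one_iff semiring_norm(69))
  next
    assume "\<not> distinct xs"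
    then obtain c us vs ws where "xs = us @ [c] @ vs @ [c] @ ws" using not_distinct_decomp by blast
    then have "count (mset xs) c \<ge> 2" by simp
    then show "\<exists>c. 2 \<le> count (mset xs) c" by blast
  qed
  finally show ?thesis unfolding basic_def by blast
qed

text \<open>The summands in \<open>almost_rigid\<close> are intervals only up to isomorphism. The
  hypothesis therefore speaks of all representations isomorphic to intervals, which leaves the
  invariance of \<open>rigid_pair\<close> to the place where it is computed.\<close>

lemma almost_rigid_iff:
  assumes rep: "rep T" and T: "qiso T (ivl_sum xs)" and xs: "set xs \<subseteq> segs N"
    and good: "\<And>A B c d. rep A \<Longrightarrow> rep B \<Longrightarrow> c \<in> segs N \<Longrightarrow> d \<in> segs N \<Longrightarrow>
      qiso A (F_obj c) \<Longrightarrow> qiso B (F_obj d) \<Longrightarrow> rigid_pair N Q A (B :: 'k rep) \<longleftrightarrow> good c d"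
  shows "almost_rigid N Q (T :: 'k::field rep) \<longleftrightarrow> distinct xs \<and> (\<forall>c\<in>set xs. \<forall>d\<in>set xs. good c d)"
proof -
  have summand: "is_summand N Q A T \<longleftrightarrow> c \<in> set xs"
    if "rep A" "c \<in> segs N" "qiso A (F_obj c)" for A c
    using is_summand_iff[OF that(1) rep _ T _ xs, of "[c]"] that by simp
  have "(\<forall>A B. indecomposable N Q A \<longrightarrow> is_summand N Q A T \<longrightarrow> indecomposable N Q B \<longrightarrow> is_summand N Q B T \<longrightarrow>
      rigid_pair N Q A B) \<longleftrightarrow> (\<forall>c\<in>set xs. \<forall>d\<in>set xs. good c d)" (is "?L \<longleftrightarrow> ?R")
  proof
    assume L: ?L
    show ?R
    proof (intro ballI)
      fix c d assume cd: "c \<in> set xs" "d \<in> set xs"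
      then have s: "c \<in> segs N" "d \<in> segs N" using xs by auto
      have "rigid_pair N Q (F_obj c :: 'k rep) (F_obj d)"
        using L indecomposable_F_obj[OF s(1)] indecomposable_F_obj[OF s(2)]
          summand[OF is_rep_F_obj s(1) iso_refl[OF is_rep_F_obj]] summand[OF is_rep_F_obj s(2) iso_refl[OF is_rep_F_obj]] cd
        by blast
      then show "good c d"
        using good[OF is_rep_F_obj is_rep_F_obj s iso_refl[OF is_rep_F_obj] iso_refl[OF is_rep_F_obj]] by blast
    qed
  next
    assume R: ?R
    show ?L
    proof (intro allI impI)
      fix A B assume "indecomposable N Q A" "is_summand N Q A T" "indecomposable N Q B" "is_summand N Q B T"
      then obtain c d where *: "rep A" "rep B" "c \<in> segs N" "d \<in> segs N" "qiso A (F_obj c)" "qiso B (F_obj d)"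
        "c \<in> set xs" "d \<in> set xs"
        by (metis indecomposable_iff summand)
      then show "rigid_pair N Q A B" using good[OF *(1-6)] R by blast
    qed
  qed
  then show ?thesis
    unfolding almost_rigid_def rigid_pair_def[symmetric] using rep basic_iff[OF rep T xs] by blast
qed

end


section \<open>Extensions and cocycles\<close>

lemma mult_mat_vec_assoc:
  fixes X :: "'a::semiring_0 mat"
  shows "dim_col X = dim_row Y \<Longrightarrow> dim_vec y = dim_col Y \<Longrightarrow> X *\<^sub>v (Y *\<^sub>v y) = (X * Y) *\<^sub>v y"
  by (rule assoc_mult_mat_vec[of _ "dim_row X" "dim_col X" _ "dim_col Y", symmetric])
    (auto intro: carrier_matI carrier_vecI)

lemma one_mult_vec: "dim_vec y = n \<Longrightarrow> 1\<^sub>m n *\<^sub>v y = (y :: 'a::semiring_1 vec)"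
  by (rule one_mult_mat_vec) (auto intro: carrier_vecI)

lemma zero_mult_vec: "dim_vec y = n \<Longrightarrow> 0\<^sub>m m n *\<^sub>v y = (0\<^sub>v m :: 'a::semiring_1 vec)"
  by (intro eq_vecI) auto

text \<open>\<open>extensions\<close> phrases exactness by injectivity, images and kernels. Here and
  in \<open>split_of_exact\<close> this is exchanged for matrix equations with a retraction
  \<open>r\<close> and a section \<open>s\<close>.\<close>

lemma exact_of_split:
  fixes f g r s :: "'a::field mat"
  assumes car: "f \<in> carrier_mat e b" "g \<in> carrier_mat a e" "r \<in> carrier_mat b e" "s \<in> carrier_mat e a"
    and eqs: "r * f = 1\<^sub>m b" "g * s = 1\<^sub>m a" "g * f = 0\<^sub>m a b" "f * r + s * g = 1\<^sub>m e"
  shows "inj_on ((*\<^sub>v) f) (carrier_vec b)"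
    and "(*\<^sub>v) f ` carrier_vec b = {x \<in> carrier_vec e. g *\<^sub>v x = 0\<^sub>v a}"
    and "(*\<^sub>v) g ` carrier_vec e = carrier_vec a"
proof -
  note dims = carrier_matD[OF car(1)] carrier_matD[OF car(2)] carrier_matD[OF car(3)] carrier_matD[OF car(4)]
  show "inj_on ((*\<^sub>v) f) (carrier_vec b)"
  proof (rule inj_on_inverseI[of _ "(*\<^sub>v) r"])
    fix y :: "'a vec" assume "y \<in> carrier_vec b"
    then show "r *\<^sub>v (f *\<^sub>v y) = y" using dims eqs by (simp add: mult_mat_vec_assoc one_mult_vec del: assoc_mult_mat_vec)
  qed
  show "(*\<^sub>v) f ` carrier_vec b = {x \<in> carrier_vec e. g *\<^sub>v x = 0\<^sub>v a}"
  proof (rule equalityI; rule subsetI)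
    fix x assume "x \<in> (*\<^sub>v) f ` carrier_vec b"
    then obtain y where y: "y \<in> carrier_vec b" "x = f *\<^sub>v y" unfolding image_iff by (elim bexE)
    have "g *\<^sub>v x = (g * f) *\<^sub>v y" unfolding y(2) using dims y(1) by (intro mult_mat_vec_assoc) auto
    also have "\<dots> = 0\<^sub>v a" unfolding eqs(3) using y(1) by (intro zero_mult_vec) auto
    finally show "x \<in> {x \<in> carrier_vec e. g *\<^sub>v x = 0\<^sub>v a}"
      using dims y by (auto intro: carrier_vecI)
  next
    fix x assume "x \<in> {x \<in> carrier_vec e. g *\<^sub>v x = 0\<^sub>v a}"
    then have x: "x \<in> carrier_vec e" "g *\<^sub>v x = 0\<^sub>v a" by auto
    have "x = (f * r + s * g) *\<^sub>v x" using x eqs by (simp add: one_mult_vec)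
    also have "\<dots> = (f * r) *\<^sub>v x + (s * g) *\<^sub>v x"
      using dims x by (intro add_mult_distrib_mat_vec[of _ e e]) auto
    also have "(s * g) *\<^sub>v x = s *\<^sub>v 0\<^sub>v a"
      using dims x by (simp add: mult_mat_vec_assoc[symmetric] del: assoc_mult_mat_vec)
    also have "(f * r) *\<^sub>v x + s *\<^sub>v 0\<^sub>v a = f *\<^sub>v (r *\<^sub>v x)"
    proof -
      have "s *\<^sub>v 0\<^sub>v a = 0\<^sub>v e" using dims by (intro eq_vecI) (auto simp: scalar_prod_def)
      moreover have "(f * r) *\<^sub>v x = f *\<^sub>v (r *\<^sub>v x)"
        using dims x by (intro mult_mat_vec_assoc[symmetric]) auto
      ultimately show ?thesis using dims by (intro eq_vecI) auto
    qed
    finally show "x \<in> (*\<^sub>v) f ` carrier_vec b"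
      using dims x by (intro image_eqI[of _ _ "r *\<^sub>v x"]) (auto intro: carrier_vecI)
  qed
  show "(*\<^sub>v) g ` carrier_vec e = carrier_vec a"
  proof (rule equalityI; rule subsetI)
    fix y :: "'a vec" assume y: "y \<in> carrier_vec a"
    then have "y = g *\<^sub>v (s *\<^sub>v y)" using dims eqs by (simp add: mult_mat_vec_assoc one_mult_vec del: assoc_mult_mat_vec)
    then show "y \<in> (*\<^sub>v) g ` carrier_vec e" using dims y by (intro image_eqI) (auto intro: carrier_vecI)
  qed (use dims in \<open>auto intro: carrier_vecI\<close>)
qed

lemma factor_through_image:
  fixes X :: "'a::field mat"
  assumes X: "X \<in> carrier_mat a e" and Y: "Y \<in> carrier_mat a k"
    and im: "\<And>j. j < k \<Longrightarrow> col Y j \<in> (*\<^sub>v) X ` carrier_vec e"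
  obtains S where "S \<in> carrier_mat e k" "X * S = Y"
proof -
  from im have "\<forall>j. \<exists>x. j < k \<longrightarrow> x \<in> carrier_vec e \<and> X *\<^sub>v x = col Y j" by fastforce
  then obtain x where x: "\<And>j. j < k \<Longrightarrow> x j \<in> carrier_vec e" "\<And>j. j < k \<Longrightarrow> X *\<^sub>v x j = col Y j" by metis
  define S where "S = mat e k (\<lambda>(i, j). x j $ i)"
  have "X * S = Y"
  proof (rule eq_matI)
    fix i j assume ij: "i < dim_row Y" "j < dim_col Y"
    then have jk: "j < k" using Y by auto
    have "col S j = x j" using x(1)[OF jk] jk by (intro eq_vecI) (auto simp: S_def)
    then have "(X * S) $$ (i, j) = (X *\<^sub>v x j) $ i" using ij X Y jk by (simp add: S_def)
    also have "\<dots> = Y $$ (i, j)" using x(2)[OF jk] ij by simp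
    finally show "(X * S) $$ (i, j) = Y $$ (i, j)" .
  qed (use X Y in \<open>auto simp: S_def\<close>)
  then show ?thesis using that[of S] by (simp add: S_def)
qed

lemma inj_mult_cancel:
  fixes X :: "'a::field mat"
  assumes X: "X \<in> carrier_mat e b" and inj: "inj_on ((*\<^sub>v) X) (carrier_vec b)"
    and Y: "Y \<in> carrier_mat b k" "Z \<in> carrier_mat b k" and eq: "X * Y = X * Z"
  shows "Y = Z"
proof (rule mat_eq_mult_vecI)
  fix y :: "'a vec" assume y: "y \<in> carrier_vec (dim_col Z)"
  have "X *\<^sub>v (Y *\<^sub>v y) = X *\<^sub>v (Z *\<^sub>v y)"
    using X Y y eq by (simp add: mult_mat_vec_assoc del: assoc_mult_mat_vec)
  from inj_onD[OF inj this] show "Y *\<^sub>v y = Z *\<^sub>v y" using Y y by (auto intro: carrier_vecI)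
qed (use Y in auto)

text \<open>Surjectivity of \<open>g\<close> gives \<open>s\<close> column by column. The matrix
  \<open>1 - s * g\<close> then maps into the kernel of \<open>g\<close>, which is the image of
  \<open>f\<close>, and so equals \<open>f * r\<close> for some \<open>r\<close>; the equations for
  \<open>r * f\<close> and \<open>r * s\<close> follow by cancelling the injective
  \<open>f\<close>.\<close>

lemma split_of_exact:
  fixes f g :: "'a::field mat"
  assumes car: "f \<in> carrier_mat e b" "g \<in> carrier_mat a e"
    and inj: "inj_on ((*\<^sub>v) f) (carrier_vec b)"
    and ker: "(*\<^sub>v) f ` carrier_vec b = {x \<in> carrier_vec e. g *\<^sub>v x = 0\<^sub>v a}"
    and surj: "(*\<^sub>v) g ` carrier_vec e = carrier_vec a"
  shows "\<exists>r s. r \<in> carrier_mat b e \<and> s \<in> carrier_mat e a \<and> r * f = 1\<^sub>m b \<and> g * s = 1\<^sub>m a \<and>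
    g * f = 0\<^sub>m a b \<and> r * s = 0\<^sub>m b a \<and> f * r + s * g = 1\<^sub>m e"
proof -
  note dims = carrier_matD[OF car(1)] carrier_matD[OF car(2)]
  have gf: "g * f = 0\<^sub>m a b"
  proof (rule mat_eq_mult_vecI)
    fix y :: "'a vec" assume "y \<in> carrier_vec (dim_col (0\<^sub>m a b :: 'a mat))"
    then have "y \<in> carrier_vec b" by simp
    moreover from this have "g *\<^sub>v (f *\<^sub>v y) = 0\<^sub>v a" using ker by blast
    ultimately show "(g * f) *\<^sub>v y = 0\<^sub>m a b *\<^sub>v y"
      using dims by (simp add: mult_mat_vec_assoc zero_mult_vec del: assoc_mult_mat_vec)
  qed (use dims in auto)
  obtain s where s: "s \<in> carrier_mat e a" "g * s = 1\<^sub>m a"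
    by (rule factor_through_image[OF car(2), of "1\<^sub>m a" a]) (auto simp: surj)
  define D where "D = 1\<^sub>m e + (-1) \<cdot>\<^sub>m (s * g)"
  have D: "D \<in> carrier_mat e e" using s dims by (auto simp: D_def)
  have gD: "g * D = 0\<^sub>m a e"
  proof -
    have "g * D = g + (-1) \<cdot>\<^sub>m ((g * s) * g)"
      using s(1) dims by (simp add: D_def mult_add_mat mult_smult_mat mult_mat_assoc)
    then show ?thesis using s dims by (auto intro!: eq_matI)
  qed
  obtain r where r: "r \<in> carrier_mat b e" "f * r = D"
  proof (rule factor_through_image[OF car(1) D])
    fix j assume j: "j < e"
    have "g *\<^sub>v col D j = col (g * D) j" using D dims j by (intro eq_vecI) auto
    also have "\<dots> = 0\<^sub>v a" using gD j by (auto intro!: eq_vecI)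
    finally show "col D j \<in> (*\<^sub>v) f ` carrier_vec b" using D ker by (auto intro: carrier_vecI)
  qed
  have fr: "f * r + s * g = 1\<^sub>m e"
    unfolding r(2) D_def using s dims by (intro eq_matI) auto
  have "f * (r * f) = D * f" using r dims by (simp flip: mult_mat_assoc)
  also have "\<dots> = f + (-1) \<cdot>\<^sub>m (s * (g * f))"
    using s dims by (simp add: D_def add_mult_mat smult_mult_mat mult_mat_assoc)
  also have "\<dots> = f * 1\<^sub>m b" using gf s dims by (auto intro!: eq_matI)
  finally have "f * (r * f) = f * 1\<^sub>m b" .
  from inj_mult_cancel[OF car(1) inj mult_carrier_mat[OF r(1) car(1)] one_carrier_mat this]
  have rf: "r * f = 1\<^sub>m b" .
  have "f * (r * s) = D * s" using r s dims by (simp flip: mult_mat_assoc)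
  also have "\<dots> = s + (-1) \<cdot>\<^sub>m (s * (g * s))"
    using s(1) dims by (simp add: D_def add_mult_mat smult_mult_mat mult_mat_assoc)
  also have "\<dots> = f * 0\<^sub>m b a" using s dims by (auto intro!: eq_matI)
  finally have "f * (r * s) = f * 0\<^sub>m b a" .
  from inj_mult_cancel[OF car(1) inj mult_carrier_mat[OF r(1) s(1)] zero_carrier_mat this]
  have rs: "r * s = 0\<^sub>m b a" .
  show ?thesis using r(1) s gf fr rf rs by blast
qed

text \<open>
  An extension of \<open>A\<close> by \<open>B\<close> is, up to equivalence, given by the upper right blocks
  \<open>\<eta> (s, t) : A s \<rightarrow> B t\<close> of its maps with respect to vertexwise splittings.
\<close>

type_synonym 'k cochain = "nat \<times> nat \<Rightarrow> 'k mat"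

definition ext_rep :: "'k::field rep \<Rightarrow> 'k rep \<Rightarrow> 'k cochain \<Rightarrow> 'k rep" where
  "ext_rep A B \<eta> = \<lparr>vdim = (\<lambda>v. vdim B v + vdim A v),
     amap = (\<lambda>(s, t).
       inl_mat (vdim B t) (vdim A t) * (amap B (s, t) * prl_mat (vdim B s) (vdim A s)) +
       (inl_mat (vdim B t) (vdim A t) * (\<eta> (s, t) * prr_mat (vdim B s) (vdim A s)) +
       inr_mat (vdim B t) (vdim A t) * (amap A (s, t) * prr_mat (vdim B s) (vdim A s))))\<rparr>"

definition std_ses :: "'k::field rep \<Rightarrow> 'k rep \<Rightarrow> 'k cochain \<Rightarrow> 'k ses" where
  "std_ses A B \<eta> = (ext_rep A B \<eta>, (\<lambda>v. inl_mat (vdim B v) (vdim A v)), (\<lambda>v. prr_mat (vdim B v) (vdim A v)))"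

lemma vdim_ext_rep [simp]: "vdim (ext_rep A B \<eta>) v = vdim B v + vdim A v"
  by (simp add: ext_rep_def)

context quiver
begin

definition cochain :: "'k rep \<Rightarrow> 'k rep \<Rightarrow> 'k cochain \<Rightarrow> bool" where
  "cochain A B \<eta> \<longleftrightarrow> (\<forall>(s, t)\<in>Q. \<eta> (s, t) \<in> carrier_mat (vdim B t) (vdim A s))"

lemma cochain_dims:
  assumes "cochain A B \<eta>" "(s, t) \<in> Q"
  shows "dim_row (\<eta> (s, t)) = vdim B t" "dim_col (\<eta> (s, t)) = vdim A s"
  using assms by (auto simp: cochain_def)

text \<open>The equation says that the unipotent block matrices with corner \<open>u\<close>
  intertwine the block triangular maps given by \<open>\<eta>\<close> and \<open>\<theta>\<close>;
  equivalently, \<open>\<eta>\<close> and \<open>\<theta>\<close> differ by the coboundary of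
  \<open>u\<close>.\<close>

definition cohomologous :: "'k::field rep \<Rightarrow> 'k rep \<Rightarrow> 'k cochain \<Rightarrow> 'k cochain \<Rightarrow> bool" where
  "cohomologous A B \<eta> \<theta> \<longleftrightarrow> (\<exists>u. (\<forall>v\<in>{1..N}. u v \<in> carrier_mat (vdim B v) (vdim A v)) \<and>
     (\<forall>(s, t)\<in>Q. \<eta> (s, t) + u t * amap A (s, t) = amap B (s, t) * u s + \<theta> (s, t)))"

lemma ext_rep_simps:
  assumes rep: "rep A" "rep B" and \<eta>: "cochain A B \<eta>" and st: "(s, t) \<in> Q"
  defines "E \<equiv> amap (ext_rep A B \<eta>) (s, t)"
  shows "dim_row E = vdim B t + vdim A t" "dim_col E = vdim B s + vdim A s"
    and "prl_mat (vdim B t) (vdim A t) * E =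
      amap B (s, t) * prl_mat (vdim B s) (vdim A s) + \<eta> (s, t) * prr_mat (vdim B s) (vdim A s)"
    and "prr_mat (vdim B t) (vdim A t) * E = amap A (s, t) * prr_mat (vdim B s) (vdim A s)"
    and "E * inl_mat (vdim B s) (vdim A s) = inl_mat (vdim B t) (vdim A t) * amap B (s, t)"
    and "E * inr_mat (vdim B s) (vdim A s) =
      inl_mat (vdim B t) (vdim A t) * \<eta> (s, t) + inr_mat (vdim B t) (vdim A t) * amap A (s, t)"
  using is_rep_dims[OF rep(1) st] is_rep_dims[OF rep(2) st] cochain_dims[OF \<eta> st]
  by (simp_all add: E_def ext_rep_def mult_add_mat add_mult_mat mult_mat_assoc)

lemma rep_ext_rep: "rep A \<Longrightarrow> rep B \<Longrightarrow> cochain A B \<eta> \<Longrightarrow> rep (ext_rep A B \<eta>)"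
  by (intro is_repI) (auto simp: ext_rep_simps)

lemma std_ses_in_extensions:
  assumes rep: "rep A" "rep B" and \<eta>: "cochain A B \<eta>"
  shows "std_ses A B \<eta> \<in> extensions N Q A B"
proof -
  have "qhom B (ext_rep A B \<eta>) (\<lambda>v. inl_mat (vdim B v) (vdim A v))"
    by (rule is_homI) (auto simp: ext_rep_simps[OF rep \<eta>])
  moreover have "qhom (ext_rep A B \<eta>) A (\<lambda>v. prr_mat (vdim B v) (vdim A v))"
    by (rule is_homI) (auto simp: ext_rep_simps[OF rep \<eta>])
  moreover note rep_ext_rep[OF rep \<eta>]
  moreover have "inj_on ((*\<^sub>v) (inl_mat (vdim B v) (vdim A v) :: 'a mat)) (carrier_vec (vdim B v)) \<and>
      (*\<^sub>v) (inl_mat (vdim B v) (vdim A v) :: 'a mat) ` carrier_vec (vdim B v) =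
        {x \<in> carrier_vec (vdim B v + vdim A v). prr_mat (vdim B v) (vdim A v) *\<^sub>v x = 0\<^sub>v (vdim A v)} \<and>
      (*\<^sub>v) (prr_mat (vdim B v) (vdim A v) :: 'a mat) ` carrier_vec (vdim B v + vdim A v) = carrier_vec (vdim A v)" for v
    using exact_of_split[where r = "prl_mat (vdim B v) (vdim A v) :: 'a mat" and s = "inr_mat (vdim B v) (vdim A v)" and
      f = "inl_mat (vdim B v) (vdim A v)" and g = "prr_mat (vdim B v) (vdim A v)" and
      b = "vdim B v" and a = "vdim A v" and e = "vdim B v + vdim A v"]
    by (simp add: biproduct_sum)
  ultimately show ?thesis by (simp add: extensions_def std_ses_def)
qed

lemma extensionsD:
  assumes "(E, f, g) \<in> extensions N Q A B"
  shows "rep E" "qhom B E f" "qhom E A g"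
  using assms by (auto simp: extensions_def)

lemma extensions_split:
  assumes "(E, f, g) \<in> extensions N Q A B"
  obtains r s where "\<And>v. v \<in> {1..N} \<Longrightarrow> r v \<in> carrier_mat (vdim B v) (vdim E v)"
    "\<And>v. v \<in> {1..N} \<Longrightarrow> s v \<in> carrier_mat (vdim E v) (vdim A v)"
    "\<And>v. v \<in> {1..N} \<Longrightarrow> r v * f v = 1\<^sub>m (vdim B v)"
    "\<And>v. v \<in> {1..N} \<Longrightarrow> g v * s v = 1\<^sub>m (vdim A v)"
    "\<And>v. v \<in> {1..N} \<Longrightarrow> g v * f v = 0\<^sub>m (vdim A v) (vdim B v)"
    "\<And>v. v \<in> {1..N} \<Longrightarrow> r v * s v = 0\<^sub>m (vdim B v) (vdim A v)"
    "\<And>v. v \<in> {1..N} \<Longrightarrow> f v * r v + s v * g v = 1\<^sub>m (vdim E v)"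
proof -
  define P where "P v r s \<longleftrightarrow> r \<in> carrier_mat (vdim B v) (vdim E v) \<and> s \<in> carrier_mat (vdim E v) (vdim A v) \<and>
     r * f v = 1\<^sub>m (vdim B v) \<and> g v * s = 1\<^sub>m (vdim A v) \<and> g v * f v = 0\<^sub>m (vdim A v) (vdim B v) \<and>
     r * s = 0\<^sub>m (vdim B v) (vdim A v) \<and> f v * r + s * g v = 1\<^sub>m (vdim E v)" for v r s
  have "\<forall>v\<in>{1..N}. \<exists>r s. P v r s"
  proof
    fix v assume v: "v \<in> {1..N}"
    have "f v \<in> carrier_mat (vdim E v) (vdim B v)" "g v \<in> carrier_mat (vdim A v) (vdim E v)"
      using extensionsD(2,3)[OF assms] v by (auto simp: is_hom_def)
    from split_of_exact[OF this] show "\<exists>r s. P v r s"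
      unfolding P_def using assms v by (auto simp: extensions_def)
  qed
  then obtain r s where "\<And>v. v \<in> {1..N} \<Longrightarrow> P v (r v) (s v)" by metis
  then show ?thesis unfolding P_def using that[of r s] by blast
qed

text \<open>In the vertexwise coordinates \<open>(r, g)\<close> on \<open>E\<close> the arrow maps
  become block triangular, because \<open>f\<close> and \<open>g\<close> are morphisms; the corner
  at an arrow is \<open>r * amap E * s\<close>.\<close>

lemma extension_equiv_std:
  assumes rep: "rep A" "rep B" and x: "x \<in> extensions N Q A B"
  obtains \<eta> where "cochain A B \<eta>" "ext_equiv N Q x (std_ses A B \<eta>)"
proof -
  obtain E f g where xE: "x = (E, f, g)" by (cases x)
  note hom = extensionsD[OF x[unfolded xE]]
  obtain r s where rs: "\<And>v. v \<in> {1..N} \<Longrightarrow> r v \<in> carrier_mat (vdim B v) (vdim E v)"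
    "\<And>v. v \<in> {1..N} \<Longrightarrow> s v \<in> carrier_mat (vdim E v) (vdim A v)"
    "\<And>v. v \<in> {1..N} \<Longrightarrow> r v * f v = 1\<^sub>m (vdim B v)"
    "\<And>v. v \<in> {1..N} \<Longrightarrow> g v * s v = 1\<^sub>m (vdim A v)"
    "\<And>v. v \<in> {1..N} \<Longrightarrow> g v * f v = 0\<^sub>m (vdim A v) (vdim B v)"
    "\<And>v. v \<in> {1..N} \<Longrightarrow> r v * s v = 0\<^sub>m (vdim B v) (vdim A v)"
    "\<And>v. v \<in> {1..N} \<Longrightarrow> f v * r v + s v * g v = 1\<^sub>m (vdim E v)"
    using extensions_split[OF x[unfolded xE]] by blast
  note dims = is_hom_dims[OF hom(2)] is_hom_dims[OF hom(3)] carrier_matD[OF rs(1)] carrier_matD[OF rs(2)]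
  define \<eta> where "\<eta> = (\<lambda>(i, j). r j * amap E (i, j) * s i)"
  have \<eta>: "cochain A B \<eta>"
    unfolding cochain_def
  proof clarify
    fix i j assume "(i, j) \<in> Q"
    then have v: "i \<in> {1..N}" "j \<in> {1..N}" using Q_vertices by auto
    show "\<eta> (i, j) \<in> carrier_mat (vdim B j) (vdim A i)"
      using carrier_matD[OF rs(1)[OF v(2)]] carrier_matD[OF rs(2)[OF v(1)]] by (intro carrier_matI) (simp_all add: \<eta>_def)
  qed
  define h where "h v = inl_mat (vdim B v) (vdim A v) * r v + inr_mat (vdim B v) (vdim A v) * g v" for v
  have "qhom E (ext_rep A B \<eta>) h"
  proof (rule is_homI)
    fix i j assume ij: "(i, j) \<in> Q"
    then have v: "i \<in> {1..N}" "j \<in> {1..N}" using Q_vertices by auto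
    note d = dims[OF v(1)] dims[OF v(2)] is_rep_dims[OF hom(1) ij] is_rep_dims[OF rep(1) ij] is_rep_dims[OF rep(2) ij]
      cochain_dims[OF \<eta> ij] ext_rep_simps(1,2)[OF rep \<eta> ij]
    show "h j * amap E (i, j) = amap (ext_rep A B \<eta>) (i, j) * h i"
    proof (rule biproduct_row_ext[of _ "vdim B j" "vdim A j"])
      have "r j * amap E (i, j) = r j * (amap E (i, j) * (f i * r i + s i * g i))"
        using d rs(7)[OF v(1)] by simp
      also have "\<dots> = r j * ((amap E (i, j) * f i) * r i) + \<eta> (i, j) * g i"
        using d by (simp add: mult_add_mat mult_mat_assoc \<eta>_def)
      also have "r j * ((amap E (i, j) * f i) * r i) = (r j * f j) * (amap B (i, j) * r i)"
        using d by (simp add: mult_mat_assoc flip: is_hom_arrow[OF hom(2) ij])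
      finally have 1: "r j * amap E (i, j) = amap B (i, j) * r i + \<eta> (i, j) * g i"
        using d rs(3)[OF v(2)] by simp
      have "prl_mat (vdim B j) (vdim A j) * (amap (ext_rep A B \<eta>) (i, j) * h i) =
        (prl_mat (vdim B j) (vdim A j) * amap (ext_rep A B \<eta>) (i, j)) * h i"
        using d by (simp add: mult_mat_assoc h_def)
      also have "\<dots> = amap B (i, j) * r i + \<eta> (i, j) * g i"
        unfolding ext_rep_simps(3)[OF rep \<eta> ij] h_def using d by (simp add: mult_add_mat add_mult_mat mult_mat_assoc)
      finally show "prl_mat (vdim B j) (vdim A j) * (h j * amap E (i, j)) =
        prl_mat (vdim B j) (vdim A j) * (amap (ext_rep A B \<eta>) (i, j) * h i)"
        using d 1 by (simp add: h_def mult_add_mat add_mult_mat mult_mat_assoc)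
      have "prr_mat (vdim B j) (vdim A j) * (amap (ext_rep A B \<eta>) (i, j) * h i) =
        (prr_mat (vdim B j) (vdim A j) * amap (ext_rep A B \<eta>) (i, j)) * h i"
        using d by (simp add: mult_mat_assoc h_def)
      also have "\<dots> = amap A (i, j) * g i"
        unfolding ext_rep_simps(4)[OF rep \<eta> ij] h_def using d by (simp add: mult_add_mat add_mult_mat mult_mat_assoc)
      finally show "prr_mat (vdim B j) (vdim A j) * (h j * amap E (i, j)) =
        prr_mat (vdim B j) (vdim A j) * (amap (ext_rep A B \<eta>) (i, j) * h i)"
        using d by (simp add: h_def mult_add_mat add_mult_mat mult_mat_assoc is_hom_arrow[OF hom(3) ij])
    qed (use d in \<open>auto simp: h_def\<close>)
  qed (use dims in \<open>auto simp: h_def\<close>)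
  then have "is_iso N Q E (ext_rep A B \<eta>) h"
  proof (rule isomorphicI)
    fix v assume v: "v \<in> {1..N}"
    note d = dims[OF v]
    let ?g = "\<lambda>v. f v * prl_mat (vdim B v) (vdim A v) + s v * prr_mat (vdim B v) (vdim A v)"
    show "?g v \<in> carrier_mat (vdim E v) (vdim (ext_rep A B \<eta>) v)" using d by auto
    show "?g v * h v = 1\<^sub>m (vdim E v)"
      unfolding h_def using d rs(7)[OF v] by (simp add: mult_add_mat add_mult_mat mult_mat_assoc)
    have "r v * (f v * X) = X" if "dim_row X = vdim B v" for X
      using d rs(3)[OF v] that by (simp flip: mult_mat_assoc)
    moreover have "g v * (s v * X) = X" if "dim_row X = vdim A v" for X
      using d rs(4)[OF v] that by (simp flip: mult_mat_assoc)
    moreover have "r v * (s v * X) = 0\<^sub>m (vdim B v) (dim_col X)" if "dim_row X = vdim A v" for X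
      using d rs(6)[OF v] that by (simp flip: mult_mat_assoc)
    moreover have "g v * (f v * X) = 0\<^sub>m (vdim A v) (dim_col X)" if "dim_row X = vdim B v" for X
      using d rs(5)[OF v] that by (simp flip: mult_mat_assoc)
    ultimately show "h v * ?g v = 1\<^sub>m (vdim (ext_rep A B \<eta>) v)"
      unfolding h_def using d
      by (simp add: mult_add_mat add_mult_mat mult_mat_assoc biproduct_sum)
  qed
  moreover have "h v * f v = inl_mat (vdim B v) (vdim A v) \<and> prr_mat (vdim B v) (vdim A v) * h v = g v"
    if v: "v \<in> {1..N}" for v
    using dims[OF v] rs(3,5)[OF v] by (simp add: h_def mult_add_mat add_mult_mat mult_mat_assoc)
  ultimately have "ext_equiv N Q x (std_ses A B \<eta>)"
    unfolding xE std_ses_def ext_equiv_def by auto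
  then show ?thesis using that \<eta> by blast
qed

lemma ext_equiv_refl:
  assumes "x \<in> extensions N Q A B"
  shows "ext_equiv N Q x x"
proof -
  obtain E f g where x: "x = (E, f, g)" by (cases x)
  note hom = extensionsD[OF assms[unfolded x]]
  have "is_iso N Q E E (\<lambda>v. 1\<^sub>m (vdim E v))"
    by (rule isomorphicI[OF hom_id[OF hom(1)], where g = "\<lambda>v. 1\<^sub>m (vdim E v)"]) auto
  then show ?thesis unfolding x ext_equiv_def
    using is_hom_dims[OF hom(2)] is_hom_dims[OF hom(3)] by (auto intro!: exI[of _ "\<lambda>v. 1\<^sub>m (vdim E v)"])
qed

lemma ext_equiv_sym:
  assumes x: "x \<in> extensions N Q A B" and y: "y \<in> extensions N Q A B" and xy: "ext_equiv N Q x y"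
  shows "ext_equiv N Q y x"
proof -
  obtain E f g where xE: "x = (E, f, g)" by (cases x)
  obtain E' f' g' where yE: "y = (E', f', g')" by (cases y)
  note homx = extensionsD[OF x[unfolded xE]] and homy = extensionsD[OF y[unfolded yE]]
  from xy obtain h where h: "is_iso N Q E E' h" "\<And>v. v \<in> {1..N} \<Longrightarrow> h v * f v = f' v"
    "\<And>v. v \<in> {1..N} \<Longrightarrow> g' v * h v = g v" unfolding xE yE ext_equiv_def by auto
  obtain k where k: "qhom E' E k" "\<And>v. v \<in> {1..N} \<Longrightarrow> k v * h v = 1\<^sub>m (vdim E v)"
    "\<And>v. v \<in> {1..N} \<Longrightarrow> h v * k v = 1\<^sub>m (vdim E' v)"
    using is_isoE[OF h(1) homx(1) homy(1)] by metis
  have hh: "qhom E E' h" using h(1) by (simp add: is_iso_def)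
  have "is_iso N Q E' E k"
    using is_hom_dims[OF hh] k by (intro isomorphicI[OF k(1), where g = h]) (auto intro: carrier_matI)
  moreover have "k v * f' v = f v \<and> g v * k v = g' v" if v: "v \<in> {1..N}" for v
  proof -
    note d = is_hom_dims[OF hh v] is_hom_dims[OF k(1) v] is_hom_dims[OF homx(2) v] is_hom_dims[OF homx(3) v]
      is_hom_dims[OF homy(2) v] is_hom_dims[OF homy(3) v]
    have "k v * f' v = (k v * h v) * f v" using d h(2)[OF v] by (simp add: mult_mat_assoc)
    moreover have "g v * k v = g' v * (h v * k v)" using d h(3)[OF v] by (simp flip: mult_mat_assoc)
    ultimately show ?thesis using d k(2,3)[OF v] by simp
  qed
  ultimately show ?thesis unfolding xE yE ext_equiv_def by auto
qed

lemma ses_map_trans: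
  assumes x: "x \<in> extensions N Q A B" and y: "y \<in> extensions N Q A' B'" and z: "z \<in> extensions N Q A'' B''"
    and xy: "ses_map N Q b a x y" and yz: "ses_map N Q b' a' y z"
    and b: "\<And>v. v \<in> {1..N} \<Longrightarrow> b v \<in> carrier_mat (vdim B' v) (vdim B v)"
      "\<And>v. v \<in> {1..N} \<Longrightarrow> b' v \<in> carrier_mat (vdim B'' v) (vdim B' v)"
    and a: "\<And>v. v \<in> {1..N} \<Longrightarrow> a v \<in> carrier_mat (vdim A' v) (vdim A v)"
      "\<And>v. v \<in> {1..N} \<Longrightarrow> a' v \<in> carrier_mat (vdim A'' v) (vdim A' v)"
  shows "ses_map N Q (\<lambda>v. b' v * b v) (\<lambda>v. a' v * a v) x z"
proof -
  obtain E f g where xE: "x = (E, f, g)" by (cases x)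
  obtain E' f' g' where yE: "y = (E', f', g')" by (cases y)
  obtain E'' f'' g'' where zE: "z = (E'', f'', g'')" by (cases z)
  note homx = extensionsD[OF x[unfolded xE]] and homy = extensionsD[OF y[unfolded yE]] and homz = extensionsD[OF z[unfolded zE]]
  from xy obtain h where h: "qhom E E' h" "\<And>v. v \<in> {1..N} \<Longrightarrow> h v * f v = f' v * b v"
    "\<And>v. v \<in> {1..N} \<Longrightarrow> g' v * h v = a v * g v" unfolding xE yE ses_map_def by auto
  from yz obtain k where k: "qhom E' E'' k" "\<And>v. v \<in> {1..N} \<Longrightarrow> k v * f' v = f'' v * b' v"
    "\<And>v. v \<in> {1..N} \<Longrightarrow> g'' v * k v = a' v * g' v" unfolding yE zE ses_map_def by auto
  have "k v * h v * f v = f'' v * (b' v * b v) \<and> g'' v * (k v * h v) = a' v * a v * g v" if v: "v \<in> {1..N}" for v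
  proof -
    note d = is_hom_dims[OF h(1) v] is_hom_dims[OF k(1) v] is_hom_dims[OF homx(2) v] is_hom_dims[OF homx(3) v]
      is_hom_dims[OF homy(2) v] is_hom_dims[OF homy(3) v] is_hom_dims[OF homz(2) v] is_hom_dims[OF homz(3) v]
      carrier_matD[OF a(1)[OF v]] carrier_matD[OF a(2)[OF v]] carrier_matD[OF b(1)[OF v]] carrier_matD[OF b(2)[OF v]]
    have "k v * h v * f v = k v * f' v * b v" using d h(2)[OF v] by (simp add: mult_mat_assoc)
    also have "\<dots> = f'' v * (b' v * b v)" unfolding k(2)[OF v] using d by (simp add: mult_mat_assoc)
    finally have 1: "k v * h v * f v = f'' v * (b' v * b v)" .
    have "g'' v * (k v * h v) = (g'' v * k v) * h v" using d by (simp add: mult_mat_assoc)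
    also have "\<dots> = a' v * (g' v * h v)" unfolding k(3)[OF v] using d by (simp add: mult_mat_assoc)
    also have "\<dots> = a' v * a v * g v" unfolding h(3)[OF v] using d by (simp add: mult_mat_assoc)
    finally show ?thesis using 1 by simp
  qed
  with hom_comp[OF h(1) k(1) homx(1) homy(1) homz(1)] show ?thesis
    unfolding xE zE ses_map_def by auto
qed

lemma ext_equiv_ses_map:
  assumes x: "x \<in> extensions N Q A B" and y: "y \<in> extensions N Q A B" and xy: "ext_equiv N Q x y"
  shows "ses_map N Q (id_family B) (id_family A) x y"
proof -
  obtain E f g where xE: "x = (E, f, g)" by (cases x)
  obtain E' f' g' where yE: "y = (E', f', g')" by (cases y)
  note homx = extensionsD[OF x[unfolded xE]] and homy = extensionsD[OF y[unfolded yE]]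
  show ?thesis using xy is_hom_dims[OF homx(3)] is_hom_dims[OF homy(2)]
    unfolding xE yE ses_map_def ext_equiv_def is_iso_def id_family_def by fastforce
qed

lemma ses_map_cong_families:
  assumes "ses_map N Q b a x y" "\<And>v. v \<in> {1..N} \<Longrightarrow> b v = b' v" "\<And>v. v \<in> {1..N} \<Longrightarrow> a v = a' v"
  shows "ses_map N Q b' a' x y"
  using assms unfolding ses_map_def by fastforce

lemma ses_map_equiv_left:
  assumes x: "x \<in> extensions N Q A B" "x' \<in> extensions N Q A B" and y: "y \<in> extensions N Q A' B'"
    and eq: "ext_equiv N Q x' x" and xy: "ses_map N Q b a x y"
    and b: "\<And>v. v \<in> {1..N} \<Longrightarrow> b v \<in> carrier_mat (vdim B' v) (vdim B v)"
    and a: "\<And>v. v \<in> {1..N} \<Longrightarrow> a v \<in> carrier_mat (vdim A' v) (vdim A v)"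
  shows "ses_map N Q b a x' y"
proof -
  have "ses_map N Q (\<lambda>v. b v * id_family B v) (\<lambda>v. a v * id_family A v) x' y"
    using a b by (intro ses_map_trans[OF x(2,1) y ext_equiv_ses_map[OF x(2,1) eq] xy]) (auto simp: id_family_def)
  then show ?thesis using carrier_matD[OF a] carrier_matD[OF b]
    by (elim ses_map_cong_families) (auto simp: id_family_def)
qed

lemma ses_map_equiv_right:
  assumes x: "x \<in> extensions N Q A B" and y: "y \<in> extensions N Q A' B'" "y' \<in> extensions N Q A' B'"
    and eq: "ext_equiv N Q y y'" and xy: "ses_map N Q b a x y"
    and b: "\<And>v. v \<in> {1..N} \<Longrightarrow> b v \<in> carrier_mat (vdim B' v) (vdim B v)"
    and a: "\<And>v. v \<in> {1..N} \<Longrightarrow> a v \<in> carrier_mat (vdim A' v) (vdim A v)"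
  shows "ses_map N Q b a x y'"
proof -
  have "ses_map N Q (\<lambda>v. id_family B' v * b v) (\<lambda>v. id_family A' v * a v) x y'"
    using a b by (intro ses_map_trans[OF x y xy ext_equiv_ses_map[OF y eq]]) (auto simp: id_family_def)
  then show ?thesis using carrier_matD[OF a] carrier_matD[OF b]
    by (elim ses_map_cong_families) (auto simp: id_family_def)
qed

end


section \<open>Morphisms between standard extensions\<close>

context quiver
begin

text \<open>A morphism over \<open>b\<close> and \<open>a\<close> is block triangular with diagonal
  \<open>b\<close>, \<open>a\<close>; the equation is the upper right corner of its commutation with
  an arrow, and \<open>u\<close> is its own corner.\<close>

lemma ses_map_stdD:
  assumes rep: "rep A" "rep B" "rep A'" "rep B'" and \<eta>: "cochain A B \<eta>" "cochain A' B' \<theta>"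
    and b: "\<And>v. v \<in> {1..N} \<Longrightarrow> b v \<in> carrier_mat (vdim B' v) (vdim B v)"
    and a: "\<And>v. v \<in> {1..N} \<Longrightarrow> a v \<in> carrier_mat (vdim A' v) (vdim A v)"
    and map: "ses_map N Q b a (std_ses A B \<eta>) (std_ses A' B' \<theta>)"
  shows "\<exists>u. (\<forall>v\<in>{1..N}. u v \<in> carrier_mat (vdim B' v) (vdim A v)) \<and>
     (\<forall>(s, t)\<in>Q. b t * \<eta> (s, t) + u t * amap A (s, t) = amap B' (s, t) * u s + \<theta> (s, t) * a s)"
proof -
  from map obtain h where h: "qhom (ext_rep A B \<eta>) (ext_rep A' B' \<theta>) h"
    "\<And>v. v \<in> {1..N} \<Longrightarrow> h v * inl_mat (vdim B v) (vdim A v) = inl_mat (vdim B' v) (vdim A' v) * b v"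
    "\<And>v. v \<in> {1..N} \<Longrightarrow> prr_mat (vdim B' v) (vdim A' v) * h v = a v * prr_mat (vdim B v) (vdim A v)"
    by (auto simp: ses_map_def std_ses_def)
  define u where "u v = prl_mat (vdim B' v) (vdim A' v) * (h v * inr_mat (vdim B v) (vdim A v))" for v
  have "b t * \<eta> (s, t) + u t * amap A (s, t) = amap B' (s, t) * u s + \<theta> (s, t) * a s" if st: "(s, t) \<in> Q" for s t
  proof -
    have v: "s \<in> {1..N}" "t \<in> {1..N}" using Q_vertices[OF st] by auto
    let ?pl = "prl_mat (vdim B' t) (vdim A' t) :: 'a mat" and ?ir = "inr_mat (vdim B s) (vdim A s) :: 'a mat"
    let ?E = "amap (ext_rep A B \<eta>) (s, t)" and ?E' = "amap (ext_rep A' B' \<theta>) (s, t)"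
    note d = is_hom_dims[OF h(1) v(1)] is_hom_dims[OF h(1) v(2)] is_rep_dims[OF rep(1) st] is_rep_dims[OF rep(2) st]
      is_rep_dims[OF rep(3) st] is_rep_dims[OF rep(4) st] cochain_dims[OF \<eta>(1) st] cochain_dims[OF \<eta>(2) st]
      carrier_matD[OF a[OF v(1)]] carrier_matD[OF a[OF v(2)]] carrier_matD[OF b[OF v(1)]] carrier_matD[OF b[OF v(2)]]
      ext_rep_simps(1,2)[OF rep(1,2) \<eta>(1) st] ext_rep_simps(1,2)[OF rep(3,4) \<eta>(2) st]
    have "?pl * (h t * (?E * ?ir)) = ?pl * (h t * inl_mat (vdim B t) (vdim A t)) * \<eta> (s, t) + u t * amap A (s, t)"
      unfolding ext_rep_simps(6)[OF rep(1,2) \<eta>(1) st] u_def using d by (simp add: mult_add_mat mult_mat_assoc)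
    also have "\<dots> = b t * \<eta> (s, t) + u t * amap A (s, t)"
      unfolding h(2)[OF v(2)] using d by simp
    finally have 1: "?pl * (h t * (?E * ?ir)) = b t * \<eta> (s, t) + u t * amap A (s, t)" .
    have "?pl * (h t * (?E * ?ir)) = ?pl * ((h t * ?E) * ?ir)" using d by (simp add: mult_mat_assoc)
    also have "\<dots> = (?pl * ?E') * (h s * ?ir)" unfolding is_hom_arrow[OF h(1) st] using d by (simp add: mult_mat_assoc)
    also have "\<dots> = amap B' (s, t) * u s + \<theta> (s, t) * ((prr_mat (vdim B' s) (vdim A' s) * h s) * ?ir)"
      unfolding ext_rep_simps(3)[OF rep(3,4) \<eta>(2) st] u_def using d by (simp add: add_mult_mat mult_mat_assoc)
    also have "\<dots> = amap B' (s, t) * u s + \<theta> (s, t) * a s"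
      unfolding h(3)[OF v(1)] using d by (simp add: mult_mat_assoc)
    finally show ?thesis using 1 by simp
  qed
  moreover have "u v \<in> carrier_mat (vdim B' v) (vdim A v)" if "v \<in> {1..N}" for v
    using is_hom_dims[OF h(1) that] by (intro carrier_matI) (simp_all add: u_def)
  ultimately show ?thesis by blast
qed

text \<open>The matrix \<open>h\<close> is exposed, not merely asserted to exist, because it is used
  again to show that middle terms are isomorphic.\<close>

lemma ses_map_stdI:
  assumes rep: "rep A" "rep B" "rep A'" "rep B'" and \<eta>: "cochain A B \<eta>" "cochain A' B' \<theta>"
    and b: "qhom B B' b" and a: "qhom A A' a"
    and u': "\<forall>v\<in>{1..N}. u v \<in> carrier_mat (vdim B' v) (vdim A v)"
    and eq': "\<forall>s t. (s, t) \<in> Q \<longrightarrow> b t * \<eta> (s, t) + u t * amap A (s, t) = amap B' (s, t) * u s + \<theta> (s, t) * a s"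
  defines "h \<equiv> \<lambda>v. inl_mat (vdim B' v) (vdim A' v) *
      (b v * prl_mat (vdim B v) (vdim A v) + u v * prr_mat (vdim B v) (vdim A v)) +
      inr_mat (vdim B' v) (vdim A' v) * (a v * prr_mat (vdim B v) (vdim A v))"
  shows "qhom (ext_rep A B \<eta>) (ext_rep A' B' \<theta>) h"
    and "\<And>v. v \<in> {1..N} \<Longrightarrow> h v * inl_mat (vdim B v) (vdim A v) = inl_mat (vdim B' v) (vdim A' v) * b v"
    and "\<And>v. v \<in> {1..N} \<Longrightarrow> prr_mat (vdim B' v) (vdim A' v) * h v = a v * prr_mat (vdim B v) (vdim A v)"
    and "ses_map N Q b a (std_ses A B \<eta>) (std_ses A' B' \<theta>)"
proof -
  note u = u'[rule_format] and eq = eq'[rule_format]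
  note dv = is_hom_dims[OF a] is_hom_dims[OF b] carrier_matD[OF u]
  show hom: "qhom (ext_rep A B \<eta>) (ext_rep A' B' \<theta>) h"
  proof (rule is_homI)
    fix s t assume st: "(s, t) \<in> Q"
    have v: "s \<in> {1..N}" "t \<in> {1..N}" using Q_vertices[OF st] by auto
    note d = dv[OF v(1)] dv[OF v(2)] is_rep_dims[OF rep(1) st] is_rep_dims[OF rep(2) st]
      is_rep_dims[OF rep(3) st] is_rep_dims[OF rep(4) st] cochain_dims[OF \<eta>(1) st] cochain_dims[OF \<eta>(2) st]
      ext_rep_simps(1,2)[OF rep(1,2) \<eta>(1) st] ext_rep_simps(1,2)[OF rep(3,4) \<eta>(2) st]
    let ?pl = "prl_mat (vdim B s) (vdim A s) :: 'a mat" and ?pr = "prr_mat (vdim B s) (vdim A s) :: 'a mat"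
    let ?E = "amap (ext_rep A B \<eta>) (s, t)" and ?E' = "amap (ext_rep A' B' \<theta>) (s, t)"
    show "h t * ?E = ?E' * h s"
    proof (rule biproduct_row_ext[of _ "vdim B' t" "vdim A' t"])
      have "prl_mat (vdim B' t) (vdim A' t) * (h t * ?E) =
         b t * (prl_mat (vdim B t) (vdim A t) * ?E) + u t * (prr_mat (vdim B t) (vdim A t) * ?E)"
        using d by (simp add: h_def mult_add_mat add_mult_mat mult_mat_assoc)
      also have "\<dots> = b t * amap B (s, t) * ?pl + (b t * \<eta> (s, t) * ?pr + u t * amap A (s, t) * ?pr)"
        unfolding ext_rep_simps(3,4)[OF rep(1,2) \<eta>(1) st]
        using d by (simp add: mult_add_mat mult_mat_assoc)
          (intro assoc_add_mat[of _ "vdim B' t" "vdim B s + vdim A s"] carrier_matI; simp)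
      also have "b t * \<eta> (s, t) * ?pr + u t * amap A (s, t) * ?pr = (b t * \<eta> (s, t) + u t * amap A (s, t)) * ?pr"
        using d by (simp add: add_mult_mat)
      also have "\<dots> = amap B' (s, t) * u s * ?pr + \<theta> (s, t) * a s * ?pr"
        unfolding eq[OF st] using d by (simp add: add_mult_mat)
      also have "b t * amap B (s, t) = amap B' (s, t) * b s" by (rule is_hom_arrow[OF b st])
      finally have 1: "prl_mat (vdim B' t) (vdim A' t) * (h t * ?E) =
        amap B' (s, t) * b s * ?pl + (amap B' (s, t) * u s * ?pr + \<theta> (s, t) * a s * ?pr)" .
      have "prl_mat (vdim B' t) (vdim A' t) * (?E' * h s) = (prl_mat (vdim B' t) (vdim A' t) * ?E') * h s"
        using d by (simp add: h_def mult_mat_assoc)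
      also have "\<dots> = amap B' (s, t) * b s * ?pl + (amap B' (s, t) * u s * ?pr + \<theta> (s, t) * a s * ?pr)"
        unfolding ext_rep_simps(3)[OF rep(3,4) \<eta>(2) st] h_def
        using d by (simp add: mult_add_mat add_mult_mat mult_mat_assoc)
          (intro assoc_add_mat[of _ "vdim B' t" "vdim B s + vdim A s"] carrier_matI; simp)
      finally show "prl_mat (vdim B' t) (vdim A' t) * (h t * ?E) = prl_mat (vdim B' t) (vdim A' t) * (?E' * h s)"
        using 1 by simp
      have "prr_mat (vdim B' t) (vdim A' t) * (h t * ?E) = a t * (prr_mat (vdim B t) (vdim A t) * ?E)"
        using d by (simp add: h_def mult_add_mat add_mult_mat mult_mat_assoc)
      also have "\<dots> = amap A' (s, t) * a s * ?pr"
        unfolding ext_rep_simps(4)[OF rep(1,2) \<eta>(1) st]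
        using d by (simp add: is_hom_arrow[OF a st] flip: mult_mat_assoc)
      also have "\<dots> = (prr_mat (vdim B' t) (vdim A' t) * ?E') * h s"
        unfolding ext_rep_simps(4)[OF rep(3,4) \<eta>(2) st] h_def
        using d by (simp add: mult_add_mat add_mult_mat mult_mat_assoc)
      also have "\<dots> = prr_mat (vdim B' t) (vdim A' t) * (?E' * h s)"
        using d by (simp add: h_def mult_mat_assoc)
      finally show "prr_mat (vdim B' t) (vdim A' t) * (h t * ?E) = prr_mat (vdim B' t) (vdim A' t) * (?E' * h s)" .
    qed (use d in \<open>auto simp: h_def\<close>)
  qed (use dv in \<open>auto simp: h_def\<close>)
  show 1: "h v * inl_mat (vdim B v) (vdim A v) = inl_mat (vdim B' v) (vdim A' v) * b v" if "v \<in> {1..N}" for v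
    using dv[OF that] by (simp add: h_def mult_add_mat add_mult_mat mult_mat_assoc)
  show 2: "prr_mat (vdim B' v) (vdim A' v) * h v = a v * prr_mat (vdim B v) (vdim A v)" if "v \<in> {1..N}" for v
    using dv[OF that] by (simp add: h_def mult_add_mat add_mult_mat mult_mat_assoc)
  show "ses_map N Q b a (std_ses A B \<eta>) (std_ses A' B' \<theta>)"
    unfolding ses_map_def std_ses_def using hom 1 2 by auto
qed

lemma id_family_carrier: "id_family R v \<in> carrier_mat (vdim R v) (vdim R v)"
  by (simp add: id_family_def)

lemma hom_id_family: "rep R \<Longrightarrow> qhom R R (id_family R)"
  unfolding id_family_def by (rule hom_id)

text \<open>Only the corner \<open>u\<close> of a morphism over the two identities is free, and a
  unipotent block matrix is always invertible.\<close>

lemma ext_equiv_std_iff: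
  assumes rep: "rep A" "rep B" and \<eta>: "cochain A B \<eta>" "cochain A B \<theta>"
  shows "ext_equiv N Q (std_ses A B \<eta>) (std_ses A B \<theta>) \<longleftrightarrow> cohomologous A B \<eta> \<theta>"
proof
  assume "ext_equiv N Q (std_ses A B \<eta>) (std_ses A B \<theta>)"
  then have "ses_map N Q (id_family B) (id_family A) (std_ses A B \<eta>) (std_ses A B \<theta>)"
    by (intro ext_equiv_ses_map std_ses_in_extensions rep \<eta>)
  from ses_map_stdD[OF rep rep \<eta> id_family_carrier id_family_carrier this]
  obtain u where u: "\<forall>v\<in>{1..N}. u v \<in> carrier_mat (vdim B v) (vdim A v)"
    "\<forall>(s, t)\<in>Q. id_family B t * \<eta> (s, t) + u t * amap A (s, t) = amap B (s, t) * u s + \<theta> (s, t) * id_family A s"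
    by blast
  have "\<forall>(s, t)\<in>Q. \<eta> (s, t) + u t * amap A (s, t) = amap B (s, t) * u s + \<theta> (s, t)"
    using u(2) cochain_dims[OF \<eta>(1)] cochain_dims[OF \<eta>(2)] by (auto simp: id_family_def)
  with u(1) show "cohomologous A B \<eta> \<theta>" unfolding cohomologous_def by blast
next
  assume "cohomologous A B \<eta> \<theta>"
  then obtain u where u: "\<And>v. v \<in> {1..N} \<Longrightarrow> u v \<in> carrier_mat (vdim B v) (vdim A v)"
    "\<And>s t. (s, t) \<in> Q \<Longrightarrow> \<eta> (s, t) + u t * amap A (s, t) = amap B (s, t) * u s + \<theta> (s, t)"
    unfolding cohomologous_def by blast
  have u1: "\<forall>v\<in>{1..N}. u v \<in> carrier_mat (vdim B v) (vdim A v)" using u(1) by blast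
  have "\<forall>s t. (s, t) \<in> Q \<longrightarrow>
     id_family B t * \<eta> (s, t) + u t * amap A (s, t) = amap B (s, t) * u s + \<theta> (s, t) * id_family A s"
    using u(2) cochain_dims[OF \<eta>(1)] cochain_dims[OF \<eta>(2)] by (simp add: id_family_def)
  note h = ses_map_stdI[OF rep rep \<eta> hom_id_family[OF rep(2)] hom_id_family[OF rep(1)] u1 this]
  \<comment> \<open>The inverse of the unipotent matrix with corner \<open>u\<close> has corner
    \<open>- u\<close>.\<close>
  define g where "g v = inl_mat (vdim B v) (vdim A v) *
      (prl_mat (vdim B v) (vdim A v) + ((-1) \<cdot>\<^sub>m u v) * prr_mat (vdim B v) (vdim A v)) +
      inr_mat (vdim B v) (vdim A v) * prr_mat (vdim B v) (vdim A v)" for v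
  define h' where "h' v = inl_mat (vdim B v) (vdim A v) *
      (id_family B v * prl_mat (vdim B v) (vdim A v) + u v * prr_mat (vdim B v) (vdim A v)) +
      inr_mat (vdim B v) (vdim A v) * (id_family A v * prr_mat (vdim B v) (vdim A v))" for v
  have inv: "(inl_mat b a * (prl_mat b a + X * prr_mat b a) + inr_mat b a * prr_mat b a) *
     (inl_mat b a * (prl_mat b a + Y * prr_mat b a) + inr_mat b a * prr_mat b a) = (1\<^sub>m (b + a) :: 'a mat)"
    if d: "dim_row X = b" "dim_col X = a" "dim_row Y = b" "dim_col Y = a" and XY: "Y + X = 0\<^sub>m b a" for X Y :: "'a mat" and a b
  proof (rule biproduct_row_ext[of _ b a])
    have "prl_mat b a + Y * prr_mat b a + X * prr_mat b a = prl_mat b a + (Y * prr_mat b a + X * prr_mat b a)"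
      using d by (intro assoc_add_mat[of _ b "b + a"] carrier_matI) auto
    also have "Y * prr_mat b a + X * prr_mat b a = (Y + X) * prr_mat b a" using d by (simp add: add_mult_mat)
    finally have "prl_mat b a + Y * prr_mat b a + X * prr_mat b a = prl_mat b a" using XY by simp
    then show "prl_mat b a * ((inl_mat b a * (prl_mat b a + X * prr_mat b a) + inr_mat b a * prr_mat b a) *
     (inl_mat b a * (prl_mat b a + Y * prr_mat b a) + inr_mat b a * prr_mat b a)) = prl_mat b a * (1\<^sub>m (b + a) :: 'a mat)"
      using d by (simp add: mult_add_mat add_mult_mat mult_mat_assoc)
    show "prr_mat b a * ((inl_mat b a * (prl_mat b a + X * prr_mat b a) + inr_mat b a * prr_mat b a) *
     (inl_mat b a * (prl_mat b a + Y * prr_mat b a) + inr_mat b a * prr_mat b a)) = prr_mat b a * (1\<^sub>m (b + a) :: 'a mat)"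
      using d by (simp add: mult_add_mat add_mult_mat mult_mat_assoc)
  qed (use d in auto)
  have h'_eq: "h' v = inl_mat (vdim B v) (vdim A v) *
      (prl_mat (vdim B v) (vdim A v) + u v * prr_mat (vdim B v) (vdim A v)) +
      inr_mat (vdim B v) (vdim A v) * prr_mat (vdim B v) (vdim A v)" for v
    by (simp add: h'_def id_family_def)
  have "is_iso N Q (ext_rep A B \<eta>) (ext_rep A B \<theta>) h'"
  proof (rule isomorphicI[where g = g])
    show "qhom (ext_rep A B \<eta>) (ext_rep A B \<theta>) h'" using h(1) by (simp add: h'_def[abs_def])
    fix v assume v: "v \<in> {1..N}"
    note d = carrier_matD[OF u(1)[OF v]]
    show "g v \<in> carrier_mat (vdim (ext_rep A B \<eta>) v) (vdim (ext_rep A B \<theta>) v)"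
      using d by (intro carrier_matI) (auto simp: g_def)
    have "u v + (- 1) \<cdot>\<^sub>m u v = 0\<^sub>m (vdim B v) (vdim A v)" "(- 1) \<cdot>\<^sub>m u v + u v = 0\<^sub>m (vdim B v) (vdim A v)"
      using d by (auto intro!: eq_matI)
    then show "g v * h' v = 1\<^sub>m (vdim (ext_rep A B \<eta>) v)" "h' v * g v = 1\<^sub>m (vdim (ext_rep A B \<theta>) v)"
      unfolding g_def h'_eq vdim_ext_rep using d by (auto intro!: inv)
  qed
  moreover have "h' v * inl_mat (vdim B v) (vdim A v) = inl_mat (vdim B v) (vdim A v)"
    "prr_mat (vdim B v) (vdim A v) * h' v = prr_mat (vdim B v) (vdim A v)" if v: "v \<in> {1..N}" for v
    using h(2,3)[OF v] by (simp_all add: h'_def id_family_def)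
  ultimately show "ext_equiv N Q (std_ses A B \<eta>) (std_ses A B \<theta>)"
    unfolding ext_equiv_def std_ses_def by auto
qed

end


text \<open>Addition of matrices obeys the group laws only for matching dimensions, so this
  rearrangement and the next two are done entrywise, where ring arithmetic applies.\<close>

lemma mat_add_rearrange:
  fixes X Y Z W :: "'a::comm_ring_1 mat"
  assumes "X \<in> carrier_mat n m" "Y \<in> carrier_mat n m" "Z \<in> carrier_mat n m" "W \<in> carrier_mat n m"
    and eq: "X + Y = Z + W"
  shows "W + (-1) \<cdot>\<^sub>m Y = (-1) \<cdot>\<^sub>m Z + X"
proof (rule eq_matI)
  fix i j assume "i < dim_row ((-1) \<cdot>\<^sub>m Z + X)" "j < dim_col ((-1) \<cdot>\<^sub>m Z + X)"
  then show "(W + (-1) \<cdot>\<^sub>m Y) $$ (i, j) = ((-1) \<cdot>\<^sub>m Z + X) $$ (i, j)"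
    using arg_cong[OF eq, of "\<lambda>M. M $$ (i, j)"] assms(1-4) by (auto simp: algebra_simps)
qed (use assms in auto)

lemma mat_add_combine:
  fixes X Y Z W :: "'a::comm_ring_1 mat"
  assumes "X \<in> carrier_mat n m" "Y \<in> carrier_mat n m" "Z \<in> carrier_mat n m" "W \<in> carrier_mat n m"
    and "X' \<in> carrier_mat n m" "Y' \<in> carrier_mat n m" "Z' \<in> carrier_mat n m" "W' \<in> carrier_mat n m"
    and eq: "X + Y = Z + W" "X' + Y' = Z' + W'"
  shows "(X + X') + (Y + Y') = (Z + Z') + (W + W')"
proof (rule eq_matI)
  fix i j assume "i < dim_row ((Z + Z') + (W + W'))" "j < dim_col ((Z + Z') + (W + W'))"
  then have ij: "i < n" "j < m" using assms by auto
  have add_swap: "(p + q) + (r + s) = (p + r) + (q + s)" for p q r s :: 'a by (simp add: ac_simps)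
  have "X $$ (i, j) + Y $$ (i, j) = Z $$ (i, j) + W $$ (i, j)" "X' $$ (i, j) + Y' $$ (i, j) = Z' $$ (i, j) + W' $$ (i, j)"
    using arg_cong[OF eq(1), of "\<lambda>M. M $$ (i, j)"] arg_cong[OF eq(2), of "\<lambda>M. M $$ (i, j)"] assms(1-8) ij by auto
  then have "(X $$ (i, j) + Y $$ (i, j)) + (X' $$ (i, j) + Y' $$ (i, j)) =
      (Z $$ (i, j) + W $$ (i, j)) + (Z' $$ (i, j) + W' $$ (i, j))" by simp
  then have "(X $$ (i, j) + X' $$ (i, j)) + (Y $$ (i, j) + Y' $$ (i, j)) =
      (Z $$ (i, j) + Z' $$ (i, j)) + (W $$ (i, j) + W' $$ (i, j))" unfolding add_swap[of "X $$ (i, j)" "X' $$ (i, j)"] add_swap[of "Z $$ (i, j)" "Z' $$ (i, j)"] .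
  then show "((X + X') + (Y + Y')) $$ (i, j) = ((Z + Z') + (W + W')) $$ (i, j)"
    using assms(1-8) ij by (auto simp: add.assoc)
qed (use assms in auto)

lemma mat_add_cancel:
  fixes X Y Z W :: "'a::comm_ring_1 mat"
  assumes "X \<in> carrier_mat n m" "Y \<in> carrier_mat n m" "Z \<in> carrier_mat n m" "W \<in> carrier_mat n m"
    "V \<in> carrier_mat n m" and eq: "(X + V) + Y = Z + (V + W)"
  shows "X + Y = Z + W"
proof (rule eq_matI)
  fix i j assume "i < dim_row (Z + W)" "j < dim_col (Z + W)"
  then show "(X + Y) $$ (i, j) = (Z + W) $$ (i, j)"
    using arg_cong[OF eq, of "\<lambda>M. M $$ (i, j)"] assms(1-5) by (auto simp: algebra_simps)
qed (use assms in auto)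

section \<open>Cohomology classes of cochains and the elements of Ext1\<close>

context quiver
begin

lemma cochain_carrier: "cochain A B \<eta> \<Longrightarrow> (s, t) \<in> Q \<Longrightarrow> \<eta> (s, t) \<in> carrier_mat (vdim B t) (vdim A s)"
  by (auto simp: cochain_def)

lemma cohomologousI:
  assumes "\<And>v. v \<in> {1..N} \<Longrightarrow> u v \<in> carrier_mat (vdim B v) (vdim A v)"
    "\<And>s t. (s, t) \<in> Q \<Longrightarrow> \<eta> (s, t) + u t * amap A (s, t) = amap B (s, t) * u s + \<theta> (s, t)"
  shows "cohomologous A B \<eta> \<theta>"
  using assms unfolding cohomologous_def by blast

lemma coboundary_carrier:
  assumes rep: "rep A" "rep B" and u: "\<And>v. v \<in> {1..N} \<Longrightarrow> u v \<in> carrier_mat (vdim B v) (vdim A v)"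
    and st: "(s, t) \<in> Q"
  shows "u t * amap A (s, t) \<in> carrier_mat (vdim B t) (vdim A s)"
    "amap B (s, t) * u s \<in> carrier_mat (vdim B t) (vdim A s)"
  using carrier_matD[OF u[of s]] carrier_matD[OF u[of t]] Q_vertices[OF st]
    is_rep_dims[OF rep(1) st] is_rep_dims[OF rep(2) st] by (auto intro!: carrier_matI)

lemma cohomologous_refl:
  assumes "rep A" "rep B" "cochain A B \<eta>"
  shows "cohomologous A B \<eta> \<eta>"
  using assms(1,2)[THEN is_rep_dims(1)] assms(1,2)[THEN is_rep_dims(2)] cochain_dims[OF assms(3)]
  by (intro cohomologousI[of "\<lambda>v. 0\<^sub>m (vdim B v) (vdim A v)"]) auto

lemma cohomologous_sym:
  assumes rep: "rep A" "rep B" and c: "cochain A B \<eta>" "cochain A B \<theta>" and eq: "cohomologous A B \<eta> \<theta>"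
  shows "cohomologous A B \<theta> \<eta>"
proof -
  obtain u where u: "\<And>v. v \<in> {1..N} \<Longrightarrow> u v \<in> carrier_mat (vdim B v) (vdim A v)"
    "\<And>s t. (s, t) \<in> Q \<Longrightarrow> \<eta> (s, t) + u t * amap A (s, t) = amap B (s, t) * u s + \<theta> (s, t)"
    using eq unfolding cohomologous_def by blast
  show ?thesis
  proof (rule cohomologousI)
    fix s t assume st: "(s, t) \<in> Q"
    have v: "s \<in> {1..N}" "t \<in> {1..N}" using Q_vertices[OF st] by auto
    have "((-1) \<cdot>\<^sub>m u t) * amap A (s, t) = (-1) \<cdot>\<^sub>m (u t * amap A (s, t))"
      "amap B (s, t) * ((-1) \<cdot>\<^sub>m u s) = (-1) \<cdot>\<^sub>m (amap B (s, t) * u s)"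
      using carrier_matD[OF u(1)[OF v(1)]] carrier_matD[OF u(1)[OF v(2)]]
        is_rep_dims[OF rep(1) st] is_rep_dims[OF rep(2) st] by (auto simp: smult_mult_mat mult_smult_mat)
    then show "\<theta> (s, t) + ((-1) \<cdot>\<^sub>m u t) * amap A (s, t) = amap B (s, t) * ((-1) \<cdot>\<^sub>m u s) + \<eta> (s, t)"
      using mat_add_rearrange[OF cochain_carrier[OF c(1) st] coboundary_carrier[OF rep u(1) st] cochain_carrier[OF c(2) st] u(2)[OF st]]
      by simp
  qed (use u in auto)
qed

lemma cohomologous_add:
  assumes rep: "rep A" "rep B"
    and c: "cochain A B \<eta>" "cochain A B \<theta>" "cochain A B \<eta>'" "cochain A B \<theta>'"
    and eq: "cohomologous A B \<eta> \<theta>" "cohomologous A B \<eta>' \<theta>'"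
  shows "cohomologous A B (\<lambda>a. \<eta> a + \<eta>' a) (\<lambda>a. \<theta> a + \<theta>' a)"
proof -
  obtain u where u: "\<And>v. v \<in> {1..N} \<Longrightarrow> u v \<in> carrier_mat (vdim B v) (vdim A v)"
    "\<And>s t. (s, t) \<in> Q \<Longrightarrow> \<eta> (s, t) + u t * amap A (s, t) = amap B (s, t) * u s + \<theta> (s, t)"
    using eq(1) unfolding cohomologous_def by blast
  obtain u' where u': "\<And>v. v \<in> {1..N} \<Longrightarrow> u' v \<in> carrier_mat (vdim B v) (vdim A v)"
    "\<And>s t. (s, t) \<in> Q \<Longrightarrow> \<eta>' (s, t) + u' t * amap A (s, t) = amap B (s, t) * u' s + \<theta>' (s, t)"
    using eq(2) unfolding cohomologous_def by blast
  show ?thesis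
  proof (rule cohomologousI)
    fix s t assume st: "(s, t) \<in> Q"
    have v: "s \<in> {1..N}" "t \<in> {1..N}" using Q_vertices[OF st] by auto
    have "(u t + u' t) * amap A (s, t) = u t * amap A (s, t) + u' t * amap A (s, t)"
      "amap B (s, t) * (u s + u' s) = amap B (s, t) * u s + amap B (s, t) * u' s"
      using carrier_matD[OF u(1)[OF v(1)]] carrier_matD[OF u(1)[OF v(2)]]
        carrier_matD[OF u'(1)[OF v(1)]] carrier_matD[OF u'(1)[OF v(2)]]
        is_rep_dims[OF rep(1) st] is_rep_dims[OF rep(2) st] by (auto simp: add_mult_mat mult_add_mat)
    then show "\<eta> (s, t) + \<eta>' (s, t) + (u t + u' t) * amap A (s, t) =
       amap B (s, t) * (u s + u' s) + (\<theta> (s, t) + \<theta>' (s, t))"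
      using mat_add_combine[OF cochain_carrier[OF c(1) st] coboundary_carrier[OF rep u(1) st] cochain_carrier[OF c(2) st]
         cochain_carrier[OF c(3) st] coboundary_carrier[OF rep u'(1) st] cochain_carrier[OF c(4) st] u(2)[OF st] u'(2)[OF st]]
      by simp
  qed (use u u' in auto)
qed

text \<open>Add the two relations and cancel \<open>\<theta>\<close>, which then occurs on both
  sides.\<close>

lemma cohomologous_trans:
  assumes rep: "rep A" "rep B" and c: "cochain A B \<eta>" "cochain A B \<theta>" "cochain A B \<zeta>"
    and eq: "cohomologous A B \<eta> \<theta>" "cohomologous A B \<theta> \<zeta>"
  shows "cohomologous A B \<eta> \<zeta>"
proof -
  obtain u where u: "\<And>v. v \<in> {1..N} \<Longrightarrow> u v \<in> carrier_mat (vdim B v) (vdim A v)"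
    "\<And>s t. (s, t) \<in> Q \<Longrightarrow> \<eta> (s, t) + \<theta> (s, t) + u t * amap A (s, t) = amap B (s, t) * u s + (\<theta> (s, t) + \<zeta> (s, t))"
    using cohomologous_add[OF rep c(1,2,2,3) eq] unfolding cohomologous_def by blast
  show ?thesis
    by (rule cohomologousI[OF u(1)])
      (use mat_add_cancel[OF cochain_carrier[OF c(1)] coboundary_carrier[OF rep u(1)] cochain_carrier[OF c(3)] cochain_carrier[OF c(2)] u(2)]
        in auto)
qed

lemma ext_equiv_trans:
  assumes x: "x \<in> extensions N Q A B" "y \<in> extensions N Q A B" "z \<in> extensions N Q A B"
    and eq: "ext_equiv N Q x y" "ext_equiv N Q y z"
  shows "ext_equiv N Q x z"
proof -
  obtain E f g where xE: "x = (E, f, g)" by (cases x)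
  obtain E' f' g' where yE: "y = (E', f', g')" by (cases y)
  obtain E'' f'' g'' where zE: "z = (E'', f'', g'')" by (cases z)
  note homx = extensionsD[OF x(1)[unfolded xE]] and homy = extensionsD[OF x(2)[unfolded yE]]
    and homz = extensionsD[OF x(3)[unfolded zE]]
  from eq(1) obtain h where h: "is_iso N Q E E' h" "\<And>v. v \<in> {1..N} \<Longrightarrow> h v * f v = f' v"
    "\<And>v. v \<in> {1..N} \<Longrightarrow> g' v * h v = g v" unfolding xE yE ext_equiv_def by auto
  from eq(2) obtain h' where h': "is_iso N Q E' E'' h'" "\<And>v. v \<in> {1..N} \<Longrightarrow> h' v * f' v = f'' v"
    "\<And>v. v \<in> {1..N} \<Longrightarrow> g'' v * h' v = g' v" unfolding yE zE ext_equiv_def by auto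
  have hh: "qhom E E' h" "qhom E' E'' h'" using h(1) h'(1) by (auto simp: is_iso_def)
  obtain k where k: "qhom E' E k" "\<And>v. v \<in> {1..N} \<Longrightarrow> k v * h v = 1\<^sub>m (vdim E v)"
    "\<And>v. v \<in> {1..N} \<Longrightarrow> h v * k v = 1\<^sub>m (vdim E' v)"
    using is_isoE[OF h(1) homx(1) homy(1)] by metis
  obtain k' where k': "qhom E'' E' k'" "\<And>v. v \<in> {1..N} \<Longrightarrow> k' v * h' v = 1\<^sub>m (vdim E' v)"
    "\<And>v. v \<in> {1..N} \<Longrightarrow> h' v * k' v = 1\<^sub>m (vdim E'' v)"
    using is_isoE[OF h'(1) homy(1) homz(1)] by metis
  have "is_iso N Q E E'' (\<lambda>v. h' v * h v)"
  proof (rule isomorphicI[OF hom_comp[OF hh homx(1) homy(1) homz(1)], where g = "\<lambda>v. k v * k' v"])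
    fix v assume v: "v \<in> {1..N}"
    show "k v * k' v \<in> carrier_mat (vdim E v) (vdim E'' v)"
      using is_hom_dims[OF k(1) v] is_hom_dims[OF k'(1) v] by (intro carrier_matI) auto
    show "k v * k' v * (h' v * h v) = 1\<^sub>m (vdim E v)"
      by (rule comp_inverse[OF hh(1) k(1) hh(2) k'(1) v k(2)[OF v] k'(2)[OF v]])
    show "h' v * h v * (k v * k' v) = 1\<^sub>m (vdim E'' v)"
      by (rule comp_inverse[OF k'(1) hh(2) k(1) hh(1) v k'(3)[OF v] k(3)[OF v]])
  qed
  moreover have "h' v * h v * f v = f'' v \<and> g'' v * (h' v * h v) = g v" if v: "v \<in> {1..N}" for v
  proof -
    note d = is_hom_dims[OF hh(1) v] is_hom_dims[OF hh(2) v] is_hom_dims[OF homx(2) v] is_hom_dims[OF homz(3) v]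
    have "h' v * h v * f v = h' v * f' v" using d h(2)[OF v] by (simp add: mult_mat_assoc)
    moreover have "g'' v * (h' v * h v) = g' v * h v" using d h'(3)[OF v] by (simp flip: mult_mat_assoc)
    ultimately show ?thesis using h(3)[OF v] h'(2)[OF v] by simp
  qed
  ultimately show ?thesis unfolding xE zE ext_equiv_def by auto
qed

definition cls :: "'k::field rep \<Rightarrow> 'k rep \<Rightarrow> 'k cochain \<Rightarrow> 'k ses set" where
  "cls A B \<eta> = ext_class N Q A B (std_ses A B \<eta>)"

lemma ext_class_eq:
  assumes x: "x \<in> extensions N Q A B" "y \<in> extensions N Q A B" and eq: "ext_equiv N Q x y"
  shows "ext_class N Q A B x = ext_class N Q A B y"
  unfolding ext_class_def
  using ext_equiv_trans[OF x(1,2) _ eq] ext_equiv_trans[OF x(2,1) _ ext_equiv_sym[OF x eq]] by blast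

lemma cls_eq_iff:
  assumes rep: "rep A" "rep B" and c: "cochain A B \<eta>" "cochain A B \<theta>"
  shows "cls A B \<eta> = cls A B \<theta> \<longleftrightarrow> cohomologous A B \<eta> \<theta>"
proof
  note mem = std_ses_in_extensions[OF rep c(1)] std_ses_in_extensions[OF rep c(2)]
  assume "cls A B \<eta> = cls A B \<theta>"
  then have "std_ses A B \<theta> \<in> cls A B \<eta>"
    using mem(2) ext_equiv_refl[OF mem(2)] by (simp add: cls_def ext_class_def)
  then show "cohomologous A B \<eta> \<theta>"
    using ext_equiv_std_iff[OF rep c] by (simp add: cls_def ext_class_def)
next
  assume "cohomologous A B \<eta> \<theta>"
  then show "cls A B \<eta> = cls A B \<theta>" unfolding cls_def
    using ext_equiv_std_iff[OF rep c] by (intro ext_class_eq std_ses_in_extensions[OF rep] c) auto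
qed

lemma Ext1_eq:
  assumes rep: "rep A" "rep B"
  shows "Ext1 N Q A B = {cls A B \<eta> | \<eta>. cochain A B \<eta>}"
proof (intro Set.set_eqI iffI)
  fix X assume "X \<in> Ext1 N Q A B"
  then obtain x where x: "x \<in> extensions N Q A B" "X = ext_class N Q A B x" by (auto simp: Ext1_def)
  obtain \<eta> where \<eta>: "cochain A B \<eta>" "ext_equiv N Q x (std_ses A B \<eta>)"
    using extension_equiv_std[OF rep x(1)] .
  have "X = cls A B \<eta>" unfolding x(2) cls_def by (rule ext_class_eq[OF x(1) std_ses_in_extensions[OF rep \<eta>(1)] \<eta>(2)])
  then show "X \<in> {cls A B \<eta> | \<eta>. cochain A B \<eta>}" using \<eta> by blast
next
  fix X assume "X \<in> {cls A B \<eta> | \<eta>. cochain A B \<eta>}"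
  then show "X \<in> Ext1 N Q A B" unfolding Ext1_def cls_def using std_ses_in_extensions[OF rep] by blast
qed

definition zero_cochain :: "'k::field rep \<Rightarrow> 'k rep \<Rightarrow> 'k cochain" where
  "zero_cochain A B = (\<lambda>(s, t). 0\<^sub>m (vdim B t) (vdim A s))"

lemma cochain_zero: "cochain A B (zero_cochain A B)"
  by (auto simp: cochain_def zero_cochain_def)

lemma ext_zero_eq:
  assumes rep: "rep A" "rep B"
  shows "ext_zero N Q A B = cls A B (zero_cochain A B)"
proof -
  let ?f = "\<lambda>v. inl_mat (vdim B v) (vdim A v) :: 'a mat" and ?g = "\<lambda>v. prr_mat (vdim B v) (vdim A v) :: 'a mat"
  have split: "split_ses A B = (direct_sum B A, ?f, ?g)"
    by (simp add: split_ses_def append_columns_eq append_rows_eq)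
  \<comment> \<open>The two middle terms agree at arrows of \<open>Q\<close>, not at arbitrary
    pairs; so the sequences are compared by an equivalence made of identity matrices, not by
    equality.\<close>
  have arrow: "amap (ext_rep A B (zero_cochain A B)) (s, t) = amap (direct_sum B A) (s, t)" if "(s, t) \<in> Q" for s t
    using is_rep_dims[OF rep(1) that] is_rep_dims[OF rep(2) that]
    by (simp add: ext_rep_def zero_cochain_def block_diag_eq)
  have "std_ses A B (zero_cochain A B) \<in> extensions N Q A B"
    by (rule std_ses_in_extensions[OF rep cochain_zero])
  then have mem: "split_ses A B \<in> extensions N Q A B"
    using hom_inl[OF rep(2,1)] hom_prr[OF rep(2,1)] is_rep_direct_sum[OF rep(2,1)]
    unfolding extensions_def split std_ses_def by simp
  have "qhom (direct_sum B A) (ext_rep A B (zero_cochain A B)) (\<lambda>v. 1\<^sub>m (vdim B v + vdim A v))"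
    using is_rep_dims[OF rep(1)] is_rep_dims[OF rep(2)] by (intro is_homI) (auto simp: arrow)
  then have "is_iso N Q (direct_sum B A) (ext_rep A B (zero_cochain A B)) (\<lambda>v. 1\<^sub>m (vdim B v + vdim A v))"
    by (rule isomorphicI[where g = "\<lambda>v. 1\<^sub>m (vdim B v + vdim A v)"]) auto
  then have "ext_equiv N Q (split_ses A B) (std_ses A B (zero_cochain A B))"
    unfolding split std_ses_def ext_equiv_def by (auto intro!: exI[of _ "\<lambda>v. 1\<^sub>m (vdim B v + vdim A v)"])
  then show ?thesis unfolding ext_zero_def cls_def
    by (rule ext_class_eq[OF mem std_ses_in_extensions[OF rep cochain_zero]])
qed

lemma Ext1_is_zero_iff:
  assumes rep: "rep A" "rep B"
  shows "Ext1_is_zero N Q A B \<longleftrightarrow> (\<forall>\<eta>. cochain A B \<eta> \<longrightarrow> cohomologous A B \<eta> (zero_cochain A B))"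
  unfolding Ext1_is_zero_def Ext1_eq[OF rep] ext_zero_eq[OF rep]
  using cls_eq_iff[OF rep _ cochain_zero] cochain_zero by fast

lemma mem_cls: "y \<in> cls A B \<eta> \<longleftrightarrow> y \<in> extensions N Q A B \<and> ext_equiv N Q (std_ses A B \<eta>) y"
  by (simp add: cls_def ext_class_def)

lemma cochain_smult: "cochain A B \<eta> \<Longrightarrow> cochain A B (\<lambda>a. c \<cdot>\<^sub>m \<eta> a)"
  by (auto simp: cochain_def)

lemma cochain_add: "cochain A B \<eta> \<Longrightarrow> cochain A B \<theta> \<Longrightarrow> cochain A B (\<lambda>a. \<eta> a + \<theta> a)"
  by (auto simp: cochain_def)

end


section \<open>The scalar action in terms of cochains\<close>

context quiver
begin

text \<open>With \<open>c\<close> times the identity on the left and the identity on the right, the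
  corner equation of a morphism of standard sequences says that the target cochain is cohomologous
  to \<open>c\<close> times the source.\<close>

lemma ext_scale_cls:
  assumes rep: "rep A" "rep B" and \<eta>: "cochain A B \<eta>"
  shows "ext_scale N Q A B c (cls A B \<eta>) = cls A B (\<lambda>a. c \<cdot>\<^sub>m \<eta> a)"
proof (intro Set.set_eqI iffI)
  note mem = std_ses_in_extensions[OF rep]
  note c\<eta> = cochain_smult[OF \<eta>, of c]
  have car: "c \<cdot>\<^sub>m id_family B v \<in> carrier_mat (vdim B v) (vdim B v)" for v by (simp add: id_family_def)
  {
    fix y assume "y \<in> ext_scale N Q A B c (cls A B \<eta>)"
    then obtain x where y: "y \<in> extensions N Q A B" and x: "x \<in> extensions N Q A B" "ext_equiv N Q (std_ses A B \<eta>) x"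
      and xy: "ses_map N Q (\<lambda>v. c \<cdot>\<^sub>m id_family B v) (id_family A) x y"
      by (auto simp: ext_scale_def mem_cls)
    obtain \<zeta> where \<zeta>: "cochain A B \<zeta>" "ext_equiv N Q y (std_ses A B \<zeta>)"
      using extension_equiv_std[OF rep y] .
    have "ses_map N Q (\<lambda>v. c \<cdot>\<^sub>m id_family B v) (id_family A) (std_ses A B \<eta>) y"
      by (rule ses_map_equiv_left[OF x(1) mem[OF \<eta>] y x(2) xy car id_family_carrier])
    then have "ses_map N Q (\<lambda>v. c \<cdot>\<^sub>m id_family B v) (id_family A) (std_ses A B \<eta>) (std_ses A B \<zeta>)"
      by (rule ses_map_equiv_right[OF mem[OF \<eta>] y mem[OF \<zeta>(1)] \<zeta>(2) _ car id_family_carrier])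
    from ses_map_stdD[OF rep rep \<eta> \<zeta>(1) car id_family_carrier this]
    obtain u where u: "\<forall>v\<in>{1..N}. u v \<in> carrier_mat (vdim B v) (vdim A v)"
      "\<forall>(s, t)\<in>Q. c \<cdot>\<^sub>m id_family B t * \<eta> (s, t) + u t * amap A (s, t) = amap B (s, t) * u s + \<zeta> (s, t) * id_family A s"
      by blast
    have "cohomologous A B (\<lambda>a. c \<cdot>\<^sub>m \<eta> a) \<zeta>"
    proof (rule cohomologousI)
      fix s t assume st: "(s, t) \<in> Q"
      then show "c \<cdot>\<^sub>m \<eta> (s, t) + u t * amap A (s, t) = amap B (s, t) * u s + \<zeta> (s, t)"
        using u(2) cochain_dims[OF \<eta> st] cochain_dims[OF \<zeta>(1) st] by (auto simp: id_family_def smult_mult_mat)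
    qed (use u(1) in auto)
    then have "ext_equiv N Q (std_ses A B (\<lambda>a. c \<cdot>\<^sub>m \<eta> a)) (std_ses A B \<zeta>)"
      using ext_equiv_std_iff[OF rep c\<eta> \<zeta>(1)] by simp
    then have "ext_equiv N Q (std_ses A B (\<lambda>a. c \<cdot>\<^sub>m \<eta> a)) y"
      by (rule ext_equiv_trans[OF mem[OF c\<eta>] mem[OF \<zeta>(1)] y _ ext_equiv_sym[OF y mem[OF \<zeta>(1)] \<zeta>(2)]])
    then show "y \<in> cls A B (\<lambda>a. c \<cdot>\<^sub>m \<eta> a)" using y by (simp add: mem_cls)
  next
    fix y assume "y \<in> cls A B (\<lambda>a. c \<cdot>\<^sub>m \<eta> a)"
    then have y: "y \<in> extensions N Q A B" "ext_equiv N Q (std_ses A B (\<lambda>a. c \<cdot>\<^sub>m \<eta> a)) y" by (auto simp: mem_cls)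
    have hom: "qhom B B (\<lambda>v. c \<cdot>\<^sub>m id_family B v)"
      using is_rep_dims[OF rep(2)] by (intro is_homI) (auto simp: id_family_def smult_mult_mat mult_smult_mat)
    have z: "\<forall>v\<in>{1..N}. (0\<^sub>m (vdim B v) (vdim A v) :: 'a mat) \<in> carrier_mat (vdim B v) (vdim A v)" by simp
    have "\<forall>s t. (s, t) \<in> Q \<longrightarrow> c \<cdot>\<^sub>m id_family B t * \<eta> (s, t) + 0\<^sub>m (vdim B t) (vdim A t) * amap A (s, t) =
        amap B (s, t) * 0\<^sub>m (vdim B s) (vdim A s) + c \<cdot>\<^sub>m \<eta> (s, t) * id_family A s"
      using is_rep_dims[OF rep(1)] is_rep_dims[OF rep(2)] cochain_dims[OF \<eta>]
      by (simp add: id_family_def smult_mult_mat)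
    from ses_map_stdI(4)[OF rep rep \<eta> c\<eta> hom hom_id_family[OF rep(1)] z this]
    have "ses_map N Q (\<lambda>v. c \<cdot>\<^sub>m id_family B v) (id_family A) (std_ses A B \<eta>) y"
      by (rule ses_map_equiv_right[OF mem[OF \<eta>] mem[OF c\<eta>] y(1,2) _ car id_family_carrier])
    moreover have "std_ses A B \<eta> \<in> cls A B \<eta>" using mem[OF \<eta>] ext_equiv_refl[OF mem[OF \<eta>]] by (simp add: mem_cls)
    ultimately show "y \<in> ext_scale N Q A B c (cls A B \<eta>)"
      using y(1) by (auto simp: ext_scale_def)
  }
qed

end


section \<open>The Baer sum, and Ext1 of dimension one\<close>

context quiver
begin

text \<open>A morphism out of \<open>E \<oplus> E'\<close> is a pair of morphisms. This replaces the
  pushout along the codiagonal by two pullbacks along the inclusions of \<open>A\<close> into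
  \<open>A \<oplus> A\<close>, so that every step of the Baer sum becomes a pullback.\<close>

lemma ses_map_codiagonal_iff:
  assumes rep: "rep A" "rep B"
    and x: "x \<in> extensions N Q A B" "x' \<in> extensions N Q A B" and w: "w \<in> extensions N Q (direct_sum A A) B"
  shows "ses_map N Q (codiagonal B) (id_family (direct_sum A A)) (ses_direct_sum x x') w \<longleftrightarrow>
    ses_map N Q (id_family B) (\<lambda>v. inl_mat (vdim A v) (vdim A v)) x w \<and>
    ses_map N Q (id_family B) (\<lambda>v. inr_mat (vdim A v) (vdim A v)) x' w"
proof -
  obtain E f g where xE: "x = (E, f, g)" by (cases x)
  obtain E' f' g' where xE': "x' = (E', f', g')" by (cases x')
  obtain W p q where wW: "w = (W, p, q)" by (cases w)
  note h1 = extensionsD[OF x(1)[unfolded xE]] and h2 = extensionsD[OF x(2)[unfolded xE']] and hw = extensionsD[OF w[unfolded wW]]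
  note dims = is_hom_dims[OF h1(2)] is_hom_dims[OF h1(3)] is_hom_dims[OF h2(2)] is_hom_dims[OF h2(3)]
    is_hom_dims[OF hw(2)] is_hom_dims[OF hw(3), unfolded vdim_direct_sum]
  have repEE: "rep (direct_sum E E')" using h1 h2 by (intro is_rep_direct_sum)
  have codiag: "codiagonal B v = prl_mat (vdim B v) (vdim B v) + prr_mat (vdim B v) (vdim B v)" for v
    by (simp add: codiagonal_def codiagonal_eq)
  show ?thesis
  proof
    assume "ses_map N Q (codiagonal B) (id_family (direct_sum A A)) (ses_direct_sum x x') w"
    then obtain h where h: "qhom (direct_sum E E') W h"
      "\<And>v. v \<in> {1..N} \<Longrightarrow> h v * block_diag (f v) (f' v) = p v * codiagonal B v"
      "\<And>v. v \<in> {1..N} \<Longrightarrow> q v * h v = 1\<^sub>m (vdim A v + vdim A v) * block_diag (g v) (g' v)"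
      unfolding xE xE' wW ses_map_def ses_direct_sum_def id_family_def by auto
    let ?l = "\<lambda>v. inl_mat (vdim E v) (vdim E' v)" and ?r = "\<lambda>v. inr_mat (vdim E v) (vdim E' v)"
    have hl: "qhom E W (\<lambda>v. h v * ?l v)" by (rule hom_comp[OF hom_inl[OF h1(1) h2(1)] h(1) h1(1) repEE hw(1)])
    have hr: "qhom E' W (\<lambda>v. h v * ?r v)" by (rule hom_comp[OF hom_inr[OF h1(1) h2(1)] h(1) h2(1) repEE hw(1)])
    have eqs: "h v * ?l v * f v = p v * id_family B v" "q v * (h v * ?l v) = inl_mat (vdim A v) (vdim A v) * g v"
      "h v * ?r v * f' v = p v * id_family B v" "q v * (h v * ?r v) = inr_mat (vdim A v) (vdim A v) * g' v"
      if v: "v \<in> {1..N}" for v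
    proof -
      note d = dims[OF v] is_hom_dims[OF h(1) v, unfolded vdim_direct_sum]
      note bdf = block_diag_simps[OF d(1,5,2,6)] and bdg = block_diag_simps[OF d(3,7,4,8)]
      have "h v * ?l v * f v = (h v * block_diag (f v) (f' v)) * inl_mat (vdim B v) (vdim B v)"
        using d bdf(3) by (simp add: mult_mat_assoc)
      also have "\<dots> = p v" unfolding h(2)[OF v] codiag using d by (simp add: mult_mat_assoc add_mult_mat)
      finally show "h v * ?l v * f v = p v * id_family B v" using d by (simp add: id_family_def)
      have "h v * ?r v * f' v = (h v * block_diag (f v) (f' v)) * inr_mat (vdim B v) (vdim B v)"
        using d bdf(4) by (simp add: mult_mat_assoc)
      also have "\<dots> = p v" unfolding h(2)[OF v] codiag using d by (simp add: mult_mat_assoc add_mult_mat)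
      finally show "h v * ?r v * f' v = p v * id_family B v" using d by (simp add: id_family_def)
      have qh: "q v * h v = block_diag (g v) (g' v)" using h(3)[OF v] d by simp
      have "q v * (h v * ?l v) = (q v * h v) * ?l v" "q v * (h v * ?r v) = (q v * h v) * ?r v"
        using d by (simp_all add: mult_mat_assoc)
      then show "q v * (h v * ?l v) = inl_mat (vdim A v) (vdim A v) * g v"
        "q v * (h v * ?r v) = inr_mat (vdim A v) (vdim A v) * g' v"
        unfolding qh using bdg(3,4) by simp_all
    qed
    show "ses_map N Q (id_family B) (\<lambda>v. inl_mat (vdim A v) (vdim A v)) x w \<and>
      ses_map N Q (id_family B) (\<lambda>v. inr_mat (vdim A v) (vdim A v)) x' w"
      unfolding xE xE' wW ses_map_def using hl hr eqs by auto
  next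
    assume "ses_map N Q (id_family B) (\<lambda>v. inl_mat (vdim A v) (vdim A v)) x w \<and>
      ses_map N Q (id_family B) (\<lambda>v. inr_mat (vdim A v) (vdim A v)) x' w"
    then obtain h h' where h: "qhom E W h" "\<And>v. v \<in> {1..N} \<Longrightarrow> h v * f v = p v * id_family B v"
       "\<And>v. v \<in> {1..N} \<Longrightarrow> q v * h v = inl_mat (vdim A v) (vdim A v) * g v"
      and h': "qhom E' W h'" "\<And>v. v \<in> {1..N} \<Longrightarrow> h' v * f' v = p v * id_family B v"
       "\<And>v. v \<in> {1..N} \<Longrightarrow> q v * h' v = inr_mat (vdim A v) (vdim A v) * g' v"
      unfolding xE xE' wW ses_map_def by auto
    let ?h = "\<lambda>v. h v * prl_mat (vdim E v) (vdim E' v) + h' v * prr_mat (vdim E v) (vdim E' v)"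
    have hom: "qhom (direct_sum E E') W ?h" by (rule hom_copair[OF h(1) h'(1) h1(1) h2(1) hw(1)])
    have "?h v * block_diag (f v) (f' v) = p v * codiagonal B v \<and>
       q v * ?h v = id_family (direct_sum A A) v * block_diag (g v) (g' v)" if v: "v \<in> {1..N}" for v
    proof
      note d = dims[OF v] is_hom_dims[OF h(1) v] is_hom_dims[OF h'(1) v]
      note bdf = block_diag_simps[OF d(1,5,2,6)]
      have "?h v * block_diag (f v) (f' v) = (h v * f v) * prl_mat (vdim B v) (vdim B v) +
          (h' v * f' v) * prr_mat (vdim B v) (vdim B v)"
        using d bdf(1,2) by (simp add: add_mult_mat mult_mat_assoc)
      then show "?h v * block_diag (f v) (f' v) = p v * codiagonal B v"
        unfolding h(2)[OF v] h'(2)[OF v] codiag using d by (simp add: id_family_def mult_add_mat)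
      have "q v * ?h v = (q v * h v) * prl_mat (vdim E v) (vdim E' v) + (q v * h' v) * prr_mat (vdim E v) (vdim E' v)"
        using d by (simp add: mult_add_mat mult_mat_assoc)
      also have "\<dots> = block_diag (g v) (g' v)"
        unfolding h(3)[OF v] h'(3)[OF v] block_diag_eq using d by (simp add: mult_mat_assoc)
      finally show "q v * ?h v = id_family (direct_sum A A) v * block_diag (g v) (g' v)"
        using d by (simp add: id_family_def)
    qed
    then show "ses_map N Q (codiagonal B) (id_family (direct_sum A A)) (ses_direct_sum x x') w"
      unfolding xE xE' wW ses_map_def ses_direct_sum_def using hom by auto
  qed
qed

lemma cohomologous_cong:
  assumes "cohomologous A B \<eta> \<theta>" "\<And>s t. (s, t) \<in> Q \<Longrightarrow> \<theta> (s, t) = \<theta>' (s, t)"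
  shows "cohomologous A B \<eta> \<theta>'"
proof -
  obtain u where u: "\<And>v. v \<in> {1..N} \<Longrightarrow> u v \<in> carrier_mat (vdim B v) (vdim A v)"
    "\<And>s t. (s, t) \<in> Q \<Longrightarrow> \<eta> (s, t) + u t * amap A (s, t) = amap B (s, t) * u s + \<theta> (s, t)"
    using assms(1) unfolding cohomologous_def by blast
  show ?thesis by (rule cohomologousI[OF u(1)]) (use u(2) assms(2) in auto)
qed

lemma cochain_precompose:
  assumes "cochain A' B \<omega>" "rep A" "\<And>v. v \<in> {1..N} \<Longrightarrow> a v \<in> carrier_mat (vdim A' v) (vdim A v)"
  shows "cochain A B (\<lambda>(s, t). \<omega> (s, t) * a s)"
  unfolding cochain_def
proof clarify
  fix s t assume st: "(s, t) \<in> Q"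
  show "\<omega> (s, t) * a s \<in> carrier_mat (vdim B t) (vdim A s)"
    using cochain_dims[OF assms(1) st] carrier_matD[OF assms(3)] Q_vertices[OF st] by (intro carrier_matI) auto
qed

text \<open>With the identity of \<open>B\<close> on the left, the corner equation becomes a
  cohomology relation in which the target cochain is multiplied on the right by
  \<open>a\<close>.\<close>

lemma ses_map_pullback_iff:
  assumes rep: "rep A" "rep A'" "rep B" and c: "cochain A B \<eta>" "cochain A' B \<omega>" and a: "qhom A A' a"
  shows "ses_map N Q (id_family B) a (std_ses A B \<eta>) (std_ses A' B \<omega>) \<longleftrightarrow>
    cohomologous A B \<eta> (\<lambda>(s, t). \<omega> (s, t) * a s)"
proof
  have ac: "a v \<in> carrier_mat (vdim A' v) (vdim A v)" if "v \<in> {1..N}" for v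
    using a that by (auto simp: is_hom_def)
  assume "ses_map N Q (id_family B) a (std_ses A B \<eta>) (std_ses A' B \<omega>)"
  from ses_map_stdD[OF rep(1,3) rep(2,3) c id_family_carrier ac this]
  obtain u where u: "\<forall>v\<in>{1..N}. u v \<in> carrier_mat (vdim B v) (vdim A v)"
    "\<forall>(s, t)\<in>Q. id_family B t * \<eta> (s, t) + u t * amap A (s, t) = amap B (s, t) * u s + \<omega> (s, t) * a s"
    by auto
  show "cohomologous A B \<eta> (\<lambda>(s, t). \<omega> (s, t) * a s)"
    by (rule cohomologousI[of u]) (use u cochain_dims[OF c(1)] in \<open>auto simp: id_family_def\<close>)
next
  assume "cohomologous A B \<eta> (\<lambda>(s, t). \<omega> (s, t) * a s)"
  then obtain u where u: "\<forall>v\<in>{1..N}. u v \<in> carrier_mat (vdim B v) (vdim A v)"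
    "\<forall>(s, t)\<in>Q. \<eta> (s, t) + u t * amap A (s, t) = amap B (s, t) * u s + \<omega> (s, t) * a s"
    unfolding cohomologous_def by auto
  have "\<forall>s t. (s, t) \<in> Q \<longrightarrow> id_family B t * \<eta> (s, t) + u t * amap A (s, t) = amap B (s, t) * u s + \<omega> (s, t) * a s"
    using u(2) cochain_dims[OF c(1)] by (auto simp: id_family_def)
  from ses_map_stdI(4)[OF rep(1,3) rep(2,3) c hom_id_family[OF rep(3)] a u(1) this]
  show "ses_map N Q (id_family B) a (std_ses A B \<eta>) (std_ses A' B \<omega>)" .
qed

text \<open>The sequence \<open>w\<close> corresponds to a cochain \<open>\<omega>\<close> on
  \<open>A \<oplus> A\<close> with restrictions \<open>\<eta>\<close> and \<open>\<theta>\<close> to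
  the two summands; the diagonal is the sum of the two inclusions, so the pullback along it is
  \<open>\<eta> + \<theta>\<close>.\<close>

lemma ext_add_cls:
  assumes rep: "rep A" "rep B" and c: "cochain A B \<eta>" "cochain A B \<theta>"
  shows "ext_add N Q A B (cls A B \<eta>) (cls A B \<theta>) = cls A B (\<lambda>a. \<eta> a + \<theta> a)"
proof -
  let ?AA = "direct_sum A A"
  let ?l = "\<lambda>v. inl_mat (vdim A v) (vdim A v) :: 'a mat" and ?r = "\<lambda>v. inr_mat (vdim A v) (vdim A v) :: 'a mat"
  have repAA: "rep ?AA" by (rule is_rep_direct_sum[OF rep(1,1)])
  note mem = std_ses_in_extensions[OF rep] and memAA = std_ses_in_extensions[OF repAA rep(2)]
  note homl = hom_inl[OF rep(1,1)] and homr = hom_inr[OF rep(1,1)]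
  have diag: "diagonal A v = ?l v + ?r v" for v by (simp add: diagonal_def diagonal_eq)
  have homd: "qhom A ?AA (diagonal A)"
    using hom_pair[OF hom_id[OF rep(1)] hom_id[OF rep(1)] rep(1,1,1)] by (simp add: diag[abs_def])
  have car: "?l v \<in> carrier_mat (vdim ?AA v) (vdim A v)" "?r v \<in> carrier_mat (vdim ?AA v) (vdim A v)"
    "diagonal A v \<in> carrier_mat (vdim ?AA v) (vdim A v)" for v
    by (simp_all add: diag)
  note csum = cochain_add[OF c]
  show ?thesis
  proof (intro Set.set_eqI iffI)
    fix y assume "y \<in> ext_add N Q A B (cls A B \<eta>) (cls A B \<theta>)"
    then obtain x x' w where y: "y \<in> extensions N Q A B" and x: "x \<in> cls A B \<eta>" "x' \<in> cls A B \<theta>"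
      and w: "w \<in> extensions N Q ?AA B"
      and xw: "ses_map N Q (codiagonal B) (id_family ?AA) (ses_direct_sum x x') w"
      and yw: "ses_map N Q (id_family B) (diagonal A) y w"
      by (auto simp: ext_add_def)
    have x1: "x \<in> extensions N Q A B" "ext_equiv N Q (std_ses A B \<eta>) x"
      and x2: "x' \<in> extensions N Q A B" "ext_equiv N Q (std_ses A B \<theta>) x'" using x by (auto simp: mem_cls)
    obtain \<omega> where \<omega>: "cochain ?AA B \<omega>" "ext_equiv N Q w (std_ses ?AA B \<omega>)"
      using extension_equiv_std[OF repAA rep(2) w] .
    obtain \<zeta> where \<zeta>: "cochain A B \<zeta>" "ext_equiv N Q y (std_ses A B \<zeta>)"
      using extension_equiv_std[OF rep y] .
    note \<zeta>' = ext_equiv_sym[OF y mem[OF \<zeta>(1)] \<zeta>(2)]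
    have pull: "cohomologous A B \<xi> (\<lambda>(s, t). \<omega> (s, t) * a s)"
      if "ses_map N Q (id_family B) a z w" "z \<in> extensions N Q A B" "ext_equiv N Q (std_ses A B \<xi>) z" "cochain A B \<xi>"
        "qhom A ?AA a" for a z \<xi>
    proof -
      have ac: "a v \<in> carrier_mat (vdim ?AA v) (vdim A v)" if "v \<in> {1..N}" for v
        using \<open>qhom A ?AA a\<close> that by (auto simp: is_hom_def)
      have "ses_map N Q (id_family B) a (std_ses A B \<xi>) w"
        by (rule ses_map_equiv_left[OF that(2) mem[OF that(4)] w that(3,1) id_family_carrier ac])
      then have "ses_map N Q (id_family B) a (std_ses A B \<xi>) (std_ses ?AA B \<omega>)"
        by (rule ses_map_equiv_right[OF mem[OF that(4)] w memAA[OF \<omega>(1)] \<omega>(2) _ id_family_carrier ac])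
      then show ?thesis using ses_map_pullback_iff[OF rep(1) repAA rep(2) that(4) \<omega>(1) that(5)] by blast
    qed
    have lr: "ses_map N Q (id_family B) ?l x w" "ses_map N Q (id_family B) ?r x' w"
      using xw ses_map_codiagonal_iff[OF rep x1(1) x2(1) w] by auto
    note p1 = pull[OF lr(1) x1 c(1) homl] and p2 = pull[OF lr(2) x2 c(2) homr] and p3 = pull[OF yw y \<zeta>' \<zeta>(1) homd]
    let ?\<omega>l = "\<lambda>(s, t). \<omega> (s, t) * ?l s" and ?\<omega>r = "\<lambda>(s, t). \<omega> (s, t) * ?r s" and ?\<omega>d = "\<lambda>(s, t). \<omega> (s, t) * diagonal A s"
    have co: "cochain A B ?\<omega>l" "cochain A B ?\<omega>r" "cochain A B ?\<omega>d"
      by (rule cochain_precompose[OF \<omega>(1) rep(1) car(1)] cochain_precompose[OF \<omega>(1) rep(1) car(2)]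
          cochain_precompose[OF \<omega>(1) rep(1) car(3)])+
    have "cohomologous A B (\<lambda>a. \<eta> a + \<theta> a) (\<lambda>a. ?\<omega>l a + ?\<omega>r a)"
      by (rule cohomologous_add[OF rep c(1) co(1) c(2) co(2) p1 p2])
    then have "cohomologous A B (\<lambda>a. \<eta> a + \<theta> a) ?\<omega>d"
      by (rule cohomologous_cong) (use cochain_dims[OF \<omega>(1)] in \<open>auto simp: diag mult_add_mat\<close>)
    then have "cohomologous A B (\<lambda>a. \<eta> a + \<theta> a) \<zeta>"
      by (rule cohomologous_trans[OF rep csum co(3) \<zeta>(1) _ cohomologous_sym[OF rep \<zeta>(1) co(3) p3]])
    then have "ext_equiv N Q (std_ses A B (\<lambda>a. \<eta> a + \<theta> a)) (std_ses A B \<zeta>)"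
      using ext_equiv_std_iff[OF rep csum \<zeta>(1)] by simp
    then have "ext_equiv N Q (std_ses A B (\<lambda>a. \<eta> a + \<theta> a)) y"
      by (rule ext_equiv_trans[OF mem[OF csum] mem[OF \<zeta>(1)] y _ \<zeta>'])
    then show "y \<in> cls A B (\<lambda>a. \<eta> a + \<theta> a)" using y by (simp add: mem_cls)
  next
    fix y assume "y \<in> cls A B (\<lambda>a. \<eta> a + \<theta> a)"
    then have y: "y \<in> extensions N Q A B" "ext_equiv N Q (std_ses A B (\<lambda>a. \<eta> a + \<theta> a)) y" by (auto simp: mem_cls)
    \<comment> \<open>The row with blocks \<open>\<eta>\<close> and \<open>\<theta>\<close>; its
      restrictions are these two exactly, not just up to coboundaries.\<close>
    define \<omega> where "\<omega> = (\<lambda>(s, t). \<eta> (s, t) * prl_mat (vdim A s) (vdim A s) + \<theta> (s, t) * prr_mat (vdim A s) (vdim A s))"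
    have \<omega>: "cochain ?AA B \<omega>"
      using cochain_dims[OF c(1)] cochain_dims[OF c(2)] by (auto simp: cochain_def \<omega>_def intro!: carrier_matI)
    have \<omega>eq: "\<omega> (s, t) * ?l s = \<eta> (s, t)" "\<omega> (s, t) * ?r s = \<theta> (s, t)" "\<omega> (s, t) * diagonal A s = \<eta> (s, t) + \<theta> (s, t)"
      if st: "(s, t) \<in> Q" for s t
      using cochain_dims[OF c(1) st] cochain_dims[OF c(2) st]
      by (simp_all add: \<omega>_def diag add_mult_mat mult_add_mat mult_mat_assoc)
    have coh: "cohomologous A B \<xi> (\<lambda>(s, t). \<omega> (s, t) * a s)"
      if "cochain A B \<xi>" "\<And>s t. (s, t) \<in> Q \<Longrightarrow> \<omega> (s, t) * a s = \<xi> (s, t)" for \<xi> a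
      by (rule cohomologous_cong[OF cohomologous_refl[OF rep that(1)]]) (use that(2) in auto)
    have "ses_map N Q (id_family B) ?l (std_ses A B \<eta>) (std_ses ?AA B \<omega>)"
      using ses_map_pullback_iff[OF rep(1) repAA rep(2) c(1) \<omega> homl] coh[OF c(1) \<omega>eq(1)] by blast
    moreover have "ses_map N Q (id_family B) ?r (std_ses A B \<theta>) (std_ses ?AA B \<omega>)"
      using ses_map_pullback_iff[OF rep(1) repAA rep(2) c(2) \<omega> homr] coh[OF c(2) \<omega>eq(2)] by blast
    ultimately have 1: "ses_map N Q (codiagonal B) (id_family ?AA)
        (ses_direct_sum (std_ses A B \<eta>) (std_ses A B \<theta>)) (std_ses ?AA B \<omega>)"
      using ses_map_codiagonal_iff[OF rep mem[OF c(1)] mem[OF c(2)] memAA[OF \<omega>]] by blast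
    have "ses_map N Q (id_family B) (diagonal A) (std_ses A B (\<lambda>a. \<eta> a + \<theta> a)) (std_ses ?AA B \<omega>)"
      using ses_map_pullback_iff[OF rep(1) repAA rep(2) csum \<omega> homd] coh[OF csum \<omega>eq(3)] by blast
    then have 2: "ses_map N Q (id_family B) (diagonal A) y (std_ses ?AA B \<omega>)"
      by (rule ses_map_equiv_left[OF mem[OF csum] y(1) memAA[OF \<omega>] ext_equiv_sym[OF mem[OF csum] y] _ id_family_carrier car(3)])
    have "std_ses A B \<eta> \<in> cls A B \<eta>" "std_ses A B \<theta> \<in> cls A B \<theta>"
      using mem[OF c(1)] mem[OF c(2)] ext_equiv_refl[OF mem[OF c(1)]] ext_equiv_refl[OF mem[OF c(2)]] by (simp_all add: mem_cls)
    then show "y \<in> ext_add N Q A B (cls A B \<eta>) (cls A B \<theta>)"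
      unfolding ext_add_def using y(1) memAA[OF \<omega>] 1 2 by blast
  qed
qed

text \<open>\<open>ex\<close> and \<open>inj\<close> say that the class of \<open>\<kappa>\<close>
  is a basis of Ext1. The isomorphism from the field sends \<open>z\<close> to the class of
  \<open>z\<close> times \<open>\<kappa>\<close>.\<close>

lemma
  assumes rep: "rep A" "rep B" and \<kappa>: "cochain A B \<kappa>"
    and ex: "\<And>\<eta>. cochain A B \<eta> \<Longrightarrow> \<exists>z. cohomologous A B \<eta> (\<lambda>a. z \<cdot>\<^sub>m \<kappa> a)"
    and inj: "\<And>z z'. cohomologous A B (\<lambda>a. z \<cdot>\<^sub>m \<kappa> a) (\<lambda>a. z' \<cdot>\<^sub>m \<kappa> a) \<Longrightarrow> z = z'"
  shows Ext1_iso_fieldI: "Ext1_iso_field N Q A B"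
    and generates_Ext1I: "generates_Ext1 N Q A B (std_ses A B \<kappa>)"
proof -
  note cz = cochain_smult[OF \<kappa>]
  have Ext1: "Ext1 N Q A B = range (\<lambda>z. cls A B (\<lambda>a. z \<cdot>\<^sub>m \<kappa> a))"
  proof (intro Set.set_eqI iffI)
    fix X assume "X \<in> Ext1 N Q A B"
    then obtain \<eta> where \<eta>: "cochain A B \<eta>" "X = cls A B \<eta>" unfolding Ext1_eq[OF rep] by blast
    obtain z where "cohomologous A B \<eta> (\<lambda>a. z \<cdot>\<^sub>m \<kappa> a)" using ex[OF \<eta>(1)] by blast
    then have "X = cls A B (\<lambda>a. z \<cdot>\<^sub>m \<kappa> a)" using cls_eq_iff[OF rep \<eta>(1) cz] \<eta>(2) by simp
    then show "X \<in> range (\<lambda>z. cls A B (\<lambda>a. z \<cdot>\<^sub>m \<kappa> a))" by (rule range_eqI)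
  next
    fix X assume "X \<in> range (\<lambda>z. cls A B (\<lambda>a. z \<cdot>\<^sub>m \<kappa> a))"
    then obtain z where "X = cls A B (\<lambda>a. z \<cdot>\<^sub>m \<kappa> a)" by (rule rangeE)
    then show "X \<in> Ext1 N Q A B" unfolding Ext1_eq[OF rep] using cz[of z] by blast
  qed
  have "bij_betw (\<lambda>z. cls A B (\<lambda>a. z \<cdot>\<^sub>m \<kappa> a)) UNIV (Ext1 N Q A B)"
    unfolding bij_betw_def Ext1 using inj cls_eq_iff[OF rep cz cz] by (auto intro: injI)
  moreover have "cls A B (\<lambda>a. (x + y) \<cdot>\<^sub>m \<kappa> a) = ext_add N Q A B (cls A B (\<lambda>a. x \<cdot>\<^sub>m \<kappa> a)) (cls A B (\<lambda>a. y \<cdot>\<^sub>m \<kappa> a))" for x y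
  proof -
    have "(x + y) \<cdot>\<^sub>m \<kappa> a = x \<cdot>\<^sub>m \<kappa> a + y \<cdot>\<^sub>m \<kappa> a" for a by (rule eq_matI) (auto simp: algebra_simps)
    then show ?thesis by (simp add: ext_add_cls[OF rep cz cz])
  qed
  moreover have "cls A B (\<lambda>a. (x * y) \<cdot>\<^sub>m \<kappa> a) = ext_scale N Q A B x (cls A B (\<lambda>a. y \<cdot>\<^sub>m \<kappa> a))" for x y
  proof -
    have "(x * y) \<cdot>\<^sub>m \<kappa> a = x \<cdot>\<^sub>m (y \<cdot>\<^sub>m \<kappa> a)" for a by (rule eq_matI) (auto simp: algebra_simps)
    then show ?thesis by (simp add: ext_scale_cls[OF rep cz])
  qed
  ultimately show "Ext1_iso_field N Q A B" unfolding Ext1_iso_field_def by blast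
  show "generates_Ext1 N Q A B (std_ses A B \<kappa>)"
    unfolding generates_Ext1_def Ext1 cls_def[symmetric] ext_scale_cls[OF rep \<kappa>] by blast
qed

end


section \<open>Extensions between intervals\<close>

text \<open>As a segment, the pair of \<open>common_lo\<close> and \<open>common_hi\<close> stands
  for the intersection of the two intervals; as edges, they are where the intersection ends.\<close>

definition common_lo :: "nat \<times> nat \<Rightarrow> nat \<times> nat \<Rightarrow> nat" where
  "common_lo c d = max (fst c) (fst d)"

definition common_hi :: "nat \<times> nat \<Rightarrow> nat \<times> nat \<Rightarrow> nat" where
  "common_hi c d = min (snd c) (snd d)"

text \<open>A cochain of \<open>F_obj c\<close> by \<open>F_obj d\<close> has a nonempty matrix at
  an arrow exactly when the arrow leads from \<open>c\<close> to \<open>d\<close>; these are the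
  edges carrying one.\<close>

definition linked :: "(nat \<times> nat) set \<Rightarrow> nat \<times> nat \<Rightarrow> nat \<times> nat \<Rightarrow> nat \<Rightarrow> bool" where
  "linked Q c d v \<longleftrightarrow> (v, Suc v) \<in> Q \<and> ivl c v \<and> ivl d (Suc v) \<or> (Suc v, v) \<in> Q \<and> ivl c (Suc v) \<and> ivl d v"

text \<open>
  For intervals \<open>c\<close>, \<open>d\<close> with nonempty intersection, Ext1 of \<open>F_obj c\<close> by \<open>F_obj d\<close> is nonzero iff at both
  ends of the intersection there is an arrow from \<open>c\<close> to \<open>d\<close>.
\<close>

definition obstructed :: "(nat \<times> nat) set \<Rightarrow> nat \<times> nat \<Rightarrow> nat \<times> nat \<Rightarrow> bool" where
  "obstructed Q c d \<longleftrightarrow> common_lo c d < common_hi c d \<and>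
     linked Q c d (common_lo c d) \<and> linked Q c d (common_hi c d)"

lemma ivl_both_iff: "ivl c v \<and> ivl d v \<longleftrightarrow> common_lo c d < v \<and> v \<le> common_hi c d"
  by (auto simp: ivl_def common_lo_def common_hi_def)

lemma mult_empty_mat:
  fixes X Y :: "'a::semiring_0 mat"
  shows "dim_col X = 0 \<Longrightarrow> dim_row Y = 0 \<Longrightarrow> X * Y = 0\<^sub>m (dim_row X) (dim_col Y)"
  by (intro eq_matI) (auto simp: scalar_prod_def)

lemma biproduct_trivial [simp]:
  "inl_mat (Suc 0) 0 = 1\<^sub>m (Suc 0)" "prl_mat (Suc 0) 0 = 1\<^sub>m (Suc 0)"
  "inr_mat 0 (Suc 0) = 1\<^sub>m (Suc 0)" "prr_mat 0 (Suc 0) = 1\<^sub>m (Suc 0)"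
  by (auto simp: inl_mat_def inr_mat_def prl_mat_def prr_mat_def intro!: eq_matI)

text \<open>Transport \<open>\<eta>\<close> to \<open>A'\<close> and \<open>B'\<close> along the
  isomorphisms, solve for \<open>u\<close> there, and transport \<open>u\<close> back.\<close>

lemma (in quiver) all_cohomologous_zero_iso:
  assumes rep: "rep A" "rep B" "rep A'" "rep B'" and iso: "qiso A A'" "qiso B B'"
    and all: "\<And>\<eta>. cochain A' B' \<eta> \<Longrightarrow> cohomologous A' B' \<eta> (zero_cochain A' B')"
    and \<eta>: "cochain A B \<eta>"
  shows "cohomologous A B \<eta> (zero_cochain A B)"
proof -
  obtain \<alpha> \<alpha>' where \<alpha>: "qhom A A' \<alpha>" "qhom A' A \<alpha>'" "\<And>v. v \<in> {1..N} \<Longrightarrow> \<alpha>' v * \<alpha> v = 1\<^sub>m (vdim A v)"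
    using isoE[OF iso(1) rep(1,3)] by metis
  obtain \<beta> \<beta>' where \<beta>: "qhom B B' \<beta>" "qhom B' B \<beta>'" "\<And>v. v \<in> {1..N} \<Longrightarrow> \<beta>' v * \<beta> v = 1\<^sub>m (vdim B v)"
    using isoE[OF iso(2) rep(2,4)] by metis
  note dv = is_hom_dims[OF \<alpha>(1)] is_hom_dims[OF \<alpha>(2)] is_hom_dims[OF \<beta>(1)] is_hom_dims[OF \<beta>(2)]
  define \<eta>' where "\<eta>' = (\<lambda>(s, t). \<beta> t * \<eta> (s, t) * \<alpha>' s)"
  have "cochain A' B' \<eta>'"
    unfolding cochain_def
  proof clarify
    fix s t assume "(s, t) \<in> Q"
    then have v: "s \<in> {1..N}" "t \<in> {1..N}" using Q_vertices by auto
    show "\<eta>' (s, t) \<in> carrier_mat (vdim B' t) (vdim A' s)"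
      using dv[OF v(1)] dv[OF v(2)] by (intro carrier_matI) (simp_all add: \<eta>'_def)
  qed
  then obtain u where u: "\<And>v. v \<in> {1..N} \<Longrightarrow> u v \<in> carrier_mat (vdim B' v) (vdim A' v)"
    "\<And>s t. (s, t) \<in> Q \<Longrightarrow> \<eta>' (s, t) + u t * amap A' (s, t) = amap B' (s, t) * u s + zero_cochain A' B' (s, t)"
    using all unfolding cohomologous_def by blast
  show ?thesis
  proof (rule cohomologousI[of "\<lambda>v. \<beta>' v * (u v * \<alpha> v)"])
    fix v assume v: "v \<in> {1..N}"
    show "\<beta>' v * (u v * \<alpha> v) \<in> carrier_mat (vdim B v) (vdim A v)"
      using dv[OF v] by (intro carrier_matI) simp_all
  next
    fix s t assume st: "(s, t) \<in> Q"
    then have v: "s \<in> {1..N}" "t \<in> {1..N}" using Q_vertices by auto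
    note d = dv[OF v(1)] dv[OF v(2)] carrier_matD[OF u(1)[OF v(1)]] carrier_matD[OF u(1)[OF v(2)]] cochain_dims[OF \<eta> st]
      is_rep_dims[OF rep(1) st] is_rep_dims[OF rep(2) st] is_rep_dims[OF rep(3) st] is_rep_dims[OF rep(4) st]
    have "\<eta> (s, t) = (\<beta>' t * \<beta> t) * \<eta> (s, t) * (\<alpha>' s * \<alpha> s)"
      using \<alpha>(3)[OF v(1)] \<beta>(3)[OF v(2)] d by simp
    also have "\<dots> = \<beta>' t * \<eta>' (s, t) * \<alpha> s" using d by (simp add: \<eta>'_def mult_mat_assoc)
    finally have 1: "\<eta> (s, t) = \<beta>' t * \<eta>' (s, t) * \<alpha> s" .
    have "\<beta>' t * (u t * \<alpha> t) * amap A (s, t) = \<beta>' t * (u t * (\<alpha> t * amap A (s, t)))"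
      using d by (simp add: mult_mat_assoc)
    also have "\<dots> = \<beta>' t * (u t * amap A' (s, t)) * \<alpha> s"
      unfolding is_hom_arrow[OF \<alpha>(1) st] using d by (simp add: mult_mat_assoc)
    finally have "\<eta> (s, t) + \<beta>' t * (u t * \<alpha> t) * amap A (s, t) = \<beta>' t * (\<eta>' (s, t) + u t * amap A' (s, t)) * \<alpha> s"
      using 1 d by (simp add: mult_add_mat add_mult_mat \<eta>'_def)
    also have "\<eta>' (s, t) + u t * amap A' (s, t) = amap B' (s, t) * u s"
      unfolding u(2)[OF st] using d by (simp add: zero_cochain_def)
    also have "\<beta>' t * (amap B' (s, t) * u s) * \<alpha> s = (\<beta>' t * amap B' (s, t)) * (u s * \<alpha> s)"
      using d by (simp add: mult_mat_assoc)
    also have "\<dots> = amap B (s, t) * (\<beta>' s * (u s * \<alpha> s))"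
      unfolding is_hom_arrow[OF \<beta>(2) st] using d by (simp add: mult_mat_assoc)
    finally show "\<eta> (s, t) + \<beta>' t * (u t * \<alpha> t) * amap A (s, t) =
       amap B (s, t) * (\<beta>' s * (u s * \<alpha> s)) + zero_cochain A B (s, t)"
      using d by (simp add: zero_cochain_def)
  qed
qed

text \<open>All blocks are at most 1 by 1. Hence \<open>u\<close> is a scalar function
  \<open>w\<close> on the intersection, and extending it by zero gives the right value of the
  products that pass through a zero space; away from arrows from \<open>c\<close> to
  \<open>d\<close> the equation is between empty matrices.\<close>

lemma (in quiver) cohomologous_F_obj_zero_iff:
  assumes \<eta>: "cochain (F_obj c) (F_obj d) \<eta>"
  shows "cohomologous (F_obj c) (F_obj d) \<eta> (zero_cochain (F_obj c) (F_obj d)) \<longleftrightarrow>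
    (\<exists>w. (\<forall>v. \<not> (ivl c v \<and> ivl d v) \<longrightarrow> w v = 0) \<and>
      (\<forall>s t. (s, t) \<in> Q \<longrightarrow> ivl c s \<longrightarrow> ivl d t \<longrightarrow> \<eta> (s, t) $$ (0, 0) + w t = w s))"
proof
  assume "cohomologous (F_obj c) (F_obj d) \<eta> (zero_cochain (F_obj c) (F_obj d))"
  then obtain u where u: "\<And>v. v \<in> {1..N} \<Longrightarrow> u v \<in> carrier_mat (if ivl d v then 1 else 0) (if ivl c v then 1 else 0)"
    "\<And>s t. (s, t) \<in> Q \<Longrightarrow> \<eta> (s, t) + u t * amap (F_obj c) (s, t) =
      amap (F_obj d) (s, t) * u s + zero_cochain (F_obj c) (F_obj d) (s, t)"
    unfolding cohomologous_def vdim_F_obj by blast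
  define w where "w v = (if ivl c v \<and> ivl d v then u v $$ (0, 0) else 0)" for v
  have "\<eta> (s, t) $$ (0, 0) + w t = w s" if st: "(s, t) \<in> Q" "ivl c s" "ivl d t" for s t
  proof -
    have v: "s \<in> {1..N}" "t \<in> {1..N}" using Q_vertices[OF st(1)] by auto
    note d = carrier_matD[OF u(1)[OF v(1)]] carrier_matD[OF u(1)[OF v(2)]]
    have 1: "(u t * amap (F_obj c) (s, t)) $$ (0, 0) = w t"
      using d st by (cases "ivl c t") (auto simp: w_def amap_F_obj mult_empty_mat)
    have 2: "(amap (F_obj d) (s, t) * u s) $$ (0, 0) = w s"
      using d st by (cases "ivl d s") (auto simp: w_def amap_F_obj mult_empty_mat)
    have "(\<eta> (s, t) + u t * amap (F_obj c) (s, t)) $$ (0, 0) = \<eta> (s, t) $$ (0, 0) + w t"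
      using d st by (subst index_add_mat) (auto simp: 1 simp del: index_mult_mat(1))
    moreover have "(amap (F_obj d) (s, t) * u s + zero_cochain (F_obj c) (F_obj d) (s, t)) $$ (0, 0) = w s"
      using d st by (subst index_add_mat) (auto simp: 2 zero_cochain_def simp del: index_mult_mat(1))
    ultimately show ?thesis using u(2)[OF st(1)] by simp
  qed
  moreover have "\<not> (ivl c v \<and> ivl d v) \<longrightarrow> w v = 0" for v by (simp add: w_def)
  ultimately show "\<exists>w. (\<forall>v. \<not> (ivl c v \<and> ivl d v) \<longrightarrow> w v = 0) \<and>
      (\<forall>s t. (s, t) \<in> Q \<longrightarrow> ivl c s \<longrightarrow> ivl d t \<longrightarrow> \<eta> (s, t) $$ (0, 0) + w t = w s)"
    by (intro exI[of _ w] conjI allI impI) auto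
next
  assume "\<exists>w. (\<forall>v. \<not> (ivl c v \<and> ivl d v) \<longrightarrow> w v = 0) \<and>
      (\<forall>s t. (s, t) \<in> Q \<longrightarrow> ivl c s \<longrightarrow> ivl d t \<longrightarrow> \<eta> (s, t) $$ (0, 0) + w t = w s)"
  then obtain w where w: "\<And>v. \<not> (ivl c v \<and> ivl d v) \<Longrightarrow> w v = 0"
    "\<And>s t. (s, t) \<in> Q \<Longrightarrow> ivl c s \<Longrightarrow> ivl d t \<Longrightarrow> \<eta> (s, t) $$ (0, 0) + w t = w s" by blast
  define u where "u v = mat (if ivl d v then 1 else 0) (if ivl c v then 1 else 0) (\<lambda>_. w v)" for v
  have u_dims: "dim_row (u v) = (if ivl d v then 1 else 0)" "dim_col (u v) = (if ivl c v then 1 else 0)" for v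
    by (simp_all add: u_def)
  show "cohomologous (F_obj c) (F_obj d) \<eta> (zero_cochain (F_obj c) (F_obj d))"
  proof (rule cohomologousI[of u])
    fix s t assume st: "(s, t) \<in> Q"
    note d = cochain_dims[OF \<eta> st]
    show "\<eta> (s, t) + u t * amap (F_obj c) (s, t) =
      amap (F_obj d) (s, t) * u s + zero_cochain (F_obj c) (F_obj d) (s, t)"
    proof (cases "ivl c s \<and> ivl d t")
      case True
      have 1: "(u t * amap (F_obj c) (s, t)) $$ (0, 0) = w t"
        using True w(1)[of t] by (cases "ivl c t") (auto simp: u_def amap_F_obj mult_empty_mat)
      have 2: "(amap (F_obj d) (s, t) * u s) $$ (0, 0) = w s"
        using True w(1)[of s] by (cases "ivl d s") (auto simp: u_def amap_F_obj mult_empty_mat)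
      have "(\<eta> (s, t) + u t * amap (F_obj c) (s, t)) $$ (0, 0) = \<eta> (s, t) $$ (0, 0) + w t"
        using d True by (subst index_add_mat) (auto simp: 1 u_dims simp del: index_mult_mat(1))
      moreover have "(amap (F_obj d) (s, t) * u s + zero_cochain (F_obj c) (F_obj d) (s, t)) $$ (0, 0) = w s"
        using d True by (subst index_add_mat) (auto simp: 2 zero_cochain_def u_dims simp del: index_mult_mat(1))
      ultimately show ?thesis using d True w(2)[OF st]
        by (subst mat_1x1_eq) (simp_all add: zero_cochain_def u_dims del: index_mult_mat(1) index_add_mat(1))
    next
      case False
      then show ?thesis using d by (intro mat_empty_eq) (auto simp: zero_cochain_def u_def)
    qed
  qed (auto simp: u_def)
qed

section \<open>Ext1 of overlapping intervals\<close>

context dynkin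
begin

lemma segs_ivl: "c \<in> segs N \<Longrightarrow> ivl c v \<Longrightarrow> v \<in> {1..N}"
  by (auto simp: segs_def ivl_def)

text \<open>
  Extended by zero outside the intersection, the sought \<open>w\<close> has prescribed differences \<open>\<delta> v\<close> along the
  linked edges; as not both ends are linked, summing \<open>\<delta>\<close> from one end works.
\<close>

lemma cohomologous_zero_if_not_obstructed:
  assumes ov: "common_lo c d < common_hi c d" and no: "\<not> obstructed Q c d"
    and \<eta>: "cochain (F_obj c) (F_obj d) \<eta>"
  shows "cohomologous (F_obj c) (F_obj d) \<eta> (zero_cochain (F_obj c) (F_obj d))"
proof -
  define lo where "lo = common_lo c d"
  define hi where "hi = common_hi c d"
  have lohi: "lo < hi" using ov by (simp add: lo_def hi_def)
  define e where "e s t = \<eta> (s, t) $$ (0, 0)" for s t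
  \<comment> \<open>The relation \<open>e s t + w t = w s\<close> solved for
    \<open>w (Suc v) - w v\<close>; the sign depends on the direction of the arrow.\<close>
  define \<delta> where "\<delta> v = (if (v, Suc v) \<in> Q then - e v (Suc v) else e (Suc v) v)" for v
  \<comment> \<open>\<open>C\<close> is the value at \<open>Suc lo\<close>. If the lower edge is
    linked, it is forced by \<open>w lo = 0\<close>; otherwise it is chosen so that
    \<open>w hi + \<delta> hi = 0\<close>, as a link at the upper edge requires.\<close>
  define C where "C = (if linked Q c d lo then \<delta> lo else - \<delta> hi - (\<Sum>x\<in>{lo<..<hi}. \<delta> x))"
  define w where "w v = (if lo < v \<and> v \<le> hi then C + (\<Sum>x\<in>{lo<..<v}. \<delta> x) else 0)" for v
  have step: "w (Suc v) = w v + \<delta> v" if l: "linked Q c d v" for v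
  proof -
    have "lo \<le> v" "v \<le> hi" using l by (auto simp: linked_def ivl_def lo_def hi_def common_lo_def common_hi_def)
    then consider "v = lo" | "v = hi" | "lo < v" "v < hi" using lohi by linarith
    then show ?thesis
    proof cases
      case 1
      have "{lo<..<Suc lo} = {}" by auto
      then show ?thesis using 1 l lohi by (simp add: w_def C_def)
    next
      case 2
      then have "\<not> linked Q c d lo" using no l lohi by (auto simp: obstructed_def lo_def hi_def)
      then show ?thesis using 2 lohi by (simp add: w_def C_def)
    next
      case 3
      then have "{lo<..<Suc v} = insert v {lo<..<v}" by auto
      then show ?thesis using 3 by (simp add: w_def)
    qed
  qed
  have "e s t + w t = w s" if st: "(s, t) \<in> Q" and iv: "ivl c s" "ivl d t" for s t
    using dynkin st
  proof (cases rule: dynkin_arrow)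
    case 1
    then have "linked Q c d s" using st iv by (auto simp: linked_def)
    from step[OF this] show ?thesis using 1 st by (simp add: \<delta>_def)
  next
    case 2
    then have "linked Q c d t" using st iv by (auto simp: linked_def)
    moreover have "(t, Suc t) \<notin> Q" using dynkin_choice[OF dynkin, of t] 2 st by auto
    ultimately show ?thesis using step[of t] 2 by (simp add: \<delta>_def)
  qed
  moreover have "w v = 0" if "\<not> (ivl c v \<and> ivl d v)" for v
    using that unfolding ivl_both_iff w_def lo_def hi_def by auto
  ultimately show ?thesis unfolding cohomologous_F_obj_zero_iff[OF \<eta>] e_def
    by (intro exI[of _ w] conjI allI impI) auto
qed

text \<open>If both ends are linked, the differences of \<open>w\<close> must sum to zero, which \<open>\<eta>\<close> violates.\<close>

lemma not_all_cohomologous_zero_if_obstructed: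
  assumes obs: "obstructed Q c d"
  shows "\<exists>\<eta>. cochain (F_obj c) (F_obj d) \<eta> \<and>
     \<not> cohomologous (F_obj c) (F_obj d) \<eta> (zero_cochain (F_obj c) (F_obj d) :: 'k::field cochain)"
proof -
  define lo where "lo = common_lo c d"
  define hi where "hi = common_hi c d"
  have lohi: "lo < hi" and links: "linked Q c d lo" "linked Q c d hi"
    using obs by (auto simp: lo_def hi_def obstructed_def)
  \<comment> \<open>Value \<open>1\<close> at the lower edge and \<open>0\<close> elsewhere: the
    interval with the larger left end contains no vertex up to \<open>lo\<close>, so no other arrow
    from \<open>c\<close> to \<open>d\<close> meets \<open>lo\<close>.\<close>
  define \<eta> :: "'k cochain" where "\<eta> = (\<lambda>(s, t). mat (if ivl d t then 1 else 0) (if ivl c s then 1 else 0)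
      (\<lambda>_. if s = lo \<or> t = lo then 1 else 0))"
  have \<eta>: "cochain (F_obj c) (F_obj d) \<eta>" by (auto simp: cochain_def \<eta>_def)
  have "\<not> cohomologous (F_obj c) (F_obj d) \<eta> (zero_cochain (F_obj c) (F_obj d))"
  proof
    assume "cohomologous (F_obj c) (F_obj d) \<eta> (zero_cochain (F_obj c) (F_obj d))"
    then obtain w where w: "\<And>v. \<not> (ivl c v \<and> ivl d v) \<Longrightarrow> w v = 0"
      "\<And>s t. (s, t) \<in> Q \<Longrightarrow> ivl c s \<Longrightarrow> ivl d t \<Longrightarrow> \<eta> (s, t) $$ (0, 0) + w t = w s"
      unfolding cohomologous_F_obj_zero_iff[OF \<eta>] by blast
    have eq: "(if s = lo \<or> t = lo then 1 else 0) + w t = w s" if "(s, t) \<in> Q" "ivl c s" "ivl d t" for s t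
      using w(2)[OF that] that by (simp add: \<eta>_def)
    have w0: "w v = 0" if "\<not> (lo < v \<and> v \<le> hi)" for v
      using w(1)[of v] that unfolding ivl_both_iff lo_def hi_def by blast
    have "w (Suc lo) \<noteq> 0"
    proof
      assume "w (Suc lo) = 0"
      then show False using links(1) eq[of lo "Suc lo"] eq[of "Suc lo" lo] w0[of lo] by (auto simp: linked_def)
    qed
    moreover have "w hi = 0"
      using links(2) eq[of hi "Suc hi"] eq[of "Suc hi" hi] w0[of "Suc hi"] lohi by (auto simp: linked_def)
    moreover have "w (Suc lo) = w v" if "Suc lo \<le> v" "v \<le> hi" for v
      using that
    proof (induction rule: dec_induct)
      case (step v)
      then have iv: "ivl c v" "ivl d v" "ivl c (Suc v)" "ivl d (Suc v)"
        using ivl_both_iff[of c v d] ivl_both_iff[of c "Suc v" d] by (auto simp: lo_def hi_def)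
      have "(v, Suc v) \<in> Q \<or> (Suc v, v) \<in> Q"
        using step links(2) iv lohi
        by (intro arrow_between) (auto simp: linked_def hi_def ivl_def common_hi_def dest!: Q_vertices)
      then have "w (Suc v) = w v" using eq[of v "Suc v"] eq[of "Suc v" v] iv step(1,2) by auto
      then show ?case using step by simp
    qed simp
    ultimately show False using lohi by (metis Suc_leI order_refl)
  qed
  then show ?thesis using \<eta> by blast
qed

end


section \<open>Extensions of disjoint intervals, and the rigidity criterion\<close>

context dynkin
begin

lemma dynkin_asym: "(s, t) \<in> Q \<Longrightarrow> (t, s) \<notin> Q"
proof -
  assume st: "(s, t) \<in> Q"
  with dynkin show ?thesis
    by (cases rule: dynkin_arrow) (use st dynkin_choice[OF dynkin, of s] dynkin_choice[OF dynkin, of t] in auto)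
qed

text \<open>As \<open>s\<close> and \<open>t\<close> are neighbours and neither lies in both
  intervals, one interval ends exactly where the other begins.\<close>

lemma disjoint_arrow:
  assumes dis: "\<not> common_lo c d < common_hi c d" and st: "(s, t) \<in> Q" "ivl c s" "ivl d t"
  shows "snd c = fst d \<and> s = snd c \<and> t = Suc s \<or> snd d = fst c \<and> t = snd d \<and> s = Suc t"
proof -
  have no: "\<not> (ivl c v \<and> ivl d v)" for v using dis ivl_both_iff[of c v d] by auto
  from dynkin st(1) show ?thesis
  proof (cases rule: dynkin_arrow)
    case 1
    then show ?thesis using st no[of s] no[of t] by (auto simp: ivl_def)
  next
    case 2
    then show ?thesis using st no[of s] no[of t] by (auto simp: ivl_def)
  qed
qed

lemma disjoint_arrow_unique:
  assumes dis: "\<not> common_lo c d < common_hi c d" and cd: "c \<in> segs N" "d \<in> segs N"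
    and st: "(s, t) \<in> Q" "ivl c s" "ivl d t" and st': "(s', t') \<in> Q" "ivl c s'" "ivl d t'"
  shows "s' = s \<and> t' = t"
  using disjoint_arrow[OF dis st] disjoint_arrow[OF dis st'] cd by (auto simp: segs_def)

lemma cohomologous_zero_if_no_arrow:
  assumes dis: "\<not> common_lo c d < common_hi c d"
    and no: "\<And>s t. (s, t) \<in> Q \<Longrightarrow> ivl c s \<Longrightarrow> ivl d t \<Longrightarrow> False"
    and \<eta>: "cochain (F_obj c) (F_obj d) \<eta>"
  shows "cohomologous (F_obj c) (F_obj d) \<eta> (zero_cochain (F_obj c) (F_obj d))"
  unfolding cohomologous_F_obj_zero_iff[OF \<eta>] using no by (intro exI[of _ "\<lambda>_. 0"]) blast

text \<open>With the entry \<open>1\<close> at the arrow joining the two intervals, the maps of the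
  extension at arrows coincide with those of the longer interval, so identity matrices form the
  isomorphism.\<close>

lemma ext_rep_join_iso:
  fixes \<kappa> :: "'k::field cochain"
  assumes dis: "\<not> common_lo c d < common_hi c d" and cd: "c \<in> segs N" "d \<in> segs N"
    and st: "(s, t) \<in> Q" "ivl c s" "ivl d t"
  defines "\<kappa> \<equiv> \<lambda>(i, j). if (i, j) = (s, t) then 1\<^sub>m 1 else 0\<^sub>m (if ivl d j then 1 else 0) (if ivl c i then 1 else 0)"
    and "e \<equiv> (min (fst c) (fst d), max (snd c) (snd d))"
  shows "e \<in> segs N" "cochain (F_obj c) (F_obj d) \<kappa>" "qiso (ext_rep (F_obj c) (F_obj d) \<kappa>) (F_obj e)"
proof -
  have no: "\<not> (ivl c v \<and> ivl d v)" for v using dis ivl_both_iff[of c v d] by auto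
  show e: "e \<in> segs N" using cd by (auto simp: e_def segs_def)
  \<comment> \<open>The arrow \<open>(s, t)\<close> makes the intervals adjacent, so their hull
    \<open>e\<close> has no gap.\<close>
  have ivle: "ivl e v \<longleftrightarrow> ivl c v \<or> ivl d v" for v
    using disjoint_arrow[OF dis st] cd by (auto simp: e_def ivl_def segs_def)
  show \<kappa>: "cochain (F_obj c) (F_obj d) \<kappa>" using st by (auto simp: cochain_def \<kappa>_def)
  let ?E = "ext_rep (F_obj c) (F_obj d) \<kappa>"
  have arrow: "amap ?E (i, j) = amap (F_obj e) (i, j)" if ij: "(i, j) \<in> Q" for i j
  proof -
    note simps = ext_rep_def \<kappa>_def amap_F_obj ivle mult_empty_mat
    have uniq: "i = s \<and> j = t" if "ivl c i" "ivl d j" using disjoint_arrow_unique[OF dis cd st ij that] .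
    \<comment> \<open>The joining edge carries only one arrow, and that arrow leads from
      \<open>c\<close> to \<open>d\<close>.\<close>
    have opp: "\<not> (ivl d i \<and> ivl c j)"
    proof
      assume "ivl d i \<and> ivl c j"
      then have "snd d = fst c \<and> i = snd d \<and> j = Suc i \<or> snd c = fst d \<and> j = snd c \<and> i = Suc j"
        using disjoint_arrow[of d c i j] dis ij by (simp add: common_lo_def common_hi_def max.commute min.commute)
      then have "(i, j) = (t, s)" using disjoint_arrow[OF dis st] cd by (auto simp: segs_def)
      then show False using ij dynkin_asym[OF st(1)] by simp
    qed
    consider "\<not> ivl e i" | "\<not> ivl e j" | "ivl c i" "ivl c j" | "ivl d i" "ivl d j" | "ivl c i" "ivl d j"
      using opp ivle by blast
    then show ?thesis
    proof cases
      case 1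
      then show ?thesis using no[of i] no[of j] by (intro mat_empty_eq) (auto simp: ext_rep_def ivle)
    next
      case 2
      then show ?thesis using no[of i] no[of j] by (intro mat_empty_eq) (auto simp: ext_rep_def ivle)
    next
      case 3
      then have "\<not> ivl d i" "\<not> ivl d j" using no by blast+
      moreover from this have "\<not> (i = s \<and> j = t)" using st by blast
      ultimately show ?thesis using 3 by (simp add: simps)
    next
      case 4
      then have "\<not> ivl c i" "\<not> ivl c j" using no by blast+
      moreover from this have "\<not> (i = s \<and> j = t)" using st by blast
      ultimately show ?thesis using 4 by (simp add: simps)
    next
      case 5
      then have "\<not> ivl d i" "\<not> ivl c j" using no by blast+
      then show ?thesis using 5 uniq by (simp add: simps)
    qed
  qed
  have dim: "vdim ?E v = vdim (F_obj e :: 'k rep) v" for v using no[of v] by (auto simp: ivle)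
  have hom: "qhom ?E (F_obj e) (\<lambda>v. 1\<^sub>m (vdim ?E v))" "qhom (F_obj e) ?E (\<lambda>v. 1\<^sub>m (vdim ?E v))"
    using dim by (intro is_homI; simp add: arrow)+
  show "qiso ?E (F_obj e)" by (rule isoI[OF hom]) (use dim in auto)
qed

text \<open>A cochain has a single nonempty entry, a scalar at the joining arrow, and coboundaries
  vanish there; so Ext1 is one-dimensional, generated by the sequence whose middle term is the
  joined interval.\<close>

lemma rigid_pair_if_adjacent:
  assumes rep: "rep A" "rep B" and iso: "qiso A (F_obj c)" "qiso B (F_obj d)" and cd: "c \<in> segs N" "d \<in> segs N"
    and dis: "\<not> common_lo c d < common_hi c d" and st: "(s, t) \<in> Q" "ivl c s" "ivl d t"
  shows "rigid_pair N Q A (B :: 'k::field rep)"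
proof -
  note repF = is_rep_F_obj[of N Q c] is_rep_F_obj[of N Q d]
  have v: "s \<in> {1..N}" "t \<in> {1..N}" using Q_vertices[OF st(1)] by auto
  have no: "\<not> (ivl c v \<and> ivl d v)" for v using dis ivl_both_iff[of c v d] by auto
  define \<kappa>0 :: "'k cochain" where "\<kappa>0 = (\<lambda>(i, j). if (i, j) = (s, t) then 1\<^sub>m 1 else 0\<^sub>m (if ivl d j then 1 else 0) (if ivl c i then 1 else 0))"
  define e where "e = (min (fst c) (fst d), max (snd c) (snd d))"
  note join1 = ext_rep_join_iso(1)[OF dis cd st, folded e_def]
  note join = ext_rep_join_iso(2,3)[OF dis cd st, where 'k = 'k, folded \<kappa>0_def e_def]
  obtain \<alpha> \<alpha>' where \<alpha>: "qhom A (F_obj c) \<alpha>" "qhom (F_obj c) A \<alpha>'" "\<And>v. v \<in> {1..N} \<Longrightarrow> \<alpha>' v * \<alpha> v = 1\<^sub>m (vdim A v)"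
      "\<And>v. v \<in> {1..N} \<Longrightarrow> \<alpha> v * \<alpha>' v = 1\<^sub>m (vdim (F_obj c :: 'k rep) v)"
      "\<And>v. v \<in> {1..N} \<Longrightarrow> vdim A v = (if ivl c v then 1 else 0)"
    using isoE[OF iso(1) rep(1) repF(1)] unfolding vdim_F_obj by metis
  obtain \<beta> \<beta>' where \<beta>: "qhom B (F_obj d) \<beta>" "qhom (F_obj d) B \<beta>'" "\<And>v. v \<in> {1..N} \<Longrightarrow> \<beta>' v * \<beta> v = 1\<^sub>m (vdim B v)"
      "\<And>v. v \<in> {1..N} \<Longrightarrow> \<beta> v * \<beta>' v = 1\<^sub>m (vdim (F_obj d :: 'k rep) v)"
      "\<And>v. v \<in> {1..N} \<Longrightarrow> vdim B v = (if ivl d v then 1 else 0)"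
    using isoE[OF iso(2) rep(2) repF(2)] unfolding vdim_F_obj by metis
  note dv = is_hom_dims[OF \<alpha>(1)] is_hom_dims[OF \<alpha>(2)] is_hom_dims[OF \<beta>(1)] is_hom_dims[OF \<beta>(2)]
  \<comment> \<open>The cochain \<open>\<kappa>0\<close> of the intervals, carried over to
    \<open>A\<close> and \<open>B\<close> along the isomorphisms.\<close>
  define \<kappa> where "\<kappa> = (\<lambda>(i, j). if (i, j) = (s, t) then \<beta>' t * \<alpha> s else 0\<^sub>m (vdim B j) (vdim A i))"
  have \<kappa>: "cochain A B \<kappa>" using dv v by (auto simp: cochain_def \<kappa>_def intro!: carrier_matI)
  have uniq: "i = s \<and> j = t" if "(i, j) \<in> Q" "ivl c i" "ivl d j" for i j
    using disjoint_arrow_unique[OF dis cd st that] .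
  have pushed: "\<beta> j * \<kappa> (i, j) = \<kappa>0 (i, j) * \<alpha> i" if ij: "(i, j) \<in> Q" for i j
  proof -
    have vij: "i \<in> {1..N}" "j \<in> {1..N}" using Q_vertices[OF ij] by auto
    show ?thesis
    proof (cases "(i, j) = (s, t)")
      case True
      have "\<beta> t * (\<beta>' t * \<alpha> s) = (\<beta> t * \<beta>' t) * \<alpha> s" using dv[OF v(1)] dv[OF v(2)] st by (simp add: mult_mat_assoc)
      then show ?thesis using True dv[OF v(1)] st \<beta>(4)[OF v(2)] by (simp add: \<kappa>_def \<kappa>0_def)
    next
      case False
      then show ?thesis using dv[OF vij(1)] dv[OF vij(2)] by (auto simp: \<kappa>_def \<kappa>0_def)
    qed
  qed
  have \<kappa>nz: "\<kappa> (s, t) $$ (0, 0) \<noteq> 0"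
  proof
    assume 0: "\<kappa> (s, t) $$ (0, 0) = 0"
    have "\<alpha> s = \<beta> t * \<kappa> (s, t)" using pushed[OF st(1)] dv[OF v(1)] st by (simp add: \<kappa>0_def)
    then have "\<alpha> s $$ (0, 0) = 0"
      using 0 dv[OF v(2)] cochain_dims[OF \<kappa> st(1)] st \<alpha>(5)[OF v(1)] \<beta>(5)[OF v(2)]
      by (simp add: index_mult_1x1 del: index_mult_mat(1))
    moreover have "(\<alpha>' s * \<alpha> s) $$ (0, 0) = \<alpha>' s $$ (0, 0) * \<alpha> s $$ (0, 0)"
      using dv[OF v(1)] st \<alpha>(5)[OF v(1)] by (intro index_mult_1x1) auto
    ultimately show False using \<alpha>(3)[OF v(1)] \<alpha>(5)[OF v(1)] st by simp
  qed
  have ex: "\<exists>z. cohomologous A B \<eta> (\<lambda>a. z \<cdot>\<^sub>m \<kappa> a)" if \<eta>: "cochain A B \<eta>" for \<eta>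
  proof
    define z where "z = \<eta> (s, t) $$ (0, 0) / \<kappa> (s, t) $$ (0, 0)"
    show "cohomologous A B \<eta> (\<lambda>a. z \<cdot>\<^sub>m \<kappa> a)"
    proof (rule cohomologous_cong[OF cohomologous_refl[OF rep \<eta>]])
      fix i j assume ij: "(i, j) \<in> Q"
      have vij: "i \<in> {1..N}" "j \<in> {1..N}" using Q_vertices[OF ij] by auto
      note d = cochain_dims[OF \<eta> ij] cochain_dims[OF \<kappa> ij] \<alpha>(5)[OF vij(1)] \<beta>(5)[OF vij(2)]
      show "\<eta> (i, j) = z \<cdot>\<^sub>m \<kappa> (i, j)"
      proof (cases "ivl c i \<and> ivl d j")
        case True
        then have "i = s" "j = t" using uniq[OF ij] by auto
        then show ?thesis using d True \<kappa>nz by (subst mat_1x1_eq) (auto simp: z_def)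
      next
        case False
        then show ?thesis using d by (intro mat_empty_eq) auto
      qed
    qed
  qed
  have inj: "z = z'" if coh: "cohomologous A B (\<lambda>a. z \<cdot>\<^sub>m \<kappa> a) (\<lambda>a. z' \<cdot>\<^sub>m \<kappa> a)" for z z'
  proof -
    obtain u where u: "\<And>v. v \<in> {1..N} \<Longrightarrow> u v \<in> carrier_mat (vdim B v) (vdim A v)"
      "\<And>i j. (i, j) \<in> Q \<Longrightarrow> z \<cdot>\<^sub>m \<kappa> (i, j) + u j * amap A (i, j) = amap B (i, j) * u i + z' \<cdot>\<^sub>m \<kappa> (i, j)"
      using coh unfolding cohomologous_def by blast
    note d = carrier_matD[OF u(1)[OF v(1)]] carrier_matD[OF u(1)[OF v(2)]] is_rep_dims[OF rep(1) st(1)] is_rep_dims[OF rep(2) st(1)]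
      cochain_dims[OF \<kappa> st(1)] \<alpha>(5)[OF v(1)] \<beta>(5)[OF v(2)] \<alpha>(5)[OF v(2)] \<beta>(5)[OF v(1)]
    have "\<not> ivl d s" "\<not> ivl c t" using no st by blast+
    \<comment> \<open>Both coboundary terms factor through a zero space: \<open>A\<close> vanishes
      at \<open>t\<close> and \<open>B\<close> at \<open>s\<close>.\<close>
    then have "u t * amap A (s, t) = 0\<^sub>m 1 1" "amap B (s, t) * u s = 0\<^sub>m 1 1"
      using d st by (simp_all add: mult_empty_mat)
    then have "z \<cdot>\<^sub>m \<kappa> (s, t) = z' \<cdot>\<^sub>m \<kappa> (s, t)" using u(2)[OF st(1)] d st by simp
    then have "(z \<cdot>\<^sub>m \<kappa> (s, t)) $$ (0, 0) = (z' \<cdot>\<^sub>m \<kappa> (s, t)) $$ (0, 0)" by simp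
    then show "z = z'" using d st \<kappa>nz by simp
  qed
  have eq1: "\<forall>i j. (i, j) \<in> Q \<longrightarrow> \<beta> j * \<kappa> (i, j) + 0\<^sub>m (vdim (F_obj d :: 'k rep) j) (vdim A j) * amap A (i, j) =
     amap (F_obj d) (i, j) * 0\<^sub>m (vdim (F_obj d :: 'k rep) i) (vdim A i) + \<kappa>0 (i, j) * \<alpha> i"
  proof (intro allI impI)
    fix i j assume ij: "(i, j) \<in> Q"
    have vij: "i \<in> {1..N}" "j \<in> {1..N}" using Q_vertices[OF ij] by auto
    show "\<beta> j * \<kappa> (i, j) + 0\<^sub>m (vdim (F_obj d :: 'k rep) j) (vdim A j) * amap A (i, j) =
     amap (F_obj d) (i, j) * 0\<^sub>m (vdim (F_obj d :: 'k rep) i) (vdim A i) + \<kappa>0 (i, j) * \<alpha> i"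
      using dv[OF vij(1)] dv[OF vij(2)] cochain_dims[OF join(1) ij] is_rep_dims[OF rep(1) ij] pushed[OF ij]
      by simp
  qed
  have z1: "\<forall>v\<in>{1..N}. (0\<^sub>m (vdim (F_obj d :: 'k rep) v) (vdim A v) :: 'k mat) \<in> carrier_mat (vdim (F_obj d :: 'k rep) v) (vdim A v)" by simp
  note h = ses_map_stdI[OF rep repF \<kappa> join(1) \<beta>(1) \<alpha>(1) z1 eq1]
  let ?b = "\<lambda>v. vdim (F_obj d :: 'k rep) v" and ?a = "\<lambda>v. vdim (F_obj c :: 'k rep) v"
  let ?h = "\<lambda>v. inl_mat (?b v) (?a v) * (\<beta> v * prl_mat (vdim B v) (vdim A v) + 0\<^sub>m (?b v) (vdim A v) * prr_mat (vdim B v) (vdim A v)) +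
      inr_mat (?b v) (?a v) * (\<alpha> v * prr_mat (vdim B v) (vdim A v))"
  have "is_iso N Q (ext_rep A B \<kappa>) (ext_rep (F_obj c) (F_obj d) \<kappa>0) ?h"
  proof (rule isomorphicI[OF h(1), where g = "\<lambda>v. block_diag (\<beta>' v) (\<alpha>' v)"])
    fix v assume v: "v \<in> {1..N}"
    have car: "\<alpha> v \<in> carrier_mat (?a v) (vdim A v)" "\<alpha>' v \<in> carrier_mat (vdim A v) (?a v)"
      "\<beta> v \<in> carrier_mat (?b v) (vdim B v)" "\<beta>' v \<in> carrier_mat (vdim B v) (?b v)"
      using \<alpha>(1,2) \<beta>(1,2) v by (auto simp: is_hom_def)
    show "block_diag (\<beta>' v) (\<alpha>' v) \<in> carrier_mat (vdim (ext_rep A B \<kappa>) v) (vdim (ext_rep (F_obj c) (F_obj d) \<kappa>0) v)"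
      using car by (intro carrier_matI) auto
    have eq: "?h v = block_diag (\<beta> v) (\<alpha> v)"
      using carrier_matD[OF car(1)] carrier_matD[OF car(3)] by (simp add: block_diag_eq)
    show "block_diag (\<beta>' v) (\<alpha>' v) * ?h v = 1\<^sub>m (vdim (ext_rep A B \<kappa>) v)"
      unfolding eq using block_diag_inverse[OF car(4,3,2,1) \<beta>(3)[OF v] \<alpha>(3)[OF v]] by simp
    show "?h v * block_diag (\<beta>' v) (\<alpha>' v) = 1\<^sub>m (vdim (ext_rep (F_obj c) (F_obj d) \<kappa>0) v)"
      unfolding eq using block_diag_inverse[OF car(3,4,1,2) \<beta>(4)[OF v] \<alpha>(4)[OF v]] by simp
  qed
  then have "qiso (ext_rep A B \<kappa>) (ext_rep (F_obj c) (F_obj d) \<kappa>0)" by (auto simp: isomorphic_def)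
  then have "qiso (ext_rep A B \<kappa>) (F_obj e)"
    by (rule iso_trans[OF _ join(2) rep_ext_rep[OF rep \<kappa>] rep_ext_rep[OF repF join(1)] is_rep_F_obj])
  then have "indecomposable N Q (ext_rep A B \<kappa>)"
    using indecomposable_iff rep_ext_rep[OF rep \<kappa>] join1 by blast
  then show ?thesis
    unfolding rigid_pair_def
    using Ext1_iso_fieldI[OF rep \<kappa> ex inj] generates_Ext1I[OF rep \<kappa> ex inj] std_ses_in_extensions[OF rep \<kappa>]
    unfolding std_ses_def by blast
qed

text \<open>
  The middle term of an extension of two overlapping intervals has dimension \<open>2\<close> on the overlap and
  is therefore decomposable, so such a pair is rigid only if Ext1 vanishes.
\<close>

theorem rigid_pair_iff:
  assumes rep: "rep A" "rep B" and cd: "c \<in> segs N" "d \<in> segs N" and iso: "qiso A (F_obj c)" "qiso B (F_obj d)"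
  shows "rigid_pair N Q A (B :: 'k::field rep) \<longleftrightarrow> \<not> obstructed Q c d"
proof (cases "obstructed Q c d")
  case True
  obtain \<eta> :: "'k cochain" where \<eta>: "cochain (F_obj c) (F_obj d) \<eta>"
     "\<not> cohomologous (F_obj c) (F_obj d) \<eta> (zero_cochain (F_obj c) (F_obj d))"
    using not_all_cohomologous_zero_if_obstructed[OF True] by blast
  note repF = is_rep_F_obj[of N Q c] is_rep_F_obj[of N Q d]
  have "\<not> Ext1_is_zero N Q A B"
  proof
    assume "Ext1_is_zero N Q A B"
    then have all: "cohomologous A B \<theta> (zero_cochain A B)" if "cochain A B \<theta>" for \<theta>
      using that Ext1_is_zero_iff[OF rep] by blast
    have "cohomologous (F_obj c) (F_obj d) \<eta> (zero_cochain (F_obj c) (F_obj d))"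
      by (rule all_cohomologous_zero_iso[OF repF rep iso_sym[OF iso(1) rep(1) repF(1)] iso_sym[OF iso(2) rep(2) repF(2)] all \<eta>(1)])
    then show False using \<eta>(2) by blast
  qed
  moreover have "\<not> indecomposable N Q E" if x: "(E, f, g) \<in> extensions N Q A B" for E f g
  proof
    assume "indecomposable N Q E"
    then obtain e where e: "e \<in> segs N" "qiso E (F_obj e)" "rep E" using indecomposable_iff by blast
    obtain \<theta> where \<theta>: "cochain A B \<theta>" "ext_equiv N Q (E, f, g) (std_ses A B \<theta>)"
      using extension_equiv_std[OF rep x] .
    then have "qiso E (ext_rep A B \<theta>)" by (auto simp: ext_equiv_def std_ses_def isomorphic_def)
    define v where "v = common_hi c d"
    have v: "ivl c v" "ivl d v" using True ivl_both_iff[of c v d] by (auto simp: obstructed_def v_def)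
    then have vN: "v \<in> {1..N}" using segs_ivl cd by blast
    have "vdim E v = vdim B v + vdim A v"
      using iso_vdim[OF \<open>qiso E (ext_rep A B \<theta>)\<close> e(3) rep_ext_rep[OF rep \<theta>(1)] vN] by simp
    also have "\<dots> = 2" using iso_vdim[OF iso(1) rep(1) repF(1) vN] iso_vdim[OF iso(2) rep(2) repF(2) vN] v by simp
    finally show False using iso_vdim[OF e(2,3) is_rep_F_obj vN] by (simp split: if_splits)
  qed
  ultimately show ?thesis using True unfolding rigid_pair_def by blast
next
  case no: False
  note repF = is_rep_F_obj[of N Q c] is_rep_F_obj[of N Q d]
  have zero: "rigid_pair N Q A B"
    if "\<And>\<eta> :: 'k cochain. cochain (F_obj c) (F_obj d) \<eta> \<Longrightarrow> cohomologous (F_obj c) (F_obj d) \<eta> (zero_cochain (F_obj c) (F_obj d))"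
    unfolding rigid_pair_def Ext1_is_zero_iff[OF rep]
    using all_cohomologous_zero_iso[OF rep repF iso that] by blast
  have "rigid_pair N Q A B"
  proof (cases "common_lo c d < common_hi c d")
    case True
    then show ?thesis using zero cohomologous_zero_if_not_obstructed[OF True no] by blast
  next
    case dis: False
    show ?thesis
    proof (cases "\<exists>s t. (s, t) \<in> Q \<and> ivl c s \<and> ivl d t")
      case True
      then show ?thesis using rigid_pair_if_adjacent[OF rep iso cd dis] by blast
    next
      case False
      then show ?thesis using zero cohomologous_zero_if_no_arrow[OF dis] by blast
    qed
  qed
  then show ?thesis using no by blast
qed

end


section \<open>Crossing segments\<close>

text \<open>A zero \<open>x\<close> gives \<open>D a = m * (a - x)\<close> and
  \<open>D b = m * (b - x)\<close>, where \<open>nz\<close> excludes \<open>m = 0\<close>; from a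
  change of sign the zero is found by linear interpolation.\<close>

lemma affine_zero_iff:
  fixes D :: "real \<Rightarrow> real"
  assumes D: "\<And>x. D x = m * x + q" and ab: "a < b" and nz: "D a \<noteq> 0 \<or> D b \<noteq> 0"
  shows "(\<exists>x. a < x \<and> x < b \<and> D x = 0) \<longleftrightarrow> D a * D b < 0"
proof
  assume "\<exists>x. a < x \<and> x < b \<and> D x = 0"
  then obtain x where x: "a < x" "x < b" "q = - m * x" using D by force
  then have eqs: "D a = m * (a - x)" "D b = m * (b - x)" by (auto simp: D algebra_simps)
  then have "m \<noteq> 0" using nz by auto
  then have "m\<^sup>2 * ((x - a) * (b - x)) > 0" using x by (intro mult_pos_pos) auto
  moreover have "D a * D b = - (m\<^sup>2 * ((x - a) * (b - x)))"
    unfolding eqs by (simp add: power2_eq_square algebra_simps)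
  ultimately show "D a * D b < 0" by linarith
next
  assume neg: "D a * D b < 0"
  define t where "t = D a / (D a - D b)"
  have ne: "D a - D b \<noteq> 0" using neg by (metis eq_iff_diff_eq_0 not_square_less_zero)
  have t: "0 < t" "t < 1" using neg by (auto simp: t_def mult_less_0_iff divide_simps)
  have "D (a + t * (b - a)) = D a + t * (D b - D a)" by (simp add: D algebra_simps)
  also have "t * (D b - D a) = - D a" using ne by (simp add: t_def divide_simps) (simp add: algebra_simps)
  finally have "D (a + t * (b - a)) = 0" by simp
  moreover have "t * (b - a) < b - a"
    using mult_strict_right_mono[OF t(2), of "b - a"] ab by simp
  then have "a + t * (b - a) < b" by linarith
  ultimately show "\<exists>x. a < x \<and> x < b \<and> D x = 0"
    using t ab by (intro exI[of _ "a + t * (b - a)"]) auto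
qed

text \<open>The line through \<open>P\<close> and \<open>R\<close> as a graph over the first
  coordinate. Distinct polygon vertices have distinct first coordinates, so crossings become zeros
  of differences of such affine functions.\<close>

definition height :: "real \<times> real \<Rightarrow> real \<times> real \<Rightarrow> real \<Rightarrow> real" where
  "height P R x = snd P + (snd R - snd P) / (fst R - fst P) * (x - fst P)"

lemma height_ends: "fst P < fst R \<Longrightarrow> height P R (fst P) = snd P \<and> height P R (fst R) = snd R"
  by (simp add: height_def)

lemma height_affine: "height P R x = (snd R - snd P) / (fst R - fst P) * x +
   (snd P - (snd R - snd P) / (fst R - fst P) * fst P)"
  by (simp add: height_def right_diff_distrib)

lemma segment_point_eq:
  fixes P R :: "real \<times> real"
  assumes "fst P < fst R"
  shows "(1 - t) *\<^sub>R P + t *\<^sub>R R = (fst P + t * (fst R - fst P), height P R (fst P + t * (fst R - fst P)))"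
proof -
  have "(snd R - snd P) / (fst R - fst P) * (t * (fst R - fst P)) = t * (snd R - snd P)" using assms by simp
  then show ?thesis by (simp add: height_def prod_eq_iff algebra_simps)
qed

lemma open_segment_height:
  fixes P R :: "real \<times> real"
  assumes "fst P < fst R"
  shows "open_segment P R = {(x, height P R x) | x. fst P < x \<and> x < fst R}"
proof (intro Set.set_eqI iffI)
  fix z assume "z \<in> open_segment P R"
  then obtain t where t: "0 < t" "t < 1" "z = (1 - t) *\<^sub>R P + t *\<^sub>R R" by (auto simp: in_segment)
  have "t * (fst R - fst P) < fst R - fst P"
    using mult_strict_right_mono[OF t(2), of "fst R - fst P"] assms by simp
  then have "fst P + t * (fst R - fst P) < fst R" by linarith
  then show "z \<in> {(x, height P R x) | x. fst P < x \<and> x < fst R}"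
    using t assms unfolding segment_point_eq[OF assms] by auto
next
  fix z assume "z \<in> {(x, height P R x) | x. fst P < x \<and> x < fst R}"
  then obtain x where x: "z = (x, height P R x)" "fst P < x" "x < fst R" by blast
  define t where "t = (x - fst P) / (fst R - fst P)"
  have "x = fst P + t * (fst R - fst P)" using assms by (simp add: t_def)
  then have "z = (1 - t) *\<^sub>R P + t *\<^sub>R R" unfolding segment_point_eq[OF assms] using x(1) by simp
  moreover have "0 < t" "t < 1" using x assms by (auto simp: t_def divide_simps)
  moreover have "P \<noteq> R" using assms by auto
  ultimately show "z \<in> open_segment P R" by (auto simp: in_segment)
qed

lemma closed_point_in_convex:
  fixes P R :: "real \<times> real"
  assumes "convex H" "P \<in> H" "R \<in> H" "fst P < x" "x < fst R"
  shows "(x, height P R x) \<in> H"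
proof -
  have "fst P < fst R" using assms by simp
  from open_segment_height[OF this] have "(x, height P R x) \<in> open_segment P R" using assms by auto
  then show ?thesis
    using assms(1-3) by (meson closed_segment_subset segment_open_subset_closed subsetD)
qed

lemma vertical_convex:
  fixes x a b c :: real
  assumes "convex H" "(x, a) \<in> H" "(x, b) \<in> H" "a \<le> c" "c \<le> b"
  shows "(x, c) \<in> H"
proof (cases "a = b")
  case True
  then show ?thesis using assms by auto
next
  case False
  then have ab: "a < b" using assms by simp
  define t where "t = (c - a) / (b - a)"
  have "0 \<le> t" "t \<le> 1" using ab assms by (auto simp: t_def)
  then have "(1 - t) *\<^sub>R (x, a) + t *\<^sub>R (x, b) \<in> H" using assms(1-3) by (intro convexD_alt) auto
  moreover have "(1 - t) *\<^sub>R (x, a) + t *\<^sub>R (x, b) = (x, a + t * (b - a))" by (simp add: algebra_simps)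
  moreover have "a + t * (b - a) = c" using ab by (simp add: t_def)
  ultimately show ?thesis by simp
qed

section \<open>Vertices of the polygon relative to its chords, and crossings\<close>

locale polygon = dynkin "n + 2" Q for n :: nat and Q +
  fixes p :: "nat \<Rightarrow> real \<times> real"
  assumes polygon: "is_polygon n Q p"
begin

lemma polygon_fst: "i < j \<Longrightarrow> j \<le> n + 2 \<Longrightarrow> fst (p i) < fst (p j)"
  using polygon by (auto simp: is_polygon_def)

text \<open>If a vertex above \<open>L\<close> were not above the chord, it would lie on the
  vertical line segment between a point of \<open>L\<close> and a point of the chord, hence in the
  convex hull of the other vertices; likewise below \<open>L\<close>.\<close>

lemma polygon_side:
  assumes ikj: "i < k" "k < j" "j \<le> n + 2"
  shows "(k, Suc k) \<in> Q \<Longrightarrow> height (p i) (p j) (fst (p k)) < snd (p k)"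
    and "(Suc k, k) \<in> Q \<Longrightarrow> snd (p k) < height (p i) (p j) (fst (p k))"
proof -
  define H where "H = convex hull (p ` ({0..n + 2} - {k}))"
  have H: "convex H" "p l \<in> H" if "l \<le> n + 2" "l \<noteq> k" for l
    using that unfolding H_def by (auto intro!: hull_inc)
  have pk: "p k \<notin> H" using polygon ikj unfolding is_polygon_def H_def by auto
  \<comment> \<open>The chord from \<open>p 0\<close> to \<open>p (n + 2)\<close> lies on
    \<open>L\<close>; it puts the point of \<open>L\<close> at the abscissa of \<open>p k\<close>
    into \<open>H\<close>.\<close>
  have base: "height (p 0) (p (n + 2)) x = snd (p 0)" for x
    using polygon by (simp add: is_polygon_def height_def)
  have 1: "(fst (p k), height (p i) (p j) (fst (p k))) \<in> H"
    using ikj polygon_fst[of i k] polygon_fst[of k j] by (intro closed_point_in_convex H) auto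
  have 2: "(fst (p k), snd (p 0)) \<in> H"
    using closed_point_in_convex[OF H(1) H(2) H(2), of 0 0 "n + 2" "fst (p k)"] ikj
      polygon_fst[of 0 k] polygon_fst[of k "n + 2"] unfolding base by auto
  have k: "k \<in> {1..n + 1}" using ikj by auto
  show "height (p i) (p j) (fst (p k)) < snd (p k)" if "(k, Suc k) \<in> Q"
  proof (rule ccontr)
    assume "\<not> height (p i) (p j) (fst (p k)) < snd (p k)"
    moreover have "snd (p 0) < snd (p k)" using polygon k that by (auto simp: is_polygon_def)
    ultimately have "(fst (p k), snd (p k)) \<in> H" using ikj by (intro vertical_convex[OF H(1) 2 1]) auto
    then show False using pk by simp
  qed
  show "snd (p k) < height (p i) (p j) (fst (p k))" if "(Suc k, k) \<in> Q"
  proof (rule ccontr)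
    assume "\<not> snd (p k) < height (p i) (p j) (fst (p k))"
    moreover have "snd (p k) < snd (p 0)" using polygon k that by (auto simp: is_polygon_def)
    ultimately have "(fst (p k), snd (p k)) \<in> H" using ikj by (intro vertical_convex[OF H(1) 1 2]) auto
    then show False using pk by simp
  qed
qed

lemma up_or_down: "k \<in> {1..n + 1} \<Longrightarrow> (k, Suc k) \<in> Q \<longleftrightarrow> (Suc k, k) \<notin> Q"
  using dynkin_choice[OF dynkin, of k] by auto

lemma polygon_side_sgn:
  assumes "i < k" "k < j" "j \<le> n + 2"
  shows "sgn (height (p i) (p j) (fst (p k)) - snd (p k)) = (if (k, Suc k) \<in> Q then - 1 else 1)"
  using polygon_side[OF assms] up_or_down[of k] assms by (auto simp: sgn_if)

lemma crossing_iff_height: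
  assumes "i < j" "j \<le> n + 2" "k < l" "l \<le> n + 2"
  shows "crossing p (i, j) (k, l) \<longleftrightarrow> (i, j) \<noteq> (k, l) \<and>
    (\<exists>x. max (fst (p i)) (fst (p k)) < x \<and> x < min (fst (p j)) (fst (p l)) \<and>
      height (p i) (p j) x - height (p k) (p l) x = 0)"
proof -
  have "open_segment (p i) (p j) \<inter> open_segment (p k) (p l) \<noteq> {} \<longleftrightarrow>
     (\<exists>x. max (fst (p i)) (fst (p k)) < x \<and> x < min (fst (p j)) (fst (p l)) \<and>
      height (p i) (p j) x - height (p k) (p l) x = 0)"
    unfolding open_segment_height[OF polygon_fst[OF assms(1,2)]] open_segment_height[OF polygon_fst[OF assms(3,4)]]
    by auto
  then show ?thesis by (simp add: crossing_def)
qed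

lemma height_diff_zero_iff:
  assumes "a < b" "height P R a - height P' R' a \<noteq> 0 \<or> height P R b - height P' R' b \<noteq> 0"
  shows "(\<exists>x. a < x \<and> x < b \<and> height P R x - height P' R' x = 0) \<longleftrightarrow>
    (height P R a - height P' R' a) * (height P R b - height P' R' b) < 0"
  by (rule affine_zero_iff[OF _ assms, where m = "(snd R - snd P) / (fst R - fst P) - (snd R' - snd P') / (fst R' - fst P')"
     and q = "(snd P - (snd R - snd P) / (fst R - fst P) * fst P) - (snd P' - (snd R' - snd P') / (fst R' - fst P') * fst P')"])
    (unfold height_affine left_diff_distrib, linarith)

lemma crossing_commute: "crossing p c d \<longleftrightarrow> crossing p d c"
  by (cases c; cases d) (auto simp: crossing_def)

text \<open>The segments cross iff the difference \<open>D\<close> of their heights changes sign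
  between the ends of their common range. Its sign at each end is determined by the arrow at that
  edge, and a change of sign means that both end arrows lead from the same one of the two intervals
  to the other.\<close>

lemma crossing_iff_obstructed_less:
  assumes ij: "i < j" "j \<le> n + 2" and kl: "k < l" "l \<le> n + 2" and ik: "i < k"
  shows "crossing p (i, j) (k, l) \<longleftrightarrow> obstructed Q (i, j) (k, l) \<or> obstructed Q (k, l) (i, j)"
proof (cases "k < j")
  case False
  then have "fst (p j) \<le> fst (p k)" using polygon_fst[of j k] kl by (cases "j = k") auto
  then have "\<not> crossing p (i, j) (k, l)" unfolding crossing_iff_height[OF ij kl] by auto
  moreover have "\<not> obstructed Q (i, j) (k, l)" "\<not> obstructed Q (k, l) (i, j)"
    using False ik by (auto simp: obstructed_def common_lo_def common_hi_def)
  ultimately show ?thesis by blast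
next
  case kj: True
  let ?D = "\<lambda>x. height (p i) (p j) x - height (p k) (p l) x"
  have x: "fst (p i) < fst (p k)" "fst (p k) < fst (p j)" "fst (p k) < fst (p l)"
    using polygon_fst ij kl ik kj by auto
  have Dk: "sgn (?D (fst (p k))) = (if (k, Suc k) \<in> Q then - 1 else 1)"
    using polygon_side_sgn[OF ik kj ij(2)] height_ends[OF x(3)] by simp
  have Dk0: "?D (fst (p k)) \<noteq> 0" using Dk by (auto split: if_splits)
  have lo: "common_lo (i, j) (k, l) = k" "common_lo (k, l) (i, j) = k"
    using ik by (auto simp: common_lo_def)
  have hi: "common_hi (i, j) (k, l) = min j l" "common_hi (k, l) (i, j) = min j l"
    by (auto simp: common_hi_def)
  have link_lo: "linked Q (i, j) (k, l) k \<longleftrightarrow> (k, Suc k) \<in> Q" "linked Q (k, l) (i, j) k \<longleftrightarrow> (Suc k, k) \<in> Q"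
    using ik kj kl by (auto simp: linked_def ivl_def)
  have neg: "a * b < 0 \<longleftrightarrow> sgn a * sgn b = (- 1 :: real)" for a b :: real
    by (auto simp: sgn_if mult_less_0_iff)
  have cross: "crossing p (i, j) (k, l) \<longleftrightarrow>
     sgn (?D (fst (p k))) * sgn (?D (min (fst (p j)) (fst (p l)))) = - 1"
    unfolding crossing_iff_height[OF ij kl] neg[symmetric]
    using height_diff_zero_iff[of "fst (p k)" "min (fst (p j)) (fst (p l))" "p i" "p j" "p k" "p l"] x Dk0 ik
    by (simp add: max_def)
  have uk: "(Suc k, k) \<in> Q \<longleftrightarrow> (k, Suc k) \<notin> Q" using up_or_down[of k] ik kj ij by auto
  consider "j < l" | "l < j" | "j = l" by linarith
  then show ?thesis
  proof cases
    case 1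
    have xj: "fst (p j) < fst (p l)" using polygon_fst 1 kl by auto
    \<comment> \<open>Here an endpoint of the first segment is compared with the second one, while
      at \<open>k\<close> an endpoint of the second is compared with the first; hence the opposite
      sign rule.\<close>
    have Dj: "sgn (?D (fst (p j))) = (if (j, Suc j) \<in> Q then 1 else - 1)"
      using polygon_side_sgn[OF kj 1 kl(2)] height_ends[OF polygon_fst[OF ij]] by (auto simp: sgn_if split: if_splits)
    have uj: "(Suc j, j) \<in> Q \<longleftrightarrow> (j, Suc j) \<notin> Q" using up_or_down[of j] kj 1 kl by auto
    have "linked Q (i, j) (k, l) j \<longleftrightarrow> (j, Suc j) \<in> Q" "linked Q (k, l) (i, j) j \<longleftrightarrow> (Suc j, j) \<in> Q"
      using ij kj 1 by (auto simp: linked_def ivl_def)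
    then have "obstructed Q (i, j) (k, l) \<or> obstructed Q (k, l) (i, j) \<longleftrightarrow> ((k, Suc k) \<in> Q \<longleftrightarrow> (j, Suc j) \<in> Q)"
      unfolding obstructed_def lo hi link_lo using 1 kj uk uj by (auto simp: min_def)
    then show ?thesis unfolding cross using Dk Dj xj by (auto simp: min_def)
  next
    case 2
    have xl: "fst (p l) < fst (p j)" using polygon_fst 2 ij by auto
    have Dl: "sgn (?D (fst (p l))) = (if (l, Suc l) \<in> Q then - 1 else 1)"
      using polygon_side_sgn[of i l j] ik kl 2 ij height_ends[OF x(3)] by simp
    have ul: "(Suc l, l) \<in> Q \<longleftrightarrow> (l, Suc l) \<notin> Q" using up_or_down[of l] kl 2 ij by auto
    have "linked Q (i, j) (k, l) l \<longleftrightarrow> (Suc l, l) \<in> Q" "linked Q (k, l) (i, j) l \<longleftrightarrow> (l, Suc l) \<in> Q"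
      using ik kl 2 by (auto simp: linked_def ivl_def)
    then have "obstructed Q (i, j) (k, l) \<or> obstructed Q (k, l) (i, j) \<longleftrightarrow> ((k, Suc k) \<in> Q \<longleftrightarrow> (l, Suc l) \<notin> Q)"
      unfolding obstructed_def lo hi link_lo using 2 kl uk ul by (auto simp: min_def)
    then show ?thesis unfolding cross using Dk Dl xl by (auto simp: min_def)
  next
    case 3
    \<comment> \<open>At a common right end \<open>D\<close> vanishes, so there is no interior zero;
      likewise both intervals stop there, so no arrow links them at that edge.\<close>
    have "?D (fst (p j)) = 0"
      using height_ends[OF polygon_fst[OF ij]] height_ends[OF polygon_fst[OF kl]] 3 by simp
    then have "\<not> crossing p (i, j) (k, l)" unfolding cross using 3 by simp
    moreover have "\<not> linked Q (i, j) (k, l) j" "\<not> linked Q (k, l) (i, j) j"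
      using 3 by (auto simp: linked_def ivl_def)
    ultimately show ?thesis unfolding obstructed_def hi using 3 by simp
  qed
qed

text \<open>The difference of the heights vanishes at the common left end but not at the nearer
  right end, so it has no zero in between.\<close>

lemma not_crossing_common_left:
  assumes "i < j" "j \<le> n + 2" "i < l" "l \<le> n + 2"
  shows "\<not> crossing p (i, j) (i, l)"
proof -
  have *: "\<not> crossing p (i, j) (i, l)" if jl: "i < j" "j < l" "l \<le> n + 2" for j l
  proof -
    have ij: "i < j" "j \<le> n + 2" and il: "i < l" "l \<le> n + 2" using jl by auto
    have x: "fst (p i) < fst (p j)" "fst (p j) < fst (p l)" using polygon_fst jl by auto
    let ?D = "\<lambda>x. height (p i) (p j) x - height (p i) (p l) x"
    have 0: "?D (fst (p i)) = 0"
      using height_ends[OF polygon_fst[OF ij]] height_ends[OF polygon_fst[OF il]] by simp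
    have "?D (fst (p j)) \<noteq> 0"
      using polygon_side_sgn[OF jl] height_ends[OF x(1)] by (auto split: if_splits)
    then show ?thesis unfolding crossing_iff_height[OF ij il]
      using height_diff_zero_iff[of "fst (p i)" "fst (p j)" "p i" "p j" "p i" "p l"] x 0 by simp
  qed
  consider "j < l" | "l < j" | "j = l" by linarith
  then show ?thesis
  proof cases
    case 3
    then show ?thesis by (simp add: crossing_def)
  qed (use * assms crossing_commute in blast)+
qed

theorem crossing_iff_obstructed:
  assumes c: "c \<in> segs (n + 2)" and d: "d \<in> segs (n + 2)"
  shows "crossing p c d \<longleftrightarrow> obstructed Q c d \<or> obstructed Q d c"
proof -
  obtain i j where cij: "c = (i, j)" "i < j" "j \<le> n + 2" using c by (auto simp: segs_def)
  obtain k l where dkl: "d = (k, l)" "k < l" "l \<le> n + 2" using d by (auto simp: segs_def)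
  consider "i < k" | "k < i" | "i = k" by linarith
  then show ?thesis
  proof cases
    case 1
    then show ?thesis using crossing_iff_obstructed_less[OF cij(2,3) dkl(2,3)] cij dkl by simp
  next
    case 2
    then show ?thesis using crossing_iff_obstructed_less[OF dkl(2,3) cij(2,3)] crossing_commute[of c d] cij dkl by auto
  next
    case 3
    have "\<not> linked Q c d i" "\<not> linked Q d c i" using 3 cij dkl by (auto simp: linked_def ivl_def)
    then have "\<not> obstructed Q c d" "\<not> obstructed Q d c" using 3 cij dkl by (auto simp: obstructed_def common_lo_def)
    then show ?thesis using not_crossing_common_left[OF cij(2,3), of l] 3 cij dkl by simp
  qed
qed

end


section \<open>The bijection\<close>

lemma (in quiver) iso_class_eq_iff:
  assumes "rep R" "rep S"
  shows "iso_class N Q R = iso_class N Q S \<longleftrightarrow> qiso R S"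
proof
  assume "iso_class N Q R = iso_class N Q S"
  moreover have "S \<in> iso_class N Q S" using assms iso_refl by (simp add: iso_class_def)
  ultimately show "qiso R S" by (auto simp: iso_class_def)
next
  assume RS: "qiso R S"
  show "iso_class N Q R = iso_class N Q S"
    unfolding iso_class_def using iso_trans[OF RS _ assms] iso_trans[OF iso_sym[OF RS assms] _ assms(2,1)] by blast
qed

section \<open>Maximal almost rigid representations and triangulations\<close>

context polygon
begin

abbreviation "segment_list T \<equiv> filter (\<lambda>c. c \<in> T) (List.product [0..<n + 3] [0..<n + 3])"

lemma segments_eq: "segments n = segs (n + 2)"
  by (simp add: segments_def segs_def)

lemma set_segment_list: "T \<subseteq> segs (n + 2) \<Longrightarrow> set (segment_list T) = T"
  by (auto simp: segs_def)

lemma distinct_segment_list: "distinct (segment_list T)"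
  by (intro distinct_filter distinct_product) auto

text \<open>The quantifiers run over ordered pairs, so one order of \<open>obstructed\<close> covers
  both.\<close>

lemma noncrossing_iff:
  assumes "T \<subseteq> segs (n + 2)"
  shows "noncrossing p T \<longleftrightarrow> (\<forall>c\<in>T. \<forall>d\<in>T. \<not> obstructed Q c d)"
  using crossing_iff_obstructed assms unfolding noncrossing_def by (meson subsetD)

lemma almost_rigid_iff_noncrossing:
  assumes "rep R" "qiso R (ivl_sum xs)" "set xs \<subseteq> segs (n + 2)"
  shows "almost_rigid (n + 2) Q (R :: 'k::field rep) \<longleftrightarrow> distinct xs \<and> noncrossing p (set xs)"
  unfolding noncrossing_iff[OF assms(3)]
  using rigid_pair_iff by (intro almost_rigid_iff[OF assms]) blast

text \<open>A further noncrossing segment gives a further interval summand; conversely, a further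
  nonzero summand decomposes into intervals whose segments could be added.\<close>

lemma maximal_almost_rigid_iff:
  assumes R: "rep R" "qiso R (ivl_sum xs)" and xs: "set xs \<subseteq> segs (n + 2)"
  shows "maximal_almost_rigid (n + 2) Q (R :: 'k::field rep) \<longleftrightarrow> distinct xs \<and> set xs \<in> triangulations n p"
proof
  assume max: "maximal_almost_rigid (n + 2) Q R"
  then have rigid: "distinct xs" "noncrossing p (set xs)"
    using almost_rigid_iff_noncrossing[OF R xs] by (auto simp: maximal_almost_rigid_def)
  have "T = set xs" if T: "T \<subseteq> segs (n + 2)" "noncrossing p T" "set xs \<subseteq> T" for T
  proof (rule ccontr)
    assume "T \<noteq> set xs"
    then obtain c where c: "c \<in> T" "c \<notin> set xs" using T by blast
    have cs: "c \<in> segs (n + 2)" using c T by blast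
    have c1: "qiso (F_obj c) (ivl_sum [c] :: 'k rep)" using iso_refl[OF is_rep_F_obj] by simp
    have "noncrossing p (set (xs @ [c]))"
      using T c unfolding noncrossing_def by auto
    then have "almost_rigid (n + 2) Q (direct_sum R (F_obj c))"
      using almost_rigid_iff_noncrossing[OF is_rep_direct_sum[OF R(1) is_rep_F_obj]
          direct_sum_iso_ivl_sum[OF R(2) c1 R(1) is_rep_F_obj]] xs cs c rigid by auto
    moreover have "\<not> is_zero_rep (n + 2) (F_obj c :: 'k rep)"
      using indecomposable_F_obj[OF cs, where 'k = 'k] unfolding indecomposable_def by blast
    ultimately show False using max is_rep_F_obj unfolding maximal_almost_rigid_def by blast
  qed
  then show "distinct xs \<and> set xs \<in> triangulations n p"
    using rigid xs by (simp add: triangulations_def segments_eq)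
next
  assume tri: "distinct xs \<and> set xs \<in> triangulations n p"
  then have "almost_rigid (n + 2) Q R"
    using almost_rigid_iff_noncrossing[OF R xs] by (simp add: triangulations_def)
  moreover have "\<not> almost_rigid (n + 2) Q (direct_sum R M)"
    if M: "rep M" "\<not> is_zero_rep (n + 2) M" for M
  proof
    assume ar: "almost_rigid (n + 2) Q (direct_sum R M)"
    obtain ys where ys: "set ys \<subseteq> segs (n + 2)" "qiso M (ivl_sum ys)" using decompositionE[OF M(1)] .
    have "ys \<noteq> []" using M ys is_zero_rep_iso[OF ys(2) M(1) rep_ivl_sum] by (auto simp: is_zero_rep_zero_rep)
    have "distinct (xs @ ys)" "noncrossing p (set (xs @ ys))"
      using almost_rigid_iff_noncrossing[OF is_rep_direct_sum[OF R(1) M(1)] direct_sum_iso_ivl_sum[OF R(2) ys(2) R(1) M(1)]]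
        ar xs ys by auto
    \<comment> \<open>Maximality puts every segment of \<open>ys\<close> into \<open>xs\<close>
      already, which contradicts distinctness unless \<open>ys\<close> is empty.\<close>
    moreover have "set (xs @ ys) = set xs"
      using tri calculation(2) xs ys unfolding triangulations_def segments_eq by auto
    ultimately show False using \<open>ys \<noteq> []\<close> by (cases ys) auto
  qed
  ultimately show "maximal_almost_rigid (n + 2) Q R" by (simp add: maximal_almost_rigid_def)
qed

lemma triangulation_subset: "T \<in> triangulations n p \<Longrightarrow> T \<subseteq> segs (n + 2)"
  by (simp add: triangulations_def segments_eq)

text \<open>Surjectivity rests on the existence of interval decompositions, injectivity on their
  uniqueness.\<close>

lemma F_triangulation_bij:
  "bij_betw (F_triangulation n Q :: (nat \<times> nat) set \<Rightarrow> 'k::field rep set) (triangulations n p) (mar (n + 2) Q)"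
proof (rule bij_betw_imageI)
  show "inj_on (F_triangulation n Q :: (nat \<times> nat) set \<Rightarrow> 'k rep set) (triangulations n p)"
  proof (rule inj_onI)
    fix T T' assume T: "T \<in> triangulations n p" "T' \<in> triangulations n p"
      and eq: "(F_triangulation n Q T :: 'k rep set) = F_triangulation n Q T'"
    note sub = triangulation_subset[OF T(1)] triangulation_subset[OF T(2)]
    have "qiso (ivl_sum (segment_list T)) (ivl_sum (segment_list T') :: 'k rep)"
      using eq by (simp only: F_triangulation_def iso_class_eq_iff[OF rep_ivl_sum rep_ivl_sum])
    then have "mset (segment_list T) = mset (segment_list T')"
      using ivl_sum_iso_iff[of "segment_list T" "segment_list T'"] sub set_segment_list by metis
    then have "set (segment_list T) = set (segment_list T')" by (rule mset_eq_setD)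
    then show "T = T'" using set_segment_list sub by metis
  qed
  show "F_triangulation n Q ` triangulations n p = (mar (n + 2) Q :: 'k rep set set)"
  proof (intro Set.set_eqI iffI)
    fix X :: "'k rep set" assume "X \<in> F_triangulation n Q ` triangulations n p"
    then obtain T where T: "T \<in> triangulations n p" "X = F_triangulation n Q T" by blast
    note sub = triangulation_subset[OF T(1)]
    have "maximal_almost_rigid (n + 2) Q (ivl_sum (segment_list T) :: 'k rep)"
      using maximal_almost_rigid_iff[OF rep_ivl_sum iso_refl[OF rep_ivl_sum], of "segment_list T"]
        sub set_segment_list[OF sub] distinct_segment_list T(1) by metis
    then show "X \<in> mar (n + 2) Q" unfolding T(2) F_triangulation_def mar_def by blast
  next
    fix X :: "'k rep set" assume "X \<in> mar (n + 2) Q"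
    then obtain R where R: "maximal_almost_rigid (n + 2) Q R" "X = iso_class (n + 2) Q R" by (auto simp: mar_def)
    then have rep: "rep R" by (simp add: maximal_almost_rigid_def almost_rigid_def)
    obtain xs where xs: "set xs \<subseteq> segs (n + 2)" "qiso R (ivl_sum xs)" using decompositionE[OF rep] .
    have tri: "distinct xs" "set xs \<in> triangulations n p"
      using maximal_almost_rigid_iff[OF rep xs(2,1)] R(1) by auto
    have "mset xs = mset (segment_list (set xs))"
      using tri(1) distinct_segment_list set_segment_list[OF xs(1)] set_eq_iff_mset_eq_distinct by metis
    then have "qiso R (ivl_sum (segment_list (set xs)))"
      by (intro iso_trans[OF xs(2) ivl_sum_mset_cong rep rep_ivl_sum rep_ivl_sum])
    then have "X = F_triangulation n Q (set xs)"
      unfolding R(2) F_triangulation_def using iso_class_eq_iff[OF rep rep_ivl_sum] by blast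
    then show "X \<in> F_triangulation n Q ` triangulations n p" using tri(2) by blast
  qed
qed

end

theorem theorem3:
  fixes n :: nat
    and Q :: "(nat \<times> nat) set"
    and p :: "nat \<Rightarrow> real \<times> real"
  assumes "dynkin_quiver_A (n + 2) Q"
    and "is_polygon n Q p"
  shows "bij_betw (F_triangulation n Q :: (nat \<times> nat) set \<Rightarrow> 'k::alg_closed_field rep set)
    (triangulations n p) (mar (n + 2) Q)"
proof -
  interpret polygon n Q p by unfold_locales (use assms in auto)
  show ?thesis by (rule F_triangulation_bij)
qed

end
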